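(* Let $d\ge 2$ be an integer, let $E$ be the set of edges of $\mathbb{Z}^d$, and let $\nu$ be a nearly gamma probability measure on $\mathbb{R}^+=[0,\infty)$ with finite second moment, $\int y^2\,d\nu(y)<\infty$. Let $\mu=\nu^{\otimes E}$ on $\mathbb{R}_+^E$, and for $v\in\mathbb{Z}^d$ let $f_v(x)=d_x(0,v)$ be the first passage time from $0$ to $v$. Then $$\mathrm{Var}_\mu(f_v)=O\left(\frac{|v|}{\log|v|}\right)$$ as $|v|$ tends to infinity, where $|v|$ is the $L^1$-norm of $v$.
   Context: First Passage Percolation: for $x=(x_e)_{e\in E}\in\mathbb{R}_+^E$ and vertices $u,w\in\mathbb{Z}^d$, $d_x(u,w)=\inf_{\alpha}\sum_{e\in\alpha}x_e$, the infimum being over all paths $\alpha$ in $\mathbb{Z}^d$ (nearest-neighbour lattice) with end points $u$ and $w$. $\mathrm{Var}_\mu$ denotes the variance under $\mu$. Let $g(x)=\frac{1}{\sqrt{2\pi}}e^{-x^2/2}$ and $G(x)=\int_{-\infty}^x g(u)\,du$ (standard Gaussian density and distribution function), with the convention $g\circ G^{-1}(0)=g\circ G^{-1}(1)=0$. Definition (nearly gamma). Let $\nu$ be a probability measure on $\mathbb{R}^+$ absolutely continuous with respect to Lebesgue measure, with density $h$ and distribution function $H(t)=\int_0^t h(u)\,du$. $\nu$ is nearly gamma if: (i) the set $I$ of $t\ge 0$ such that $h(t)>0$ is an interval; (ii) $h$ restricted to $I$ is continuous; (iii) the map $\psi:I\to\mathbb{R}$, $\psi(y)=\dfrac{g\circ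 G^{-1}(H(y))}{h(y)}$, is such that (a) there exists a real $A>0$ with $\psi(y)\le A\sqrt{y}$ for all $y\in I$; and (b) there exists $\varepsilon>0$ such that, as $a\to 0$, $\nu(\{y:\psi(y)\le a\})=O(a^{\varepsilon})$. *)

theory Defs
  imports "HOL-Probability.Probability" "HOL-Library.Landau_Symbols"
begin

definition l1_norm :: "int ^ 'd \<Rightarrow> real" where
  "l1_norm v = (\<Sum>i\<in>UNIV. real_of_int \<bar>v $ i\<bar>)"

definition lattice_edges :: "(int ^ 'd) set set" where
  "lattice_edges = {{u, w} | u w. l1_norm (u - w) = 1}"

text \<open>A path is the nonempty list of its successive vertices; it need not be self-avoiding.\<close>

definition lattice_path :: "int ^ 'd \<Rightarrow> int ^ 'd \<Rightarrow> (int ^ 'd) list \<Rightarrow> bool" where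
  "lattice_path u w p \<longleftrightarrow>
     p \<noteq> [] \<and> hd p = u \<and> last p = w \<and> successively (\<lambda>a b. {a, b} \<in> lattice_edges) p"

definition path_time :: "((int ^ 'd) set \<Rightarrow> real) \<Rightarrow> (int ^ 'd) list \<Rightarrow> real" where
  "path_time x p = (\<Sum>i<length p - 1. x {p ! i, p ! Suc i})"

definition fpp_dist :: "((int ^ 'd) set \<Rightarrow> real) \<Rightarrow> int ^ 'd \<Rightarrow> int ^ 'd \<Rightarrow> real" where
  "fpp_dist x u w = (INF p\<in>{p. lattice_path u w p}. path_time x p)"

definition std_normal_cdf :: "real \<Rightarrow> real" where
  "std_normal_cdf x = (LBINT u:{..x}. std_normal_density u)"

text \<open>This is \<open>g \<circ> G\<inverse>\<close> on \<open>[0, 1]\<close>, with the value 0 at both end points by convention.\<close>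

definition gauss_profile :: "real \<Rightarrow> real" where
  "gauss_profile p = (if p = 0 \<or> p = 1 then 0 else std_normal_density (inv std_normal_cdf p))"

definition dens_support :: "(real \<Rightarrow> real) \<Rightarrow> real set" where
  "dens_support h = {t. 0 \<le> t \<and> 0 < h t}"

definition dens_cdf :: "(real \<Rightarrow> real) \<Rightarrow> real \<Rightarrow> real" where
  "dens_cdf h t = (LBINT u:{0..t}. h u)"

definition ng_psi :: "(real \<Rightarrow> real) \<Rightarrow> real \<Rightarrow> real" where
  "ng_psi h y = gauss_profile (dens_cdf h y) / h y"

text \<open>The space of \<open>\<nu>\<close> is the half-line \<open>{0..}\<close>. Conditions (i) to (iii) depend on the version
  of the density, so a law is nearly gamma if some version of its density satisfies them.\<close>

definition nearly_gamma :: "real measure \<Rightarrow> bool" where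
  "nearly_gamma \<nu> \<longleftrightarrow> prob_space \<nu> \<and>
     (\<exists>h. h \<in> borel_measurable (restrict_space lborel {0..}) \<and>
          (\<forall>t\<ge>0. 0 \<le> h t) \<and>
          \<nu> = density (restrict_space lborel {0..}) (\<lambda>t. ennreal (h t)) \<and>
          is_interval (dens_support h) \<and>
          continuous_on (dens_support h) h \<and>
          (\<exists>A>0. \<forall>y\<in>dens_support h. ng_psi h y \<le> A * sqrt y) \<and>
          (\<exists>\<epsilon>>0. (\<lambda>a. measure \<nu> {y \<in> dens_support h. ng_psi h y \<le> a})
                      \<in> O[at_right 0](\<lambda>a. a powr \<epsilon>)))"

text \<open>As \<open>\<nu>\<close> has space \<open>{0..}\<close>, the space of this product consists of the nonnegative families
  indexed by the edges.\<close>

definition fpp_measure :: "real measure \<Rightarrow> ((int ^ 'd) set \<Rightarrow> real) measure" where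
  "fpp_measure \<nu> = PiM lattice_edges (\<lambda>_. \<nu>)"

end

theory Submission
  imports Defs "HOL-Library.Nat_Bijection" "HOL-Real_Asymp.Real_Asymp"
begin

text \<open>
  The passage time of an edge is \<open>T U\<close> with \<open>U\<close> uniform and \<open>T\<close> the quantile function of \<open>\<nu>\<close>; truncating \<open>U\<close>
  to its first \<open>n\<close> binary digits turns the passage times in a finite box into functions on a discrete
  cube (the encoding of Damron, Hanson and Sosoe). There, a logarithmic Sobolev inequality applied to
  the martingale differences of \<open>f\<close> gives, with \<open>D\<^sub>j\<close> the difference in direction \<open>j\<close>,
  \<open>ln M * Var f \<le> \<Sum>\<^sub>j E (D\<^sub>j f)\<^sup>2 + M * \<Sum>\<^sub>j (E \<bar>D\<^sub>j f\<bar>)\<^sup>2\<close> for every \<open>M > 0\<close>.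
  As a function of one passage time, a first passage time is \<open>c + min t x\<^sub>e\<close>, so both \<open>\<Sum>\<^sub>i E (D\<^sub>e\<^sub>i f)\<^sup>2\<close>
  and \<open>\<Sum>\<^sub>i E \<bar>D\<^sub>e\<^sub>i f\<bar>\<close>, the sums being over the digits of \<open>e\<close>, are at most a constant times the expectation
  of \<open>1 + log (1 / U\<^sub>e)\<close> on the event that the geodesic uses \<open>e\<close>. Since \<open>\<nu>\<close> has no atom at 0, counting
  self-avoiding paths bounds the sum of \<open>1 + log (1 / U\<^sub>e)\<close> along a path by its passage time, in mean.
  Replacing \<open>f\<close> by its average over \<open>|v|\<^bsup>1/2\<^esup>\<close> translates, as Benjamini, Kalai and Schramm do, changes it
  little and makes each \<open>E \<bar>D\<^sub>e\<^sub>i f\<bar>\<close> smaller than a negative power of \<open>|v|\<close>, so that \<open>M\<close> can be a positive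
  power of \<open>|v|\<close>. The bound \<open>\<psi> y \<le> A * sqrt y\<close> provides the moments needed on the way: it
  makes the tail \<open>1 - H\<close> decay at least like \<open>exp (- c * sqrt y)\<close>.
\<close>


section \<open>An inequality of Falik and Samorodnitsky on the discrete cube\<close>

text \<open>The scales are tied together as follows. The translates run over a two-dimensional
  square of side \<open>k^2\<close> with \<open>k\<close> about \<open>|v|^(1/8)\<close>. There are
  \<open>k^4\<close> of them, and moving the end points costs order \<open>k^4\<close>, about
  \<open>|v|^(1/2)\<close>, in mean square. The influence of an edge on a translate is controlled by
  how much the geodesic of that translate uses it, and a geodesic spends expected length of order at
  most \<open>k^3\<close> in such a square. Averaging thus leaves influences of order
  \<open>1 / k\<close>, so \<open>M = k\<close> is admissible. A segment of translates would have no
  more points than the length a geodesic may spend near it; the gain comes from the second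
  coordinate direction. On the cube the obstacle is that one edge carries \<open>n\<close> digits,
  while the sum of its influences must not grow with \<open>n\<close>. Monotonicity of the quantile
  function makes the differences telescope and leaves only leading zeros or ones. All bounds are
  uniform in the number of digits and in the box, since both tend to infinity at the end.\<close>

definition cube_avg :: "'a set \<Rightarrow> ('a set \<Rightarrow> real) \<Rightarrow> real" where
  "cube_avg S f = (\<Sum>A\<in>Pow S. f A) / 2 ^ card S"

definition flip :: "'a \<Rightarrow> 'a set \<Rightarrow> 'a set" where
  "flip j A = (if j \<in> A then A - {j} else insert j A)"

text \<open>The full difference, twice the usual discrete derivative. Its sign depends on the digit;
  only squares and absolute values enter the inequalities.\<close>

definition cube_diff :: "'a \<Rightarrow> ('a set \<Rightarrow> real) \<Rightarrow> 'a set \<Rightarrow> real" where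
  "cube_diff j f A = f A - f (flip j A)"

definition cube_ent :: "'a set \<Rightarrow> ('a set \<Rightarrow> real) \<Rightarrow> real" where
  "cube_ent S F = cube_avg S (\<lambda>A. F A * ln (F A)) - cube_avg S F * ln (cube_avg S F)"

lemma cube_avg_empty [simp]: "cube_avg {} f = f {}"
  by (simp add: cube_avg_def)

lemma cube_avg_insert:
  assumes "finite S" "j \<notin> S"
  shows "cube_avg (insert j S) f = (cube_avg S f + cube_avg S (\<lambda>A. f (insert j A))) / 2"
proof -
  have inj: "inj_on (insert j) (Pow S)"
    using assms(2) by (auto simp: inj_on_def insert_ident)
  have "(\<Sum>A\<in>Pow (insert j S). f A) = (\<Sum>A\<in>Pow S. f A) + (\<Sum>A\<in>insert j ` Pow S. f A)"
    unfolding Pow_insert using assms by (intro sum.union_disjoint) auto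
  also have "(\<Sum>A\<in>insert j ` Pow S. f A) = (\<Sum>A\<in>Pow S. f (insert j A))"
    using inj by (simp add: sum.reindex)
  finally show ?thesis using assms by (simp add: cube_avg_def add_divide_distrib)
qed

lemma cube_avg_cong: "(\<And>A. A \<subseteq> S \<Longrightarrow> f A = g A) \<Longrightarrow> cube_avg S f = cube_avg S g"
  unfolding cube_avg_def by (auto intro!: arg_cong2[where f="(/)"] sum.cong)

lemma cube_avg_mono: "(\<And>A. A \<subseteq> S \<Longrightarrow> f A \<le> g A) \<Longrightarrow> cube_avg S f \<le> cube_avg S g"
  unfolding cube_avg_def by (auto intro!: divide_right_mono sum_mono)

lemma cube_avg_nonneg: "(\<And>A. A \<subseteq> S \<Longrightarrow> 0 \<le> f A) \<Longrightarrow> 0 \<le> cube_avg S f"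
  unfolding cube_avg_def by (auto intro!: divide_nonneg_nonneg sum_nonneg)

lemma cube_avg_add: "cube_avg S (\<lambda>A. f A + g A) = cube_avg S f + cube_avg S g"
  by (simp add: cube_avg_def sum.distrib add_divide_distrib)

lemma cube_avg_diff: "cube_avg S (\<lambda>A. f A - g A) = cube_avg S f - cube_avg S g"
  by (simp add: cube_avg_def sum_subtractf diff_divide_distrib)

lemma cube_avg_cmult: "cube_avg S (\<lambda>A. c * f A) = c * cube_avg S f"
  by (simp add: cube_avg_def sum_distrib_left)

lemma cube_avg_divide: "cube_avg S (\<lambda>A. f A / c) = cube_avg S f / c"
  by (simp add: cube_avg_def flip: sum_divide_distrib)

lemma cube_avg_sum: "cube_avg S (\<lambda>A. \<Sum>i\<in>I. f i A) = (\<Sum>i\<in>I. cube_avg S (f i))"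
  unfolding cube_avg_def by (subst sum.swap) (simp add: sum_divide_distrib)

lemma cube_avg_const: "finite S \<Longrightarrow> cube_avg S (\<lambda>A. c) = c"
  by (simp add: cube_avg_def card_Pow)

lemma cube_avg_Cauchy_Schwarz:
  "(cube_avg S (\<lambda>A. f A * g A))\<^sup>2 \<le> cube_avg S (\<lambda>A. (f A)\<^sup>2) * cube_avg S (\<lambda>A. (g A)\<^sup>2)"
proof -
  have "(\<Sum>A\<in>Pow S. f A * g A)\<^sup>2 \<le> (\<Sum>A\<in>Pow S. (f A)\<^sup>2) * (\<Sum>A\<in>Pow S. (g A)\<^sup>2)"
    by (rule Cauchy_Schwarz_ineq_sum)
  then show ?thesis unfolding cube_avg_def
    by (simp add: power_divide power2_eq_square divide_right_mono)
qed

text \<open>The reverse triangle inequality of \<open>L^2\<close>, squared: expand the right-hand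
  side and bound the mixed term by Cauchy-Schwarz.\<close>

lemma cube_avg_square_diff_ge:
  "(sqrt (cube_avg S (\<lambda>A. (f A)\<^sup>2)) - sqrt (cube_avg S (\<lambda>A. (g A)\<^sup>2)))\<^sup>2
     \<le> cube_avg S (\<lambda>A. (f A - g A)\<^sup>2)"
proof -
  let ?a = "cube_avg S (\<lambda>A. (f A)\<^sup>2)" and ?b = "cube_avg S (\<lambda>A. (g A)\<^sup>2)"
    and ?c = "cube_avg S (\<lambda>A. f A * g A)"
  have nn: "?a \<ge> 0" "?b \<ge> 0" by (auto intro: cube_avg_nonneg)
  have "?c\<^sup>2 \<le> (sqrt ?a * sqrt ?b)\<^sup>2"
    using cube_avg_Cauchy_Schwarz[of S f g] nn by (simp add: power_mult_distrib)
  then have "?c \<le> sqrt ?a * sqrt ?b"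
    by (rule power2_le_imp_le) (use nn in simp)
  moreover have "cube_avg S (\<lambda>A. (f A - g A)\<^sup>2) = ?a + ?b - 2 * ?c"
    by (simp add: power2_diff cube_avg_diff cube_avg_add mult.assoc cube_avg_cmult)
  ultimately show ?thesis using nn by (simp add: power2_diff)
qed

lemma ln_le_self_div: "x * ln x \<le> x * (x / m - 1) + x * ln m" if "0 \<le> x" "0 < m" for x m :: real
proof (cases "x = 0")
  case False
  then have "ln (x / m) \<le> x / m - 1" using that by (intro ln_le_minus_one) auto
  then have "ln x \<le> x / m - 1 + ln m" using that False by (simp add: ln_div)
  then have "x * ln x \<le> x * (x / m - 1 + ln m)" using that by (intro mult_left_mono)
  then show ?thesis by (simp add: algebra_simps)
qed simp

text \<open>The optimal constant is \<open>1/2\<close>; bounding the entropy of \<open>F\<close> by \<open>Var F / E F\<close> only loses a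
  factor 2.\<close>

lemma two_point_log_Sobolev:
  fixes x y :: real
  assumes "0 \<le> x" "0 \<le> y"
  shows "(x\<^sup>2 * ln (x\<^sup>2) + y\<^sup>2 * ln (y\<^sup>2)) / 2 - (x\<^sup>2 + y\<^sup>2) / 2 * ln ((x\<^sup>2 + y\<^sup>2) / 2) \<le> (x - y)\<^sup>2"
proof (cases "x = 0 \<and> y = 0")
  case False
  define m where "m = (x\<^sup>2 + y\<^sup>2) / 2"
  have m: "m > 0" using False unfolding m_def
    by (metis add_pos_nonneg half_gt_zero sum_power2_gt_zero_iff zero_le_power2)
  have m': "x\<^sup>2 + y\<^sup>2 = 2 * m" by (simp add: m_def)
  have "(x\<^sup>2 * ln (x\<^sup>2) + y\<^sup>2 * ln (y\<^sup>2)) / 2 - m * ln m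
        \<le> (x\<^sup>2 * (x\<^sup>2 / m - 1) + x\<^sup>2 * ln m + (y\<^sup>2 * (y\<^sup>2 / m - 1) + y\<^sup>2 * ln m)) / 2 - m * ln m"
    using ln_le_self_div[of "x\<^sup>2" m] ln_le_self_div[of "y\<^sup>2" m] m
    by (intro diff_right_mono divide_right_mono add_mono) auto
  also have "\<dots> = (x\<^sup>2 * x\<^sup>2 + y\<^sup>2 * y\<^sup>2) / (2 * m) - (x\<^sup>2 + y\<^sup>2) / 2 + ((x\<^sup>2 + y\<^sup>2) / 2 - m) * ln m"
    using m by (simp add: field_simps)
  also have "\<dots> = (x\<^sup>2 * x\<^sup>2 + y\<^sup>2 * y\<^sup>2) / (2 * m) - m"
    by (simp add: m')
  also have "\<dots> \<le> (x - y)\<^sup>2"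
  proof -
    \<comment> \<open>This amounts to \<open>(x + y)^2 <= 2 * (x^2 + y^2)\<close>; with denominators
      cleared the slack is exactly \<open>(x - y)^4 / 2\<close>.\<close>
    have "x\<^sup>2 * x\<^sup>2 + y\<^sup>2 * y\<^sup>2 \<le> (m + (x - y)\<^sup>2) * (2 * m)"
    proof -
      have "(m + (x - y)\<^sup>2) * (2 * m) - (x\<^sup>2 * x\<^sup>2 + y\<^sup>2 * y\<^sup>2)
         = (x - y)\<^sup>2 * (x - y)\<^sup>2 / 2"
        unfolding m_def by (simp add: field_simps power2_eq_square)
      then show ?thesis using zero_le_power2[of "(x-y)\<^sup>2"] unfolding power2_eq_square by linarith
    qed
    then have "(x\<^sup>2 * x\<^sup>2 + y\<^sup>2 * y\<^sup>2) / (2 * m) \<le> m + (x - y)\<^sup>2"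
      using m by (simp add: pos_divide_le_eq)
    then show ?thesis by simp
  qed
  finally show ?thesis by (simp add: m_def)
qed auto

lemma cube_diff_insert:
  "j \<notin> A \<Longrightarrow> i \<noteq> j \<Longrightarrow> cube_diff i f (insert j A) = cube_diff i (\<lambda>A. f (insert j A)) A"
  "j \<notin> A \<Longrightarrow> cube_diff j f A = f A - f (insert j A)"
  "j \<notin> A \<Longrightarrow> cube_diff j f (insert j A) = f (insert j A) - f A"
  by (auto simp: cube_diff_def flip_def insert_Diff_if insert_commute)

text \<open>Tensorisation by induction on the dimension: Minkowski's inequality compares the two-point entropy of
  the \<open>L\<^sup>2\<close> norms of the two halves of \<open>f\<close> with the energy in the new direction.\<close>

lemma cube_log_Sobolev:
  assumes "finite S"
  shows "cube_ent S (\<lambda>A. (f A)\<^sup>2) \<le> (\<Sum>j\<in>S. cube_avg S (\<lambda>A. (cube_diff j f A)\<^sup>2))"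
  using assms
proof (induction S arbitrary: f rule: finite_induct)
  case empty
  then show ?case by (simp add: cube_ent_def)
next
  case (insert j S)
  let ?f1 = "\<lambda>A. f (Set.insert j A)"
  let ?a0 = "cube_avg S (\<lambda>A. (f A)\<^sup>2)" and ?a1 = "cube_avg S (\<lambda>A. (?f1 A)\<^sup>2)"
  have nn: "?a0 \<ge> 0" "?a1 \<ge> 0" by (auto intro: cube_avg_nonneg)
  \<comment> \<open>Chain rule for entropy: the mean of the entropies on the two halves plus the
    two-point entropy of their means.\<close>
  have "cube_ent (insert j S) (\<lambda>A. (f A)\<^sup>2) =
     (cube_ent S (\<lambda>A. (f A)\<^sup>2) + cube_ent S (\<lambda>A. (?f1 A)\<^sup>2)) / 2
     + ((?a0 * ln ?a0 + ?a1 * ln ?a1) / 2 - (?a0 + ?a1) / 2 * ln ((?a0 + ?a1) / 2))"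
    unfolding cube_ent_def cube_avg_insert[OF insert.hyps] by (simp add: field_simps)
  also have "(?a0 * ln ?a0 + ?a1 * ln ?a1) / 2 - (?a0 + ?a1) / 2 * ln ((?a0 + ?a1) / 2)
      \<le> (sqrt ?a0 - sqrt ?a1)\<^sup>2"
    using two_point_log_Sobolev[of "sqrt ?a0" "sqrt ?a1"] nn by simp
  also have "\<dots> \<le> cube_avg S (\<lambda>A. (f A - ?f1 A)\<^sup>2)"
    by (rule cube_avg_square_diff_ge)
  also have "\<dots> = cube_avg (insert j S) (\<lambda>A. (cube_diff j f A)\<^sup>2)"
  proof -
    have "cube_avg S (\<lambda>A. (cube_diff j f A)\<^sup>2) = cube_avg S (\<lambda>A. (f A - ?f1 A)\<^sup>2)"
      using insert.hyps by (intro cube_avg_cong) (auto simp: cube_diff_def flip_def)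
    moreover have "cube_avg S (\<lambda>A. (cube_diff j f (Set.insert j A))\<^sup>2) = cube_avg S (\<lambda>A. (f A - ?f1 A)\<^sup>2)"
      using insert.hyps by (intro cube_avg_cong) (metis cube_diff_insert(3) power2_commute subsetD)
    ultimately show ?thesis unfolding cube_avg_insert[OF insert.hyps] by simp
  qed
  also have "(cube_ent S (\<lambda>A. (f A)\<^sup>2) + cube_ent S (\<lambda>A. (?f1 A)\<^sup>2)) / 2
     \<le> ((\<Sum>i\<in>S. cube_avg S (\<lambda>A. (cube_diff i f A)\<^sup>2)) + (\<Sum>i\<in>S. cube_avg S (\<lambda>A. (cube_diff i ?f1 A)\<^sup>2))) / 2"
    using insert.IH[of f] insert.IH[of ?f1] by simp
  also have "\<dots> = (\<Sum>i\<in>S. cube_avg (insert j S) (\<lambda>A. (cube_diff i f A)\<^sup>2))"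
  proof -
    have "cube_avg S (\<lambda>A. (cube_diff i ?f1 A)\<^sup>2) = cube_avg S (\<lambda>A. (cube_diff i f (Set.insert j A))\<^sup>2)"
      if "i \<in> S" for i
      using insert.hyps that by (intro cube_avg_cong) (metis cube_diff_insert(1) subsetD)
    then show ?thesis unfolding cube_avg_insert[OF insert.hyps]
      by (simp add: sum.distrib sum_divide_distrib add_divide_distrib)
  qed
  finally show ?case using insert.hyps by (simp add: add.commute)
qed

text \<open>The entropy of \<open>h^2\<close> is large if \<open>h\<close> is small in
  \<open>L^1\<close> compared with \<open>L^2\<close>: up to a linear term it is at least
  \<open>E h^2 * ln (E h^2 / (E |h|)^2)\<close>. Introducing \<open>M\<close> removes the quotient,
  so that the bound can be summed over directions.\<close>

lemma cube_ent_ge: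
  assumes "finite S" "0 < M"
  shows "ln M * cube_avg S (\<lambda>A. (h A)\<^sup>2) \<le> cube_ent S (\<lambda>A. (h A)\<^sup>2) + M * (cube_avg S (\<lambda>A. \<bar>h A\<bar>))\<^sup>2"
proof -
  define a where "a = cube_avg S (\<lambda>A. (h A)\<^sup>2)"
  define b where "b = cube_avg S (\<lambda>A. \<bar>h A\<bar>)"
  have a0: "a \<ge> 0" unfolding a_def by (auto intro: cube_avg_nonneg)
  show ?thesis
  proof (cases "a = 0")
    case True
    then have "(\<Sum>A\<in>Pow S. (h A)\<^sup>2) = 0" by (simp add: a_def cube_avg_def)
    then have "h A = 0" if "A \<subseteq> S" for A
      using that assms(1) by (subst (asm) sum_nonneg_eq_0_iff) auto
    then show ?thesis by (simp add: cube_ent_def cube_avg_def)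
  next
    case False
    then have a: "a > 0" using a0 by simp
    \<comment> \<open>Point of tangency for \<open>ln |h A|\<close>. With this choice the mixed term
      \<open>2 * c * b\<close> is at most \<open>a + M * b^2\<close> by the arithmetic-geometric
      mean inequality.\<close>
    define c where "c = sqrt (M * a)"
    have c: "c > 0" "c\<^sup>2 = M * a" using a assms by (auto simp: c_def)
    have lnc: "ln (M * a) = 2 * ln c" using ln_realpow[of c 2] c by simp
    have *: "ln (M * a) * (h A)\<^sup>2 + (2 * (h A)\<^sup>2 - (2 * c) * \<bar>h A\<bar>) \<le> (h A)\<^sup>2 * ln ((h A)\<^sup>2)" for A
    proof (cases "h A = 0")
      case False
      have "ln (c / \<bar>h A\<bar>) \<le> c / \<bar>h A\<bar> - 1" using False c by (intro ln_le_minus_one) auto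
      then have "ln \<bar>h A\<bar> \<ge> ln c + 1 - c / \<bar>h A\<bar>" using False c by (simp add: ln_div)
      then have "(h A)\<^sup>2 * (2 * (ln c + 1 - c / \<bar>h A\<bar>)) \<le> (h A)\<^sup>2 * (2 * ln \<bar>h A\<bar>)"
        by (intro mult_left_mono) auto
      moreover have "ln ((h A)\<^sup>2) = 2 * ln \<bar>h A\<bar>"
        using ln_realpow[of "\<bar>h A\<bar>" 2] False by simp
      moreover have "(h A)\<^sup>2 * (2 * (ln c + 1 - c / \<bar>h A\<bar>)) =
          2 * ln c * (h A)\<^sup>2 + (2 * (h A)\<^sup>2 - 2 * c * \<bar>h A\<bar>)"
      proof -
        have "(h A)\<^sup>2 = \<bar>h A\<bar> * \<bar>h A\<bar>" by (simp add: power2_eq_square)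
        then show ?thesis using False by (simp only:) (simp add: field_simps)
      qed
      ultimately show ?thesis unfolding lnc by simp
    qed simp
    have "ln (M * a) * a + (2 * a - (2 * c) * b) \<le> cube_avg S (\<lambda>A. (h A)\<^sup>2 * ln ((h A)\<^sup>2))"
      using cube_avg_mono[of S, OF *]
      by (simp add: cube_avg_add cube_avg_diff cube_avg_cmult a_def b_def)
    moreover have "2 * c * b \<le> a + M * b\<^sup>2"
    proof -
      have "0 \<le> (sqrt a - sqrt M * b)\<^sup>2" by simp
      also have "\<dots> = a + M * b\<^sup>2 - 2 * c * b"
        using a assms by (simp add: power2_diff power_mult_distrib c_def real_sqrt_mult)
      finally show ?thesis by simp
    qed
    ultimately have "ln M * a \<le> cube_avg S (\<lambda>A. (h A)\<^sup>2 * ln ((h A)\<^sup>2)) - a * ln a + M * b\<^sup>2"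
      using a assms by (simp add: ln_mult algebra_simps)
    then show ?thesis by (simp add: a_def b_def cube_ent_def)
  qed
qed

text \<open>Induction on the directions. \<open>g\<close> averages \<open>f\<close> over direction
  \<open>j\<close> and \<open>h\<close> is the rest, so the variances add. The induction hypothesis
  handles \<open>g\<close>; the entropy bound and the log-Sobolev inequality in the old directions
  handle \<open>h\<close>. The energies of \<open>g\<close> and \<open>h\<close> in an old direction
  add up exactly to that of \<open>f\<close>, so the energy of \<open>f\<close> is spent only
  once.\<close>

lemma cube_Falik_Samorodnitsky:
  assumes "finite S" "0 < M"
  shows "ln M * (cube_avg S (\<lambda>A. (f A)\<^sup>2) - (cube_avg S f)\<^sup>2) \<le>
      (\<Sum>j\<in>S. cube_avg S (\<lambda>A. (cube_diff j f A)\<^sup>2)) + M * (\<Sum>j\<in>S. (cube_avg S (\<lambda>A. \<bar>cube_diff j f A\<bar>))\<^sup>2)"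
  using assms(1)
proof (induction S arbitrary: f rule: finite_induct)
  case empty
  then show ?case by simp
next
  case (insert j S)
  let ?f1 = "\<lambda>A. f (Set.insert j A)"
  define g where "g A = (f A + ?f1 A) / 2" for A
  define h where "h A = (f A - ?f1 A) / 2" for A
  let ?I = "cube_avg (Set.insert j S)"
  have var: "?I (\<lambda>A. (f A)\<^sup>2) - (?I f)\<^sup>2 = cube_avg S (\<lambda>A. (g A)\<^sup>2) - (cube_avg S g)\<^sup>2 + cube_avg S (\<lambda>A. (h A)\<^sup>2)"
  proof -
    have "((f A)\<^sup>2 + (?f1 A)\<^sup>2) / 2 = (g A)\<^sup>2 + (h A)\<^sup>2" for A
      unfolding g_def h_def by (simp add: power2_eq_square field_simps)
    then have "cube_avg S (\<lambda>A. ((f A)\<^sup>2 + (?f1 A)\<^sup>2) / 2) = cube_avg S (\<lambda>A. (g A)\<^sup>2 + (h A)\<^sup>2)"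
      by (intro cube_avg_cong)
    moreover have "?I f = cube_avg S g"
      unfolding cube_avg_insert[OF insert.hyps] g_def by (simp add: cube_avg_add cube_avg_divide)
    ultimately show ?thesis unfolding cube_avg_insert[OF insert.hyps]
      by (simp add: cube_avg_add cube_avg_divide)
  qed
  have split: "cube_avg S (\<lambda>A. (cube_diff i g A)\<^sup>2) + cube_avg S (\<lambda>A. (cube_diff i h A)\<^sup>2)
      = ?I (\<lambda>A. (cube_diff i f A)\<^sup>2)" if "i \<in> S" for i
  proof -
    have "?I (\<lambda>A. (cube_diff i f A)\<^sup>2) = cube_avg S (\<lambda>A. ((cube_diff i f A)\<^sup>2 + (cube_diff i f (Set.insert j A))\<^sup>2) / 2)"
      unfolding cube_avg_insert[OF insert.hyps] by (simp add: cube_avg_add cube_avg_divide)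
    also have "\<dots> = cube_avg S (\<lambda>A. (cube_diff i g A)\<^sup>2 + (cube_diff i h A)\<^sup>2)"
    proof (rule cube_avg_cong)
      fix A assume "A \<subseteq> S"
      then have "cube_diff i f (Set.insert j A) = cube_diff i ?f1 A"
        using insert.hyps that by (intro cube_diff_insert) auto
      then show "((cube_diff i f A)\<^sup>2 + (cube_diff i f (Set.insert j A))\<^sup>2) / 2 = (cube_diff i g A)\<^sup>2 + (cube_diff i h A)\<^sup>2"
        unfolding g_def h_def cube_diff_def by (simp add: power2_eq_square field_simps)
    qed
    finally show ?thesis by (simp add: cube_avg_add)
  qed
  have L1: "cube_avg S (\<lambda>A. \<bar>cube_diff i g A\<bar>) \<le> ?I (\<lambda>A. \<bar>cube_diff i f A\<bar>)" if "i \<in> S" for i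
  proof -
    have "cube_avg S (\<lambda>A. \<bar>cube_diff i g A\<bar>) \<le> cube_avg S (\<lambda>A. (\<bar>cube_diff i f A\<bar> + \<bar>cube_diff i f (Set.insert j A)\<bar>) / 2)"
    proof (rule cube_avg_mono)
      fix A assume "A \<subseteq> S"
      then have "cube_diff i f (Set.insert j A) = cube_diff i ?f1 A"
        using insert.hyps that by (intro cube_diff_insert) auto
      then have "cube_diff i g A = (cube_diff i f A + cube_diff i f (Set.insert j A)) / 2"
        unfolding g_def cube_diff_def by (simp add: field_simps)
      then show "\<bar>cube_diff i g A\<bar> \<le> (\<bar>cube_diff i f A\<bar> + \<bar>cube_diff i f (Set.insert j A)\<bar>) / 2"
        by simp
    qed
    also have "\<dots> = ?I (\<lambda>A. \<bar>cube_diff i f A\<bar>)"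
      unfolding cube_avg_insert[OF insert.hyps] by (simp add: cube_avg_add cube_avg_divide)
    finally show ?thesis .
  qed
  have hj: "cube_avg S (\<lambda>A. \<bar>h A\<bar>) \<le> ?I (\<lambda>A. \<bar>cube_diff j f A\<bar>)"
  proof -
    have "cube_avg S (\<lambda>A. \<bar>h A\<bar>) \<le> cube_avg S (\<lambda>A. (\<bar>cube_diff j f A\<bar> + \<bar>cube_diff j f (Set.insert j A)\<bar>) / 2)"
    proof (rule cube_avg_mono)
      fix A assume "A \<subseteq> S"
      then have "j \<notin> A" using insert.hyps by auto
      then show "\<bar>h A\<bar> \<le> (\<bar>cube_diff j f A\<bar> + \<bar>cube_diff j f (Set.insert j A)\<bar>) / 2"
        by (auto simp: h_def cube_diff_insert)
    qed
    also have "\<dots> = ?I (\<lambda>A. \<bar>cube_diff j f A\<bar>)"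
      unfolding cube_avg_insert[OF insert.hyps] by (simp add: cube_avg_add cube_avg_divide)
    finally show ?thesis .
  qed
  have "ln M * (?I (\<lambda>A. (f A)\<^sup>2) - (?I f)\<^sup>2) =
     ln M * (cube_avg S (\<lambda>A. (g A)\<^sup>2) - (cube_avg S g)\<^sup>2) + ln M * cube_avg S (\<lambda>A. (h A)\<^sup>2)"
    unfolding var by (simp add: algebra_simps)
  also have "\<dots> \<le> ((\<Sum>i\<in>S. cube_avg S (\<lambda>A. (cube_diff i g A)\<^sup>2)) + M * (\<Sum>i\<in>S. (cube_avg S (\<lambda>A. \<bar>cube_diff i g A\<bar>))\<^sup>2))
     + ((\<Sum>i\<in>S. cube_avg S (\<lambda>A. (cube_diff i h A)\<^sup>2)) + M * (cube_avg S (\<lambda>A. \<bar>h A\<bar>))\<^sup>2)"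
    using insert.IH[of g] cube_ent_ge[OF insert.hyps(1) assms(2), of h] cube_log_Sobolev[OF insert.hyps(1), of h]
    by linarith
  also have "\<dots> = (\<Sum>i\<in>S. ?I (\<lambda>A. (cube_diff i f A)\<^sup>2))
     + M * ((\<Sum>i\<in>S. (cube_avg S (\<lambda>A. \<bar>cube_diff i g A\<bar>))\<^sup>2) + (cube_avg S (\<lambda>A. \<bar>h A\<bar>))\<^sup>2)"
    by (simp add: algebra_simps split[symmetric] sum.distrib)
  also have "\<dots> \<le> (\<Sum>i\<in>insert j S. ?I (\<lambda>A. (cube_diff i f A)\<^sup>2))
     + M * ((\<Sum>i\<in>S. (?I (\<lambda>A. \<bar>cube_diff i f A\<bar>))\<^sup>2) + (?I (\<lambda>A. \<bar>cube_diff j f A\<bar>))\<^sup>2)"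
    using insert.hyps assms(2) L1 hj
    by (intro add_mono mult_left_mono sum_mono power_mono) (auto intro!: cube_avg_nonneg)
  also have "\<dots> = (\<Sum>i\<in>insert j S. ?I (\<lambda>A. (cube_diff i f A)\<^sup>2))
     + M * (\<Sum>i\<in>insert j S. (?I (\<lambda>A. \<bar>cube_diff i f A\<bar>))\<^sup>2)"
    using insert.hyps by (simp add: add.commute)
  finally show ?case .
qed

section \<open>Random variables coded by fair bits\<close>

lemma set_encode_insert_top:
  assumes "B \<subseteq> {..<n}"
  shows "set_encode (insert n B) = 2 ^ n + set_encode B"
  using assms by (subst set_encode_insert) (auto intro: finite_subset)

lemma set_encode_bij: "bij_betw set_encode (Pow {..<n}) {..<2 ^ n}"
proof -
  have "set_encode ` Pow {..<n} = {..<2 ^ n}"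
  proof (induction n)
    case 0
    then show ?case by (simp add: lessThan_Suc)
  next
    case (Suc n)
    have "set_encode ` Pow {..<Suc n} = set_encode ` Pow {..<n} \<union> (\<lambda>B. 2 ^ n + set_encode B) ` Pow {..<n}"
      unfolding lessThan_Suc Pow_insert image_Un image_image
      by (intro arg_cong2[where f = "(\<union>)"] refl image_cong) (auto simp: set_encode_insert_top)
    also have "(\<lambda>B. 2 ^ n + set_encode B) ` Pow {..<n} = (+) (2 ^ n) ` {..<2 ^ n}"
      unfolding Suc[symmetric] image_image by simp
    also have "\<dots> = {2 ^ n..<2 ^ Suc n}"
      by (simp add: lessThan_atLeast0 mult_2)
    finally show ?case unfolding Suc by auto
  qed
  moreover have "inj_on set_encode (Pow {..<n})"
    by (rule inj_on_subset[OF inj_on_set_encode]) (auto intro: finite_subset)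
  ultimately show ?thesis by (simp add: bij_betw_def)
qed

lemma sum_set_encode: "(\<Sum>B\<in>Pow {..<n}. F (set_encode B)) = (\<Sum>k<2 ^ n. F k)"
  by (rule sum.reindex_bij_betw[OF set_encode_bij])

lemma set_encode_less: "B \<subseteq> {..<n} \<Longrightarrow> set_encode B < 2 ^ n"
  using bij_betw_apply[OF set_encode_bij[of n], of B] by simp

text \<open>Digit \<open>i\<close> has weight \<open>2 ^ i\<close>, so flipping it shifts the number
  by \<open>2 ^ i\<close>; each pair of neighbours is listed by its member with digit 0.\<close>

lemma sum_flip_pairs:
  fixes G :: "nat \<Rightarrow> nat \<Rightarrow> real"
  assumes "i < n"
  shows "(\<Sum>B\<in>Pow {..<n}. G (set_encode B) (set_encode (flip i B))) =
    (\<Sum>B\<in>Pow ({..<n} - {i}). G (set_encode B) (set_encode B + 2 ^ i) + G (set_encode B + 2 ^ i) (set_encode B))"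
proof -
  have ins: "{..<n} = insert i ({..<n} - {i})" using assms by auto
  have inj: "inj_on (insert i) (Pow ({..<n} - {i}))" by (rule inj_onI) (metis Diff_iff Pow_iff insertI1 insert_ident subset_iff)
  have enc: "set_encode (insert i B) = set_encode B + 2 ^ i" if "B \<subseteq> {..<n} - {i}" for B
    using that by (subst set_encode_insert) (auto intro: finite_subset)
  have "(\<Sum>B\<in>Pow {..<n}. G (set_encode B) (set_encode (flip i B))) =
    (\<Sum>B\<in>Pow ({..<n} - {i}). G (set_encode B) (set_encode (flip i B)))
    + (\<Sum>B\<in>insert i ` Pow ({..<n} - {i}). G (set_encode B) (set_encode (flip i B)))"
    by (subst ins, subst Pow_insert, rule sum.union_disjoint) auto
  also have "(\<Sum>B\<in>insert i ` Pow ({..<n} - {i}). G (set_encode B) (set_encode (flip i B))) =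
      (\<Sum>B\<in>Pow ({..<n} - {i}). G (set_encode (insert i B)) (set_encode (flip i (insert i B))))"
    using inj by (simp add: sum.reindex)
  also have "\<dots> = (\<Sum>B\<in>Pow ({..<n} - {i}). G (set_encode B + 2 ^ i) (set_encode B))"
  proof (rule sum.cong[OF refl])
    fix B assume B: "B \<in> Pow ({..<n} - {i})"
    then have "flip i (insert i B) = B" by (auto simp: flip_def)
    then show "G (set_encode (insert i B)) (set_encode (flip i (insert i B))) = G (set_encode B + 2 ^ i) (set_encode B)"
      using B enc by auto
  qed
  also have "(\<Sum>B\<in>Pow ({..<n} - {i}). G (set_encode B) (set_encode (flip i B))) =
     (\<Sum>B\<in>Pow ({..<n} - {i}). G (set_encode B) (set_encode B + 2 ^ i))"
  proof (rule sum.cong[OF refl])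
    fix B assume B: "B \<in> Pow ({..<n} - {i})"
    then have "flip i B = insert i B" by (auto simp: flip_def)
    then show "G (set_encode B) (set_encode (flip i B)) = G (set_encode B) (set_encode B + 2 ^ i)"
      using B enc by auto
  qed
  finally show ?thesis by (simp add: sum.distrib)
qed

text \<open>Forgetting that digit \<open>i\<close> vanishes gives a sum over an interval, in which
  differences over a shift by \<open>2 ^ i\<close> telescope.\<close>

lemma sum_bit_zero_le:
  fixes D :: "nat \<Rightarrow> real"
  assumes "i < n" "\<And>k. k + 2 ^ i < 2 ^ n \<Longrightarrow> 0 \<le> D k"
  shows "(\<Sum>B\<in>Pow ({..<n} - {i}). D (set_encode B)) \<le> (\<Sum>k<2 ^ n - 2 ^ i. D k)"
proof -
  have inj: "inj_on set_encode (Pow ({..<n} - {i}))"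
    using set_encode_bij[of n] by (auto simp: bij_betw_def intro: inj_on_subset)
  have lt: "set_encode B + 2 ^ i < 2 ^ n" if "B \<subseteq> {..<n} - {i}" for B
  proof -
    have "set_encode (insert i B) = set_encode B + 2 ^ i"
      using that by (subst set_encode_insert) (auto intro: finite_subset)
    moreover have "set_encode (insert i B) < 2 ^ n"
      using that assms(1) by (intro set_encode_less) auto
    ultimately show ?thesis by simp
  qed
  have "(\<Sum>B\<in>Pow ({..<n} - {i}). D (set_encode B)) = (\<Sum>k\<in>set_encode ` Pow ({..<n} - {i}). D k)"
    using inj by (simp add: sum.reindex)
  also have "\<dots> \<le> (\<Sum>k<2 ^ n - 2 ^ i. D k)"
  proof (rule sum_mono2)
    show "set_encode ` Pow ({..<n} - {i}) \<subseteq> {..<2 ^ n - 2 ^ i}"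
      using lt by (auto simp: less_diff_conv)
  qed (use assms in \<open>auto simp: less_diff_conv\<close>)
  finally show ?thesis .
qed

lemma shift_sum:
  fixes u :: "nat \<Rightarrow> real"
  assumes "s \<le> N"
  shows "(\<Sum>k<N - s. u (k + s)) + (\<Sum>k<s. u k) = (\<Sum>k<N. u k)"
    and "(\<Sum>k<N - s. u k) + (\<Sum>k\<in>{N - s..<N}. u k) = (\<Sum>k<N. u k)"
proof -
  have "(\<Sum>k<N - s. u (k + s)) = (\<Sum>k\<in>{s..<N}. u k)"
    using sum.shift_bounds_nat_ivl[of u 0 s "N - s"] assms by (simp add: lessThan_atLeast0)
  then show "(\<Sum>k<N - s. u (k + s)) + (\<Sum>k<s. u k) = (\<Sum>k<N. u k)"
    using assms by (simp add: lessThan_atLeast0 sum.atLeastLessThan_concat add.commute[of "sum u {s..<N}"])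
  show "(\<Sum>k<N - s. u k) + (\<Sum>k\<in>{N - s..<N}. u k) = (\<Sum>k<N. u k)"
    using assms by (simp add: lessThan_atLeast0 sum.atLeastLessThan_concat)
qed

text \<open>In terms of \<open>k = \<lfloor>2\<^sup>n U\<rfloor>\<close> these are the numbers of leading binary zeros and ones of \<open>U\<close>,
  dyadic versions of \<open>log (1 / U)\<close> and \<open>log (1 / (1 - U))\<close>.\<close>

definition lead_zeros :: "nat \<Rightarrow> nat \<Rightarrow> nat" where
  "lead_zeros n k = card {i. i < n \<and> k < 2 ^ i}"

definition lead_ones :: "nat \<Rightarrow> nat \<Rightarrow> nat" where
  "lead_ones n k = card {i. i < n \<and> 2 ^ n - 2 ^ i \<le> k}"

lemma sum_sum_lead:
  fixes u :: "nat \<Rightarrow> real"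
  shows "(\<Sum>i<n. \<Sum>k<2 ^ i. u k) = (\<Sum>k<2 ^ n. u k * lead_zeros n k)"
    and "(\<Sum>i<n. \<Sum>k\<in>{2 ^ n - 2 ^ i..<2 ^ n}. u k) = (\<Sum>k<2 ^ n. u k * lead_ones n k)"
proof -
  have c: "u k * real (card {i. i < n \<and> P i}) = (\<Sum>i<n. if P i then u k else 0)" for k P
  proof -
    have "{i. i < n \<and> P i} = {..<n} \<inter> {i. P i}" by auto
    then show ?thesis by (simp add: sum.If_cases)
  qed
  have "(\<Sum>i<n. \<Sum>k<2 ^ i. u k) = (\<Sum>i<n. \<Sum>k<2 ^ n. if k < 2 ^ i then u k else 0)"
  proof (rule sum.cong[OF refl])
    fix i assume "i \<in> {..<n}"
    then have "(2::nat) ^ i \<le> 2 ^ n" by simp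
    then have "k < 2 ^ n" if "k < 2 ^ i" for k :: nat using that by linarith
    then have "{..<2 ^ n} \<inter> {k::nat. k < 2 ^ i} = {..<2 ^ i}" by auto
    then show "(\<Sum>k<2 ^ i. u k) = (\<Sum>k<2 ^ n. if k < 2 ^ i then u k else 0)" by (simp add: sum.If_cases)
  qed
  also have "\<dots> = (\<Sum>k<2 ^ n. u k * lead_zeros n k)"
    unfolding lead_zeros_def c by (rule sum.swap)
  finally show "(\<Sum>i<n. \<Sum>k<2 ^ i. u k) = (\<Sum>k<2 ^ n. u k * lead_zeros n k)" .
  have "(\<Sum>i<n. \<Sum>k\<in>{2 ^ n - 2 ^ i..<2 ^ n}. u k) = (\<Sum>i<n. \<Sum>k<2 ^ n. if 2 ^ n - 2 ^ i \<le> k then u k else 0)"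
  proof (rule sum.cong[OF refl])
    fix i assume "i \<in> {..<n}"
    have "{..<2 ^ n} \<inter> {k::nat. 2 ^ n - 2 ^ i \<le> k} = {2 ^ n - 2 ^ i..<2 ^ n}" by auto
    then show "(\<Sum>k\<in>{2 ^ n - 2 ^ i..<2 ^ n}. u k) = (\<Sum>k<2 ^ n. if 2 ^ n - 2 ^ i \<le> k then u k else 0)"
      by (simp add: sum.If_cases)
  qed
  also have "\<dots> = (\<Sum>k<2 ^ n. u k * lead_ones n k)"
    unfolding lead_ones_def c by (rule sum.swap)
  finally show "(\<Sum>i<n. \<Sum>k\<in>{2 ^ n - 2 ^ i..<2 ^ n}. u k) = (\<Sum>k<2 ^ n. u k * lead_ones n k)" .
qed

text \<open>For monotone \<open>v\<close> the differences over a shift by \<open>2 ^ i\<close>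
  telescope and at most the first \<open>2 ^ i\<close> values survive. Summed over \<open>i\<close>,
  the value at \<open>k\<close> is counted once for each \<open>i\<close> with
  \<open>k < 2 ^ i\<close>, hence the leading zeros.\<close>

lemma flip_sum_antimono:
  fixes v :: "nat \<Rightarrow> real"
  assumes "\<And>k l. k \<le> l \<Longrightarrow> l < 2 ^ n \<Longrightarrow> v l \<le> v k" "\<And>k. k < 2 ^ n \<Longrightarrow> 0 \<le> v k"
  shows "(\<Sum>i<n. \<Sum>B\<in>Pow {..<n}. \<bar>v (set_encode B) - v (set_encode (flip i B))\<bar>)
     \<le> 2 * (\<Sum>k<2 ^ n. v k * lead_zeros n k)"
proof -
  have "(\<Sum>B\<in>Pow {..<n}. \<bar>v (set_encode B) - v (set_encode (flip i B))\<bar>) \<le> 2 * (\<Sum>k<2 ^ i. v k)"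
    if "i < n" for i
  proof -
    have le: "(2::nat) ^ i \<le> 2 ^ n" using that by simp
    have "(\<Sum>B\<in>Pow {..<n}. \<bar>v (set_encode B) - v (set_encode (flip i B))\<bar>)
      = (\<Sum>B\<in>Pow ({..<n} - {i}). 2 * \<bar>v (set_encode B) - v (set_encode B + 2 ^ i)\<bar>)"
      by (subst sum_flip_pairs[OF that, of "\<lambda>a b. \<bar>v a - v b\<bar>"]) (simp add: abs_minus_commute)
    also have "\<dots> \<le> (\<Sum>k<2 ^ n - 2 ^ i. 2 * \<bar>v k - v (k + 2 ^ i)\<bar>)"
      using that by (intro sum_bit_zero_le[of i n "\<lambda>k. 2 * \<bar>v k - v (k + 2 ^ i)\<bar>"]) auto
    also have "\<dots> = 2 * ((\<Sum>k<2 ^ n - 2 ^ i. v k) - (\<Sum>k<2 ^ n - 2 ^ i. v (k + 2 ^ i)))"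
      unfolding sum_distrib_left sum_subtractf[symmetric]
      by (intro sum.cong refl) (use assms(1) in \<open>auto simp: less_diff_conv\<close>)
    also have "\<dots> = 2 * ((\<Sum>k<2 ^ i. v k) - (\<Sum>k\<in>{2 ^ n - 2 ^ i..<2 ^ n}. v k))"
      using shift_sum[OF le, of v] by simp
    also have "\<dots> \<le> 2 * (\<Sum>k<2 ^ i. v k)"
      using sum_nonneg[of "{2 ^ n - 2 ^ i..<2 ^ n}" v] assms(2) by simp
    finally show ?thesis .
  qed
  then have "(\<Sum>i<n. \<Sum>B\<in>Pow {..<n}. \<bar>v (set_encode B) - v (set_encode (flip i B))\<bar>) \<le> (\<Sum>i<n. 2 * (\<Sum>k<2 ^ i. v k))"
    by (intro sum_mono) auto
  then show ?thesis by (simp add: sum_sum_lead(1) flip: sum_distrib_left)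
qed

text \<open>Mirror image of the decreasing case: the last \<open>2 ^ i\<close> values
  survive.\<close>

lemma flip_sum_mono:
  fixes v :: "nat \<Rightarrow> real"
  assumes "\<And>k l. k \<le> l \<Longrightarrow> l < 2 ^ n \<Longrightarrow> v k \<le> v l" "\<And>k. k < 2 ^ n \<Longrightarrow> 0 \<le> v k"
  shows "(\<Sum>i<n. \<Sum>B\<in>Pow {..<n}. \<bar>v (set_encode B) - v (set_encode (flip i B))\<bar>)
     \<le> 2 * (\<Sum>k<2 ^ n. v k * lead_ones n k)"
proof -
  have "(\<Sum>B\<in>Pow {..<n}. \<bar>v (set_encode B) - v (set_encode (flip i B))\<bar>) \<le> 2 * (\<Sum>k\<in>{2 ^ n - 2 ^ i..<2 ^ n}. v k)"
    if "i < n" for i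
  proof -
    have le: "(2::nat) ^ i \<le> 2 ^ n" using that by simp
    have "(\<Sum>B\<in>Pow {..<n}. \<bar>v (set_encode B) - v (set_encode (flip i B))\<bar>)
      = (\<Sum>B\<in>Pow ({..<n} - {i}). 2 * \<bar>v (set_encode B) - v (set_encode B + 2 ^ i)\<bar>)"
      by (subst sum_flip_pairs[OF that, of "\<lambda>a b. \<bar>v a - v b\<bar>"]) (simp add: abs_minus_commute)
    also have "\<dots> \<le> (\<Sum>k<2 ^ n - 2 ^ i. 2 * \<bar>v k - v (k + 2 ^ i)\<bar>)"
      using that by (intro sum_bit_zero_le[of i n "\<lambda>k. 2 * \<bar>v k - v (k + 2 ^ i)\<bar>"]) auto
    also have "\<dots> = 2 * ((\<Sum>k<2 ^ n - 2 ^ i. v (k + 2 ^ i)) - (\<Sum>k<2 ^ n - 2 ^ i. v k))"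
      unfolding sum_distrib_left sum_subtractf[symmetric]
      by (intro sum.cong refl) (use assms(1) in \<open>auto simp: less_diff_conv\<close>)
    also have "\<dots> = 2 * ((\<Sum>k\<in>{2 ^ n - 2 ^ i..<2 ^ n}. v k) - (\<Sum>k<2 ^ i. v k))"
      using shift_sum[OF le, of v] by simp
    also have "\<dots> \<le> 2 * (\<Sum>k\<in>{2 ^ n - 2 ^ i..<2 ^ n}. v k)"
      using sum_nonneg[of "{..<2 ^ i}" v] assms(2) less_le_trans[OF _ le] by simp
    finally show ?thesis .
  qed
  then have "(\<Sum>i<n. \<Sum>B\<in>Pow {..<n}. \<bar>v (set_encode B) - v (set_encode (flip i B))\<bar>)
      \<le> (\<Sum>i<n. 2 * (\<Sum>k\<in>{2 ^ n - 2 ^ i..<2 ^ n}. v k))"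
    by (intro sum_mono) auto
  then show ?thesis by (simp add: sum_sum_lead(2) flip: sum_distrib_left)
qed

lemma lead_ones_conv: "k < 2 ^ n \<Longrightarrow> lead_ones n k = lead_zeros n (2 ^ n - 1 - k)"
proof -
  assume k: "k < 2 ^ n"
  have "2 ^ n - 2 ^ i \<le> k \<longleftrightarrow> 2 ^ n - 1 - k < 2 ^ i" if "i < n" for i
  proof -
    have "(2::nat) ^ i \<le> 2 ^ n" "(0::nat) < 2 ^ i" using that by simp_all
    then show ?thesis using k by linarith
  qed
  then show ?thesis unfolding lead_ones_def lead_zeros_def by (metis (mono_tags, lifting))
qed

lemma lead_zeros_Suc:
  "k < 2 ^ n \<Longrightarrow> lead_zeros (Suc n) k = Suc (lead_zeros n k)"
  "2 ^ n \<le> k \<Longrightarrow> lead_zeros (Suc n) k = 0"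
proof -
  assume "k < 2 ^ n"
  then have "{i. i < Suc n \<and> k < 2 ^ i} = insert n {i. i < n \<and> k < 2 ^ i}" by (auto simp: less_Suc_eq)
  then show "lead_zeros (Suc n) k = Suc (lead_zeros n k)" by (simp add: lead_zeros_def)
next
  assume k: "2 ^ n \<le> k"
  have "{i. i < Suc n \<and> k < 2 ^ i} = {}"
  proof (intro equals0I, clarify)
    fix i assume "i < Suc n" "k < 2 ^ i"
    moreover from this have "(2::nat) ^ i \<le> 2 ^ n" by simp
    ultimately show False using k by linarith
  qed
  then show "lead_zeros (Suc n) k = 0" by (simp add: lead_zeros_def)
qed

lemma sum_double_pow:
  fixes F :: "nat \<Rightarrow> real"
  shows "(\<Sum>k<2 ^ Suc n. F k) = (\<Sum>k<2 ^ n. F k) + (\<Sum>k\<in>{2 ^ n..<2 ^ Suc n}. F k)"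
  using shift_sum(2)[of "2 ^ n" "2 ^ Suc n" F] by (simp add: mult_2)

text \<open>The number of leading zeros is geometric with ratio \<open>1/2\<close>, so its
  exponential moment is bounded for any base below 2, such as \<open>3/2\<close>. One more digit
  adds a leading zero to the lower half of the codes and leaves none in the upper half.\<close>

lemma sum_lead_zeros_power: "(\<Sum>k<2 ^ n. (3 / 2) ^ lead_zeros n k) \<le> (2 * 2 ^ n :: real)"
proof (induction n)
  case 0
  then show ?case by (simp add: lead_zeros_def)
next
  case (Suc n)
  have "(\<Sum>k<2 ^ Suc n. (3 / 2) ^ lead_zeros (Suc n) k) =
     (\<Sum>k<2 ^ n. (3 / 2) * (3 / 2) ^ lead_zeros n k) + (\<Sum>k\<in>{2 ^ n..<2 ^ Suc n::nat}. (1::real))"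
    unfolding sum_double_pow
    by (intro arg_cong2[where f="(+)"] sum.cong refl) (simp_all only: lessThan_iff atLeastLessThan_iff lead_zeros_Suc power_Suc power_0)
  also have "(\<Sum>k<2 ^ n. (3 / 2 :: real) * (3 / 2) ^ lead_zeros n k) + (\<Sum>k\<in>{2 ^ n..<2 ^ Suc n::nat}. (1::real))
      = (3 / 2) * (\<Sum>k<2 ^ n. (3 / 2) ^ lead_zeros n k) + 2 ^ n"
    by (simp add: sum_distrib_left)
  also have "\<dots> \<le> (3 / 2) * (2 * 2 ^ n) + 2 ^ n"
    using Suc by linarith
  finally show ?case by simp
qed

text \<open>Relative to all \<open>2 ^ (n + j)\<close> codes, those below \<open>2 ^ n\<close>
  contribute order \<open>(3/4) ^ j\<close> to the exponential moment. This makes the region of tiny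
  passage times negligible.\<close>

lemma sum_lead_zeros_power_small:
  "(\<Sum>k<2 ^ n. (3 / 2) ^ lead_zeros (n + j) k) \<le> ((3 / 2) ^ j * (2 * 2 ^ n) :: real)"
proof -
  have "lead_zeros (n + j) k = j + lead_zeros n k" if "k < 2 ^ n" for k
  proof (induction j)
    case (Suc j)
    have "k < 2 ^ (n + j)" using that by (rule less_le_trans) simp
    then show ?case using Suc by (simp add: lead_zeros_Suc)
  qed simp
  then have "(\<Sum>k<2 ^ n. (3 / 2) ^ lead_zeros (n + j) k) = (3 / 2) ^ j * (\<Sum>k<2 ^ n. (3 / 2 :: real) ^ lead_zeros n k)"
    unfolding sum_distrib_left by (intro sum.cong) (auto simp: power_add)
  then show ?thesis using sum_lead_zeros_power[of n] by simp
qed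

lemma sum_lead_ones_square: "(\<Sum>k<2 ^ n. (real (lead_ones n k))\<^sup>2) \<le> 100 * 2 ^ n"
proof -
  have sq: "(real m)\<^sup>2 \<le> 50 * (3 / 2) ^ m" for m :: nat
  proof -
    \<comment> \<open>Bernoulli's inequality with base \<open>6/5\<close>, whose square
      \<open>36/25\<close> is below \<open>3/2\<close>.\<close>
    have "1 + real m * (1 / 5) \<le> (1 + 1 / 5) ^ m"
      using Bernoulli_inequality[of "1/5 :: real" m] by simp
    also have "\<dots> \<le> (sqrt (3 / 2)) ^ m"
    proof (rule power_mono)
      show "1 + 1 / 5 \<le> sqrt (3 / 2 :: real)" by (rule real_le_rsqrt) (simp add: power2_eq_square)
    qed simp
    finally have "real m \<le> 5 * sqrt (3 / 2) ^ m" by simp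
    then have "(real m)\<^sup>2 \<le> (5 * sqrt (3 / 2) ^ m)\<^sup>2" by (intro power_mono) auto
    also have "\<dots> = 25 * ((sqrt (3 / 2))\<^sup>2) ^ m"
      by (simp only: power_mult_distrib power_mult[symmetric] mult.commute) simp
    also have "\<dots> = 25 * (3 / 2) ^ m" by simp
    also have "\<dots> \<le> 50 * (3 / 2) ^ m" by (intro mult_right_mono) auto
    finally show ?thesis .
  qed
  have "(\<Sum>k<2 ^ n. (real (lead_ones n k))\<^sup>2) \<le> (\<Sum>k<2 ^ n. 50 * (3 / 2) ^ lead_zeros n (2 ^ n - 1 - k))"
    by (intro sum_mono) (use sq in \<open>auto simp: lead_ones_conv\<close>)
  also have "\<dots> = 50 * (\<Sum>k<2 ^ n. (3 / 2) ^ lead_zeros n k)"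
    using sum.nat_diff_reindex[of "\<lambda>k. (3 / 2 :: real) ^ lead_zeros n k" "2 ^ n"]
    unfolding sum_distrib_left[symmetric] by simp
  also have "\<dots> \<le> 50 * (2 * 2 ^ n)"
    using sum_lead_zeros_power[of n] by simp
  finally show ?thesis by simp
qed


text \<open>Since \<open>v = a ^ p\<close> is still monotone, this lets the energy
  (\<open>p = 2\<close>) and the \<open>L^1\<close> influence (\<open>p = 1\<close>) share one
  telescoping argument.\<close>

lemma abs_diff_power_le:
  fixes a b :: real
  assumes "0 \<le> a" "0 \<le> b" "p = 1 \<or> p = 2"
  shows "\<bar>a - b\<bar> ^ p \<le> \<bar>a ^ p - b ^ p\<bar>"
proof -
  have "\<bar>a - b\<bar>\<^sup>2 \<le> \<bar>a - b\<bar> * \<bar>a + b\<bar>"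
    unfolding power2_eq_square using assms by (intro mult_left_mono) auto
  also have "\<dots> = \<bar>a\<^sup>2 - b\<^sup>2\<bar>"
    unfolding abs_mult[symmetric] by (simp add: power2_eq_square algebra_simps)
  finally show ?thesis using assms(3) by auto
qed

text \<open>Below the threshold \<open>t1\<close> one uses that \<open>(t - q)\<^sub>+\<close> is at most \<open>t1\<close> and lives on \<open>{q < t}\<close>; above it,
  \<open>{q < t}\<close> has probability at least \<open>1/2\<close>, so a bound by a constant suffices.\<close>

lemma flip_sum_min_le:
  fixes q :: "nat \<Rightarrow> real"
  assumes n: "0 < n"
    and mono: "\<And>k l. k \<le> l \<Longrightarrow> l < 2 ^ n \<Longrightarrow> q k \<le> q l"
    and nonneg: "\<And>k. k < 2 ^ n \<Longrightarrow> 0 \<le> q k"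
    and t1: "0 \<le> t1" "\<And>k. k < 2 ^ (n - 1) \<Longrightarrow> q k < t1"
    and m4: "(\<Sum>k<2 ^ n. q k ^ 4) \<le> m4 * 2 ^ n"
    and p: "p = 1 \<or> p = 2"
  shows "(\<Sum>i<n. \<Sum>B\<in>Pow {..<n}. \<bar>min t (q (set_encode B)) - min t (q (set_encode (flip i B)))\<bar> ^ p)
     \<le> (2 * (1 + t1)\<^sup>2 + 4 * (m4 + 101)) * (\<Sum>k<2 ^ n. if q k < t then 1 + lead_zeros n k else 0)"
    (is "?L \<le> ?C * ?R")
proof -
  have m40: "0 \<le> m4"
  proof -
    have "0 \<le> (\<Sum>k<2 ^ n. q k ^ 4)" by (intro sum_nonneg) simp
    then have "0 \<le> m4 * 2 ^ n" using m4 by linarith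
    then show ?thesis using zero_less_power[of "2::real" n] by (smt (verit) mult_neg_pos)
  qed
  have R0: "0 \<le> ?R" by (rule of_nat_0_le_iff)
  have flip_less: "set_encode (flip i B) < 2 ^ n" if "B \<subseteq> {..<n}" "i < n" for i B
    using that by (intro set_encode_less) (auto simp: flip_def)
  show ?thesis
  proof (cases "t \<le> t1")
    case True
    define v where "v k = (t - min t (q k)) ^ p" for k
    have v0: "0 \<le> v k" for k by (simp add: v_def)
    have v_le: "v k * lead_zeros n k \<le> (1 + t1)\<^sup>2 * (if q k < t then 1 + lead_zeros n k else 0)" if "k < 2 ^ n" for k
    proof (cases "q k < t")
      case qt: True
      have "v k \<le> (1 + t1) ^ p"
        unfolding v_def using True nonneg[OF that] qt by (intro power_mono) auto
      also have "\<dots> \<le> (1 + t1)\<^sup>2" using p t1 by (intro power_increasing) auto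
      finally have "v k * lead_zeros n k \<le> (1 + t1)\<^sup>2 * (1 + real (lead_zeros n k))"
        by (intro mult_mono) auto
      then show ?thesis using qt by simp
    qed (use p in \<open>auto simp: v_def\<close>)
    have "?L \<le> (\<Sum>i<n. \<Sum>B\<in>Pow {..<n}. \<bar>v (set_encode B) - v (set_encode (flip i B))\<bar>)"
    proof (intro sum_mono)
      fix i B
      show "\<bar>min t (q (set_encode B)) - min t (q (set_encode (flip i B)))\<bar> ^ p
          \<le> \<bar>v (set_encode B) - v (set_encode (flip i B))\<bar>"
        using abs_diff_power_le[OF _ _ p, of "t - min t (q (set_encode B))" "t - min t (q (set_encode (flip i B)))"]
        by (simp add: v_def abs_minus_commute)
    qed
    also have "\<dots> \<le> 2 * (\<Sum>k<2 ^ n. v k * lead_zeros n k)"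
    proof (rule flip_sum_antimono)
      fix k l :: nat assume "k \<le> l" "l < 2 ^ n"
      then have "q k \<le> q l" by (rule mono)
      then show "v l \<le> v k" unfolding v_def by (intro power_mono) auto
    qed (rule v0)
    also have "\<dots> \<le> 2 * (\<Sum>k<2 ^ n. (1 + t1)\<^sup>2 * (if q k < t then 1 + lead_zeros n k else 0))"
      using v_le by (intro mult_left_mono sum_mono) auto
    also have "\<dots> = 2 * (1 + t1)\<^sup>2 * ?R" by (simp add: sum_distrib_left mult.assoc)
    also have "\<dots> \<le> ?C * ?R" using m40 R0 by (intro mult_right_mono) auto
    finally show ?thesis .
  next
    case False
    define v where "v k = (min t (q k)) ^ p" for k
    have t: "0 \<le> t" using False t1 by simp
    have v0: "0 \<le> v k" if "k < 2 ^ n" for k using nonneg[OF that] t by (simp add: v_def)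
    \<comment> \<open>Separates the passage time from the digits, so that only a fourth moment of
      \<open>q\<close> and the second moment of the number of leading ones are needed.\<close>
    have v_le: "v k * lead_ones n k \<le> q k ^ 4 + 1 + (real (lead_ones n k))\<^sup>2" if "k < 2 ^ n" for k
    proof -
      have "v k \<le> q k ^ p" unfolding v_def using nonneg[OF that] t by (intro power_mono) auto
      also have "\<dots> \<le> q k ^ 2 + 1"
      proof -
        have "0 \<le> (q k - 1)\<^sup>2" by simp
        then have "q k * 2 \<le> q k ^ 2 + 1" by (simp add: power2_diff)
        then show ?thesis using p nonneg[OF that] by (elim disjE) simp_all
      qed
      finally have "v k * lead_ones n k \<le> (q k ^ 2 + 1) * real (lead_ones n k)"
        by (intro mult_right_mono) auto
      moreover have "(q k ^ 2 + 1) * R \<le> (q k ^ 2)\<^sup>2 + 1 + R\<^sup>2" for R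
      proof -
        have "0 \<le> (q k ^ 2 - R)\<^sup>2" "0 \<le> (1 - R)\<^sup>2" "0 \<le> (q k ^ 2)\<^sup>2" by simp_all
        then show ?thesis unfolding power2_diff distrib_right one_power2 mult_1 mult.assoc mult_1_right by linarith
      qed
      ultimately show ?thesis 
        using order_trans by (fastforce simp flip: power_mult)
    qed
    have "?L \<le> (\<Sum>i<n. \<Sum>B\<in>Pow {..<n}. \<bar>v (set_encode B) - v (set_encode (flip i B))\<bar>)"
    proof (intro sum_mono)
      fix i B assume i: "i \<in> {..<n}" "B \<in> Pow {..<n}"
      have "0 \<le> min t (q (set_encode B))" "0 \<le> min t (q (set_encode (flip i B)))"
        using i nonneg flip_less set_encode_less t by auto
      then show "\<bar>min t (q (set_encode B)) - min t (q (set_encode (flip i B)))\<bar> ^ p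
          \<le> \<bar>v (set_encode B) - v (set_encode (flip i B))\<bar>"
        unfolding v_def by (rule abs_diff_power_le[OF _ _ p])
    qed
    also have "\<dots> \<le> 2 * (\<Sum>k<2 ^ n. v k * lead_ones n k)"
    proof (rule flip_sum_mono)
      fix k l :: nat assume kl: "k \<le> l" "l < 2 ^ n"
      then have "q k \<le> q l" "0 \<le> q k" using mono nonneg by auto
      then show "v k \<le> v l" unfolding v_def using t by (intro power_mono) auto
    qed (rule v0)
    also have "\<dots> \<le> 2 * (\<Sum>k<2 ^ n. q k ^ 4 + 1 + (real (lead_ones n k))\<^sup>2)"
      using v_le by (intro mult_left_mono sum_mono) auto
    also have "\<dots> \<le> 2 * ((m4 + 101) * 2 ^ n)"
      using m4 sum_lead_ones_square[of n] by (simp add: sum.distrib algebra_simps)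
    also have "(2::real) ^ n \<le> 2 * ?R"
    proof -
      have le: "(2::nat) ^ (n - 1) \<le> 2 ^ n" by simp
      have nn: "(2::real) ^ n = 2 * 2 ^ (n - 1)" using n by (cases n) auto
      have "(2::real) ^ (n - 1) = (\<Sum>k<(2::nat) ^ (n - 1). 1)" by simp
      also have "\<dots> \<le> (\<Sum>k<2 ^ (n - 1). real (if q k < t then 1 + lead_zeros n k else 0))"
      proof (rule sum_mono)
        fix k :: nat assume "k \<in> {..<2 ^ (n - 1)}"
        then have "q k < t" using t1(2)[of k] False by simp
        then show "(1::real) \<le> real (if q k < t then 1 + lead_zeros n k else 0)" by simp
      qed
      also have "\<dots> \<le> (\<Sum>k<2 ^ n. real (if q k < t then 1 + lead_zeros n k else 0))"
        using le by (intro sum_mono2) (auto intro: less_le_trans)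
      finally have "(2::real) ^ (n - 1) \<le> ?R" by simp
      then show ?thesis using nn by linarith
    qed
    finally have "?L \<le> 2 * ((m4 + 101) * (2 * ?R))" using m40 by simp
    also have "\<dots> = (4 * (m4 + 101)) * ?R" by simp
    also have "\<dots> \<le> ?C * ?R" using R0 by (intro mult_right_mono) auto
    finally show ?thesis .
  qed
qed

section \<open>Averages over the digits of single edges\<close>

lemma cube_avg_Un:
  assumes "finite S" "finite T" "S \<inter> T = {}"
  shows "cube_avg (S \<union> T) f = cube_avg S (\<lambda>A. cube_avg T (\<lambda>B. f (A \<union> B)))"
  using assms(2,3)
proof (induction T arbitrary: f rule: finite_induct)
  case (insert j T)
  have "cube_avg (S \<union> insert j T) f = cube_avg (insert j (S \<union> T)) f" by simp
  also have "\<dots> = (cube_avg (S \<union> T) f + cube_avg (S \<union> T) (\<lambda>A. f (insert j A))) / 2"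
    using insert assms(1) by (subst cube_avg_insert) auto
  also have "\<dots> = cube_avg S (\<lambda>A. (cube_avg T (\<lambda>B. f (A \<union> B)) + cube_avg T (\<lambda>B. f (insert j (A \<union> B)))) / 2)"
    using insert by (simp add: cube_avg_add cube_avg_divide)
  also have "\<dots> = cube_avg S (\<lambda>A. cube_avg (insert j T) (\<lambda>B. f (A \<union> B)))"
    using insert by (simp add: cube_avg_insert)
  finally show ?case .
qed simp

lemma cube_avg_image:
  assumes "inj_on \<sigma> S"
  shows "cube_avg (\<sigma> ` S) f = cube_avg S (\<lambda>A. f (\<sigma> ` A))"
proof -
  have "inj_on ((`) \<sigma>) (Pow S)" using assms by (simp add: inj_on_image_Pow)
  moreover have "Pow (\<sigma> ` S) = ((`) \<sigma>) ` Pow S" by (simp add: image_Pow_surj)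
  ultimately show ?thesis using assms
    by (simp add: cube_avg_def sum.reindex card_image)
qed

lemma cube_avg_indep:
  assumes "finite S'" "S \<subseteq> S'" "\<And>A. A \<subseteq> S' \<Longrightarrow> f A = f (A \<inter> S)"
  shows "cube_avg S' f = cube_avg S f"
proof -
  have "S' = S \<union> (S' - S)" using assms by auto
  then have "cube_avg S' f = cube_avg (S \<union> (S' - S)) f" by simp
  also have "\<dots> = cube_avg S (\<lambda>A. cube_avg (S' - S) (\<lambda>B. f (A \<union> B)))"
    using assms by (intro cube_avg_Un) (auto intro: finite_subset)
  also have "\<dots> = cube_avg S (\<lambda>A. cube_avg (S' - S) (\<lambda>B. f A))"
  proof (intro cube_avg_cong)
    fix A B assume AB: "A \<subseteq> S" "B \<subseteq> S' - S"
    then have "(A \<union> B) \<inter> S = A" by auto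
    then show "f (A \<union> B) = f A" using assms(3)[of "A \<union> B"] AB assms(2) by auto
  qed
  also have "\<dots> = cube_avg S f" using assms by (simp add: cube_avg_const)
  finally show ?thesis .
qed

text \<open>A configuration is the set of pairs of an edge and a position at which its digit is 1;
  position \<open>n - 1\<close> is the most significant.\<close>

definition edge_code :: "nat \<Rightarrow> ('e \<times> nat) set \<Rightarrow> 'e \<Rightarrow> nat" where
  "edge_code n A e = set_encode {i. i < n \<and> (e, i) \<in> A}"

lemma edge_code_less: "edge_code n A e < 2 ^ n"
  unfolding edge_code_def by (rule set_encode_less) auto

lemma edge_code_Un:
  "A \<subseteq> (F - {e}) \<times> UNIV \<Longrightarrow> B \<subseteq> {..<n} \<Longrightarrow> edge_code n (A \<union> {e} \<times> B) e = set_encode B"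
  "e' \<noteq> e \<Longrightarrow> edge_code n (A \<union> {e} \<times> B) e' = edge_code n A e'"
  unfolding edge_code_def by (auto intro!: arg_cong[where f = set_encode])

lemma cube_avg_edge:
  fixes n :: nat
  assumes "finite F" "e \<in> F"
  shows "cube_avg (F \<times> {..<n}) f =
    cube_avg ((F - {e}) \<times> {..<n}) (\<lambda>A. cube_avg {..<n} (\<lambda>B. f (A \<union> {e} \<times> B)))"
proof -
  have "F \<times> {..<n} = (F - {e}) \<times> {..<n} \<union> {e} \<times> {..<n}" using assms by auto
  also have "cube_avg \<dots> f = cube_avg ((F - {e}) \<times> {..<n}) (\<lambda>A. cube_avg ({e} \<times> {..<n}) (\<lambda>B. f (A \<union> B)))"
    using assms by (intro cube_avg_Un finite_cartesian_product) auto
  also have "\<dots> = cube_avg ((F - {e}) \<times> {..<n}) (\<lambda>A. cube_avg {..<n} (\<lambda>B. f (A \<union> {e} \<times> B)))"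
  proof (rule cube_avg_cong)
    fix A
    have "{e} \<times> B = Pair e ` B" for B :: "nat set" by auto
    then show "cube_avg ({e} \<times> {..<n}) (\<lambda>B. f (A \<union> B)) = cube_avg {..<n} (\<lambda>B. f (A \<union> {e} \<times> B))"
      by (simp add: cube_avg_image inj_on_def)
  qed
  finally show ?thesis .
qed

lemma cube_avg_set_encode: "cube_avg {..<n} (\<lambda>B. g (set_encode B)) = (\<Sum>k<2 ^ n. g k) / 2 ^ n"
  by (simp add: cube_avg_def sum_set_encode)

lemma cube_avg_prod:
  assumes "finite F"
  shows "cube_avg (F \<times> {..<n}) (\<lambda>A. \<Prod>e\<in>F. g e (edge_code n A e)) = (\<Prod>e\<in>F. (\<Sum>k<2 ^ n. g e k) / 2 ^ n)"
  using assms
proof (induction F rule: finite_induct)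
  case (insert e F)
  have F: "insert e F - {e} = F" using insert by auto
  have "cube_avg (insert e F \<times> {..<n}) (\<lambda>A. \<Prod>e\<in>insert e F. g e (edge_code n A e)) =
     cube_avg (F \<times> {..<n}) (\<lambda>A. cube_avg {..<n} (\<lambda>B. (\<Prod>e\<in>F. g e (edge_code n A e)) * g e (set_encode B)))"
    using insert(1,2) unfolding cube_avg_edge[OF finite.insertI[OF insert(1)] insertI1] F
  proof (intro cube_avg_cong)
    fix A B assume AB: "A \<subseteq> F \<times> {..<n}" "B \<subseteq> {..<n}"
    have "(\<Prod>e'\<in>F. g e' (edge_code n (A \<union> {e} \<times> B) e')) = (\<Prod>e'\<in>F. g e' (edge_code n A e'))"
      using insert(2) by (intro prod.cong refl) (metis edge_code_Un(2))
    moreover have "edge_code n (A \<union> {e} \<times> B) e = set_encode B"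
      using AB insert(2) by (intro edge_code_Un(1)[of A F]) auto
    ultimately show "(\<Prod>e'\<in>insert e F. g e' (edge_code n (A \<union> {e} \<times> B) e')) =
        (\<Prod>e\<in>F. g e (edge_code n A e)) * g e (set_encode B)"
      using insert(1,2) by (simp add: mult.commute)
  qed
  also have "\<dots> = cube_avg (F \<times> {..<n}) (\<lambda>A. (\<Sum>k<2 ^ n. g e k) / 2 ^ n * (\<Prod>e\<in>F. g e (edge_code n A e)))"
    unfolding cube_avg_cmult cube_avg_set_encode by (simp add: cube_avg_cmult cube_avg_divide mult.commute)
  also have "\<dots> = (\<Prod>e\<in>insert e F. (\<Sum>k<2 ^ n. g e k) / 2 ^ n)"
    using insert by (simp add: cube_avg_cmult cube_avg_divide)
  finally show ?case .
qed simp

lemma cube_avg_edge_code: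
  assumes "finite F" "e \<in> F"
  shows "cube_avg (F \<times> {..<n}) (\<lambda>A. g (edge_code n A e)) = (\<Sum>k<2 ^ n. g k) / 2 ^ n"
proof -
  have "cube_avg (F \<times> {..<n}) (\<lambda>A. g (edge_code n A e)) =
     cube_avg ((F - {e}) \<times> {..<n}) (\<lambda>A. cube_avg {..<n} (\<lambda>B. g (set_encode B)))"
    unfolding cube_avg_edge[OF assms]
  proof (intro cube_avg_cong)
    fix A B assume AB: "A \<subseteq> (F - {e}) \<times> {..<n}" "B \<subseteq> {..<n}"
    then have "edge_code n (A \<union> {e} \<times> B) e = set_encode B"
      by (intro edge_code_Un(1)[of A F]) auto
    then show "g (edge_code n (A \<union> {e} \<times> B) e) = g (set_encode B)" by simp
  qed
  then show ?thesis using assms by (simp add: cube_avg_const cube_avg_set_encode)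
qed

lemma cube_avg_prod_subset:
  assumes "finite F" "E \<subseteq> F"
  shows "cube_avg (F \<times> {..<n}) (\<lambda>A. \<Prod>e\<in>E. g (edge_code n A e)) = ((\<Sum>k<2 ^ n. g k) / 2 ^ n) ^ card E"
proof -
  have "cube_avg (F \<times> {..<n}) (\<lambda>A. \<Prod>e\<in>E. g (edge_code n A e)) =
     cube_avg (F \<times> {..<n}) (\<lambda>A. \<Prod>e\<in>F. (if e \<in> E then g (edge_code n A e) else 1))"
    using assms by (simp add: prod.If_cases Int_absorb1 Int_absorb2)
  also have "\<dots> = (\<Prod>e\<in>F. (\<Sum>k<2 ^ n. (if e \<in> E then g k else 1)) / 2 ^ n)"
    by (rule cube_avg_prod[OF assms(1), of n "\<lambda>e k. if e \<in> E then g k else 1"])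
  also have "\<dots> = (\<Prod>e\<in>F. if e \<in> E then (\<Sum>k<2 ^ n. g k) / 2 ^ n else 1)"
    by (intro prod.cong) auto
  also have "\<dots> = ((\<Sum>k<2 ^ n. g k) / 2 ^ n) ^ card E"
    using assms by (simp add: prod.If_cases Int_absorb1 Int_absorb2)
  finally show ?thesis .
qed

lemma flip_edge_Un:
  assumes "A \<subseteq> (F - {e}) \<times> UNIV"
  shows "flip (e, i) (A \<union> {e} \<times> B) = A \<union> {e} \<times> flip i B"
  using assms by (auto simp: flip_def)

text \<open>With the digits of all other edges fixed, \<open>f\<close> is a constant plus a
  truncation of \<open>q\<close>, so the one-edge estimate applies and is then averaged.
  \<open>P\<close> will be the event that the geodesic uses \<open>e\<close>; it has to hold
  wherever the truncation is inactive.\<close>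

lemma edge_influence_le:
  fixes q :: "nat \<Rightarrow> real"
  assumes "finite F" "e \<in> F" "0 < n"
    and "\<And>k l. k \<le> l \<Longrightarrow> l < 2 ^ n \<Longrightarrow> q k \<le> q l"
    and "\<And>k. k < 2 ^ n \<Longrightarrow> 0 \<le> q k"
    and "0 \<le> t1" "\<And>k. k < 2 ^ (n - 1) \<Longrightarrow> q k < t1"
    and "(\<Sum>k<2 ^ n. q k ^ 4) \<le> m4 * 2 ^ n"
    and p: "p = 1 \<or> p = 2"
    and f: "\<And>A. A \<subseteq> (F - {e}) \<times> {..<n} \<Longrightarrow> \<exists>t c. \<forall>B\<subseteq>{..<n}. f (A \<union> {e} \<times> B) = c + min t (q (set_encode B)) \<and>
              (q (set_encode B) < t \<longrightarrow> P (A \<union> {e} \<times> B))"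
  shows "(\<Sum>i<n. cube_avg (F \<times> {..<n}) (\<lambda>A. \<bar>cube_diff (e, i) f A\<bar> ^ p))
    \<le> (2 * (1 + t1)\<^sup>2 + 4 * (m4 + 101)) *
        cube_avg (F \<times> {..<n}) (\<lambda>A. if P A then 1 + real (lead_zeros n (edge_code n A e)) else 0)"
    (is "_ \<le> ?C * _")
proof -
  let ?S = "(F - {e}) \<times> {..<n}"
  have m40: "0 \<le> ?C"
  proof -
    have "0 \<le> (\<Sum>k<2 ^ n. q k ^ 4)" by (intro sum_nonneg) simp
    then have "0 \<le> m4 * 2 ^ n" using assms(8) by linarith
    then have "0 \<le> m4" using zero_less_power[of "2::real" n] by (smt (verit) mult_neg_pos)
    then show ?thesis by simp
  qed
  have "(\<Sum>i<n. cube_avg (F \<times> {..<n}) (\<lambda>A. \<bar>cube_diff (e, i) f A\<bar> ^ p)) =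
     cube_avg ?S (\<lambda>A. \<Sum>i<n. cube_avg {..<n} (\<lambda>B. \<bar>f (A \<union> {e} \<times> B) - f (A \<union> {e} \<times> flip i B)\<bar> ^ p))"
    unfolding cube_avg_edge[OF assms(1,2)] cube_avg_sum
  proof (intro sum.cong refl cube_avg_cong)
    fix i A B assume A: "A \<subseteq> ?S"
    then have "flip (e, i) (A \<union> {e} \<times> B) = A \<union> {e} \<times> flip i B" by (intro flip_edge_Un) auto
    then show "\<bar>cube_diff (e, i) f (A \<union> {e} \<times> B)\<bar> ^ p = \<bar>f (A \<union> {e} \<times> B) - f (A \<union> {e} \<times> flip i B)\<bar> ^ p"
      by (simp add: cube_diff_def)
  qed
  also have "\<dots> \<le> cube_avg ?S (\<lambda>A. ?C * cube_avg {..<n} (\<lambda>B. if P (A \<union> {e} \<times> B) then 1 + real (lead_zeros n (set_encode B)) else 0))"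
  proof (rule cube_avg_mono)
    fix A assume A: "A \<subseteq> ?S"
    from f[OF A] obtain t c where tc: "\<And>B. B \<subseteq> {..<n} \<Longrightarrow> f (A \<union> {e} \<times> B) = c + min t (q (set_encode B))"
      "\<And>B. B \<subseteq> {..<n} \<Longrightarrow> q (set_encode B) < t \<Longrightarrow> P (A \<union> {e} \<times> B)" by blast
    have "(\<Sum>i<n. cube_avg {..<n} (\<lambda>B. \<bar>f (A \<union> {e} \<times> B) - f (A \<union> {e} \<times> flip i B)\<bar> ^ p)) =
      (\<Sum>i<n. \<Sum>B\<in>Pow {..<n}. \<bar>min t (q (set_encode B)) - min t (q (set_encode (flip i B)))\<bar> ^ p) / 2 ^ n"
      unfolding cube_avg_def sum_divide_distrib
    proof (intro sum.cong)
      fix i B assume "i \<in> {..<n}" "B \<in> Pow {..<n}"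
      then have "B \<subseteq> {..<n}" "flip i B \<subseteq> {..<n}" by (auto simp: flip_def)
      then show "\<bar>f (A \<union> {e} \<times> B) - f (A \<union> {e} \<times> flip i B)\<bar> ^ p / 2 ^ card {..<n} =
          \<bar>min t (q (set_encode B)) - min t (q (set_encode (flip i B)))\<bar> ^ p / 2 ^ n"
        by (simp add: tc(1))
    qed auto
    also have "\<dots> \<le> (?C * (\<Sum>k<2 ^ n. if q k < t then 1 + lead_zeros n k else 0)) / 2 ^ n"
      using assms by (intro divide_right_mono flip_sum_min_le) auto
    also have "\<dots> = ?C * cube_avg {..<n} (\<lambda>B. if q (set_encode B) < t then 1 + real (lead_zeros n (set_encode B)) else 0)"
      by (subst cube_avg_set_encode[of n "\<lambda>k. if q k < t then 1 + real (lead_zeros n k) else 0"])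
        (simp add: if_distrib[of real] cong: if_cong)
    also have "\<dots> \<le> ?C * cube_avg {..<n} (\<lambda>B. if P (A \<union> {e} \<times> B) then 1 + real (lead_zeros n (set_encode B)) else 0)"
      using m40 tc(2) by (intro mult_left_mono cube_avg_mono) auto
    finally show "(\<Sum>i<n. cube_avg {..<n} (\<lambda>B. \<bar>f (A \<union> {e} \<times> B) - f (A \<union> {e} \<times> flip i B)\<bar> ^ p))
      \<le> ?C * cube_avg {..<n} (\<lambda>B. if P (A \<union> {e} \<times> B) then 1 + real (lead_zeros n (set_encode B)) else 0)" .
  qed
  also have "\<dots> = ?C * cube_avg (F \<times> {..<n}) (\<lambda>A. if P A then 1 + real (lead_zeros n (edge_code n A e)) else 0)"
    unfolding cube_avg_edge[OF assms(1,2)] cube_avg_cmult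
  proof (intro arg_cong2[where f="(*)"] refl cube_avg_cong)
    fix A B assume "A \<subseteq> ?S" "B \<subseteq> {..<n}"
    then have "edge_code n (A \<union> {e} \<times> B) e = set_encode B" by (intro edge_code_Un(1)[of A F]) auto
    then show "(if P (A \<union> {e} \<times> B) then 1 + real (lead_zeros n (set_encode B)) else 0) =
      (if P (A \<union> {e} \<times> B) then 1 + real (lead_zeros n (edge_code n (A \<union> {e} \<times> B) e)) else 0)" by simp
  qed
  finally show ?thesis .
qed

text \<open>Greedy lattice animals: the sum of the exponential moments over all candidate paths controls the
  exponential moment along the random path.\<close>

lemma greedy_path_le:
  fixes q w :: "nat \<Rightarrow> real"
  assumes F: "finite F" and Q: "finite Q" "\<And>p. p \<in> Q \<Longrightarrow> E p \<subseteq> F"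
    and r: "(\<Sum>k<2 ^ n. exp (w k - \<kappa> * q k)) \<le> r * 2 ^ n"
    and K: "0 < K" "(\<Sum>p\<in>Q. r ^ card (E p)) \<le> K"
    and \<sigma>: "\<And>A. A \<subseteq> F \<times> {..<n} \<Longrightarrow> \<sigma> A \<in> Q"
  shows "cube_avg (F \<times> {..<n}) (\<lambda>A. \<Sum>e\<in>E (\<sigma> A). w (edge_code n A e))
    \<le> \<kappa> * cube_avg (F \<times> {..<n}) (\<lambda>A. \<Sum>e\<in>E (\<sigma> A). q (edge_code n A e)) + ln K"
proof -
  let ?I = "cube_avg (F \<times> {..<n})"
  define y where "y p A = (\<Sum>e\<in>E p. w (edge_code n A e) - \<kappa> * q (edge_code n A e))" for p A
  have "?I (\<lambda>A. y (\<sigma> A) A) \<le> ?I (\<lambda>A. (ln K - 1) + (\<Sum>p\<in>Q. exp (y p A)) / K)"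
  proof (rule cube_avg_mono)
    fix A assume A: "A \<subseteq> F \<times> {..<n}"
    \<comment> \<open>Jensen's inequality for \<open>ln\<close>, linearised at \<open>K\<close>. The
      path may depend on \<open>A\<close>, so its term is bounded by the sum over all
      candidates.\<close>
    have "1 + (y (\<sigma> A) A - ln K) \<le> exp (y (\<sigma> A) A - ln K)" by (rule exp_ge_add_one_self)
    also have "\<dots> = exp (y (\<sigma> A) A) / K" using K by (simp add: exp_diff)
    also have "\<dots> \<le> (\<Sum>p\<in>Q. exp (y p A)) / K"
      using K \<sigma>[OF A] Q by (intro divide_right_mono member_le_sum) auto
    finally show "y (\<sigma> A) A \<le> (ln K - 1) + (\<Sum>p\<in>Q. exp (y p A)) / K" by simp
  qed
  also have "\<dots> = ln K - 1 + (\<Sum>p\<in>Q. ?I (\<lambda>A. exp (y p A))) / K"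
    using F by (simp add: cube_avg_add cube_avg_diff cube_avg_const cube_avg_divide cube_avg_sum)
  also have "\<dots> \<le> ln K - 1 + 1"
  proof -
    have "(\<Sum>p\<in>Q. ?I (\<lambda>A. exp (y p A))) \<le> (\<Sum>p\<in>Q. r ^ card (E p))"
    proof (rule sum_mono)
      fix p assume p: "p \<in> Q"
      have "finite (E p)" using Q(2)[OF p] F by (rule finite_subset)
      then have "?I (\<lambda>A. exp (y p A)) = ?I (\<lambda>A. \<Prod>e\<in>E p. exp (w (edge_code n A e) - \<kappa> * q (edge_code n A e)))"
        unfolding y_def by (simp add: exp_sum)
      also have "\<dots> = ((\<Sum>k<2 ^ n. exp (w k - \<kappa> * q k)) / 2 ^ n) ^ card (E p)"
        by (rule cube_avg_prod_subset[OF F Q(2)[OF p]])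
      also have "\<dots> \<le> r ^ card (E p)"
        using r by (intro power_mono) (auto simp: divide_le_eq intro!: divide_nonneg_nonneg sum_nonneg)
      finally show "?I (\<lambda>A. exp (y p A)) \<le> r ^ card (E p)" .
    qed
    then show ?thesis using K by simp
  qed
  finally have "?I (\<lambda>A. y (\<sigma> A) A) \<le> ln K" by simp
  then show ?thesis unfolding y_def
    by (simp add: sum_subtractf cube_avg_diff cube_avg_cmult flip: sum_distrib_left)
qed

section \<open>Lattice paths\<close>

lemma l1_norm_nonneg: "0 \<le> l1_norm v"
  by (simp add: l1_norm_def sum_nonneg)

lemma l1_norm_minus: "l1_norm (u - w) = l1_norm (w - u)"
  by (simp add: l1_norm_def abs_minus_commute)

lemma l1_norm_triangle: "l1_norm (u + w) \<le> l1_norm u + l1_norm w"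
  unfolding l1_norm_def sum.distrib[symmetric] by (intro sum_mono) simp

lemma abs_le_l1_norm: "real_of_int \<bar>v $ i\<bar> \<le> l1_norm v"
  unfolding l1_norm_def by (rule member_le_sum) auto

lemma l1_norm_of_nat: "\<exists>k. l1_norm v = real k"
  by (rule exI[of _ "\<Sum>i\<in>UNIV. nat \<bar>v $ i\<bar>"]) (simp add: l1_norm_def)

lemma lattice_edge_iff: "{u, w} \<in> lattice_edges \<longleftrightarrow> l1_norm (u - w) = 1"
  unfolding lattice_edges_def by (auto simp: doubleton_eq_iff l1_norm_minus)

lemma l1_norm_add_axis:
  fixes v :: "int ^ 'd::finite"
  shows "l1_norm (v + axis i s) = l1_norm v - real_of_int \<bar>v $ i\<bar> + real_of_int \<bar>v $ i + s\<bar>"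
  unfolding l1_norm_def
  by (subst (1 2) sum.remove[of UNIV i]) (auto simp: axis_def intro!: sum.cong)

definition lattice_box :: "int \<Rightarrow> (int ^ 'd::finite) set" where
  "lattice_box N = {v. \<forall>i. \<bar>v $ i\<bar> \<le> N}"

lemma finite_box: "finite (lattice_box N :: (int ^ 'd::finite) set)"
proof -
  have "lattice_box N \<subseteq> vec_lambda ` (PiE (UNIV :: 'd set) (\<lambda>_. {-N..N}))"
  proof
    fix v :: "int ^ 'd" assume "v \<in> lattice_box N"
    then have "vec_nth v \<in> PiE UNIV (\<lambda>_. {-N..N})" by (auto simp: lattice_box_def abs_le_iff minus_le_iff)
    then show "v \<in> vec_lambda ` (PiE UNIV (\<lambda>_. {-N..N}))" by (metis image_eqI vec_nth_inverse)
  qed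
  then show ?thesis by (rule finite_subset) (intro finite_imageI finite_PiE, auto)
qed

text \<open>Boxes, their translates and the whole lattice all have this property. It provides paths
  that stay in the region and whose length is known.\<close>

definition geodesic_set :: "(int ^ 'd) set \<Rightarrow> bool" where
  "geodesic_set \<Lambda> \<longleftrightarrow> (\<forall>u\<in>\<Lambda>. \<forall>w\<in>\<Lambda>. \<exists>p. lattice_path u w p \<and> set p \<subseteq> \<Lambda> \<and> real (length p - 1) = l1_norm (u - w))"

text \<open>Each step moves one coordinate towards its goal, which lowers the distance by one. The
  path never leaves the coordinate ranges spanned by its ends, hence no box containing them.\<close>

lemma monotone_path:
  fixes u w :: "int ^ 'd::finite"
  assumes "l1_norm (u - w) = real k"
  shows "\<exists>p. lattice_path u w p \<and> length p = Suc k \<and>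
    (\<forall>y\<in>set p. \<forall>i. min (u $ i) (w $ i) \<le> y $ i \<and> y $ i \<le> max (u $ i) (w $ i))"
  using assms
proof (induction k arbitrary: u)
  case 0
  then have "(u - w) $ i = 0" for i using abs_le_l1_norm[of "u - w" i] by simp
  then have "u = w" by (simp add: vec_eq_iff)
  then show ?case by (intro exI[of _ "[u]"]) (simp add: lattice_path_def)
next
  case (Suc k)
  have "\<exists>i. u $ i \<noteq> w $ i"
  proof (rule ccontr)
    assume "\<not> ?thesis"
    then have "l1_norm (u - w) = 0" by (simp add: l1_norm_def)
    then show False using Suc.prems by simp
  qed
  then obtain i where i: "u $ i \<noteq> w $ i" by blast
  define s where "s = sgn (w $ i - u $ i)"
  define u' where "u' = u + axis i s"
  have s: "s = 1 \<and> u $ i < w $ i \<or> s = -1 \<and> w $ i < u $ i" using i by (cases "u $ i < w $ i") (auto simp: s_def)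
  have eq: "u' - w = (u - w) + axis i s" by (simp add: u'_def)
  have "l1_norm (u' - w) = real (Suc k) - real_of_int \<bar>u $ i - w $ i\<bar> + real_of_int \<bar>u $ i - w $ i + s\<bar>"
    unfolding eq l1_norm_add_axis using Suc.prems by simp
  also have "\<dots> = real k" using s by auto
  finally obtain p where p: "lattice_path u' w p" "length p = Suc k"
    and y: "\<forall>y\<in>set p. \<forall>i. min (u' $ i) (w $ i) \<le> y $ i \<and> y $ i \<le> max (u' $ i) (w $ i)"
    using Suc.IH by blast
  have "l1_norm (u - u') = 1"
    using l1_norm_add_axis[of 0 i "-s"] s unfolding u'_def
    by (auto simp: l1_norm_def axis_def if_distrib cong: if_cong)
  then have edge: "{u, u'} \<in> lattice_edges" by (simp add: lattice_edge_iff)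
  have path: "lattice_path u w (u # p)"
    using p edge unfolding lattice_path_def by (cases p) auto
  have u'_between: "min (u $ j) (w $ j) \<le> u' $ j \<and> u' $ j \<le> max (u $ j) (w $ j)" for j
    using s unfolding u'_def by (auto simp: axis_def)
  have "min (u $ j) (w $ j) \<le> y $ j \<and> y $ j \<le> max (u $ j) (w $ j)" if "y \<in> set (u # p)" for y j
  proof (cases "y = u")
    case False
    then have "min (u' $ j) (w $ j) \<le> y $ j \<and> y $ j \<le> max (u' $ j) (w $ j)" using that y by auto
    then show ?thesis using u'_between[of j] by linarith
  qed auto
  then show ?case using path p(2) by (intro exI[of _ "u # p"]) auto
qed

lemma geodesic_set_box: "geodesic_set (lattice_box N :: (int ^ 'd::finite) set)"
  unfolding geodesic_set_def
proof (intro ballI)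
  fix u w :: "int ^ 'd" assume uw: "u \<in> lattice_box N" "w \<in> lattice_box N"
  obtain k where k: "l1_norm (u - w) = real k" using l1_norm_of_nat by blast
  from monotone_path[OF k] obtain p where p: "lattice_path u w p" "length p = Suc k"
    "\<forall>y\<in>set p. \<forall>i. min (u $ i) (w $ i) \<le> y $ i \<and> y $ i \<le> max (u $ i) (w $ i)" by blast
  have "set p \<subseteq> lattice_box N"
  proof
    fix y assume "y \<in> set p"
    then have "min (u $ i) (w $ i) \<le> y $ i \<and> y $ i \<le> max (u $ i) (w $ i)" for i using p by blast
    moreover have "\<bar>u $ i\<bar> \<le> N" "\<bar>w $ i\<bar> \<le> N" for i using uw by (auto simp: lattice_box_def)
    ultimately have "min (u $ i) (w $ i) \<le> y $ i" "y $ i \<le> max (u $ i) (w $ i)" "\<bar>u $ i\<bar> \<le> N" "\<bar>w $ i\<bar> \<le> N" for i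
      by blast+
    note bounds = this
    have "\<bar>y $ i\<bar> \<le> N" for i
      using bounds[of i] by linarith
    then show "y \<in> lattice_box N" by (simp add: lattice_box_def)
  qed
  then show "\<exists>p. lattice_path u w p \<and> set p \<subseteq> lattice_box N \<and> real (length p - 1) = l1_norm (u - w)"
    using p k by auto
qed

lemma geodesic_set_UNIV: "geodesic_set (UNIV :: (int ^ 'd::finite) set)"
  unfolding geodesic_set_def
proof (intro ballI)
  fix u w :: "int ^ 'd"
  obtain k where k: "l1_norm (u - w) = real k" using l1_norm_of_nat by blast
  from monotone_path[OF k] show "\<exists>p. lattice_path u w p \<and> set p \<subseteq> UNIV \<and> real (length p - 1) = l1_norm (u - w)"
    using k by auto
qed

section \<open>Edges and passage times of paths\<close>

definition path_edges :: "(int ^ 'd) list \<Rightarrow> (int ^ 'd) set set" where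
  "path_edges p = (\<lambda>i. {p ! i, p ! Suc i}) ` {..<length p - 1}"

lemma finite_path_edges [simp]: "finite (path_edges p)"
  by (simp add: path_edges_def)

lemma path_edges_lattice: "lattice_path u w p \<Longrightarrow> path_edges p \<subseteq> lattice_edges"
  unfolding lattice_path_def path_edges_def by (auto simp: successively_conv_nth less_diff_conv)

lemma inj_on_path_edge: "distinct p \<Longrightarrow> inj_on (\<lambda>i. {p ! i, p ! Suc i}) {..<length p - 1}"
  by (rule inj_onI) (auto simp: doubleton_eq_iff nth_eq_iff_index_eq less_diff_conv)

lemma path_time_sum: "distinct p \<Longrightarrow> path_time x p = sum x (path_edges p)"
  unfolding path_time_def path_edges_def by (subst sum.reindex[OF inj_on_path_edge]) simp_all

lemma card_path_edges: "distinct p \<Longrightarrow> card (path_edges p) = length p - 1"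
  unfolding path_edges_def by (subst card_image[OF inj_on_path_edge]) simp_all

lemma path_time_Cons: "path_time x (a # b # p) = x {a, b} + path_time x (b # p)"
  unfolding path_time_def by (simp add: sum.lessThan_Suc_shift del: sum.lessThan_Suc)

lemma path_time_append: "path_time x (p @ c # q) = path_time x (p @ [c]) + path_time x (c # q)"
proof (induction p)
  case Nil
  show ?case by (simp add: path_time_def)
next
  case (Cons a p)
  then show ?case by (cases p) (auto simp: path_time_Cons)
qed

lemma path_time_nonneg:
  assumes "lattice_path u w p" "\<And>e. e \<in> lattice_edges \<Longrightarrow> 0 \<le> x e"
  shows "0 \<le> path_time x p"
proof -
  have "x {p ! i, p ! Suc i} \<ge> 0" if "i < length p - 1" for i
    using path_edges_lattice[OF assms(1)] that by (intro assms(2)) (auto simp: path_edges_def)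
  then show ?thesis unfolding path_time_def by (intro sum_nonneg) auto
qed

lemma lattice_path_append:
  "lattice_path u c (p @ [c]) \<Longrightarrow> lattice_path c w (c # q) \<Longrightarrow> lattice_path u w (p @ c # q)"
  unfolding lattice_path_def by (auto simp: successively_append_iff hd_append split: if_splits)

lemma lattice_path_split:
  assumes "lattice_path u w (p @ c # q)"
  shows "lattice_path u c (p @ [c])" "lattice_path c w (c # q)"
  using assms unfolding lattice_path_def by (auto simp: successively_append_iff hd_append)

lemma lattice_path_join:
  assumes "lattice_path u c p" "lattice_path c w q"
  shows "lattice_path u w (p @ tl q)" "path_time x (p @ tl q) = path_time x p + path_time x q"
    "set (p @ tl q) \<subseteq> set p \<union> set q"
proof -
  obtain p' where p: "p = p' @ [c]" using assms(1) unfolding lattice_path_def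
    by (metis append_butlast_last_id)
  obtain q' where q: "q = c # q'" using assms(2) unfolding lattice_path_def
    by (metis list.collapse)
  show "lattice_path u w (p @ tl q)" using lattice_path_append assms unfolding p q by simp
  show "path_time x (p @ tl q) = path_time x p + path_time x q"
    unfolding p q using path_time_append[of x p' c q'] by simp
  show "set (p @ tl q) \<subseteq> set p \<union> set q" by (auto simp: p q)
qed

definition saw :: "(int ^ 'd) set \<Rightarrow> int ^ 'd \<Rightarrow> int ^ 'd \<Rightarrow> (int ^ 'd) list set" where
  "saw \<Lambda> u w = {p. lattice_path u w p \<and> distinct p \<and> set p \<subseteq> \<Lambda>}"

lemma finite_saw: "finite \<Lambda> \<Longrightarrow> finite (saw \<Lambda> u w)"
  unfolding saw_def by (rule finite_subset[OF _ finite_subset_distinct[of \<Lambda>]]) auto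

text \<open>Cutting out a loop removes a closed path, whose time is nonnegative. In a finite region
  this leaves finitely many paths to compare.\<close>

lemma loop_erasure:
  assumes "lattice_path u w p" "set p \<subseteq> \<Lambda>" "\<And>e. e \<in> lattice_edges \<Longrightarrow> 0 \<le> x e"
  shows "\<exists>q\<in>saw \<Lambda> u w. path_time x q \<le> path_time x p"
  using assms(1,2)
proof (induction "length p" arbitrary: p rule: less_induct)
  case less
  show ?case
  proof (cases "distinct p")
    case True
    then show ?thesis using less.prems by (auto simp: saw_def)
  next
    case False
    then obtain as y bs cs where p: "p = as @ [y] @ bs @ [y] @ cs"
      using not_distinct_decomp by blast
    have 1: "lattice_path u y (as @ [y])" and 2: "lattice_path y w (y # bs @ y # cs)"
      using lattice_path_split[of u w as y "bs @ y # cs"] less.prems p by auto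
    have 3: "lattice_path y y (y # bs @ [y])" and 4: "lattice_path y w (y # cs)"
      using lattice_path_split[of y w "y # bs" y cs] 2 by auto
    define q where "q = as @ y # cs"
    have q: "lattice_path u w q" unfolding q_def by (rule lattice_path_append[OF 1 4])
    have "path_time x p = path_time x (as @ [y]) + (path_time x (y # bs @ [y]) + path_time x (y # cs))"
      using path_time_append[of x as y "bs @ y # cs"] path_time_append[of x "y # bs" y cs] p by simp
    moreover have "path_time x q = path_time x (as @ [y]) + path_time x (y # cs)"
      unfolding q_def by (rule path_time_append)
    moreover have "0 \<le> path_time x (y # bs @ [y])" using 3 assms(3) by (rule path_time_nonneg)
    ultimately have "path_time x q \<le> path_time x p" by simp
    moreover have "\<exists>r\<in>saw \<Lambda> u w. path_time x r \<le> path_time x q"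
      using less.prems q by (intro less.hyps) (auto simp: p q_def)
    ultimately show ?thesis by (meson order_trans)
  qed
qed

text \<open>Restricting to self-avoiding paths makes this a minimum over a finite set, thus
  attained, measurable and continuous in the passage times. By loop erasure no other path in the
  region is faster when the times are nonnegative.\<close>

definition box_time :: "(int ^ 'd) set \<Rightarrow> ((int ^ 'd) set \<Rightarrow> real) \<Rightarrow> int ^ 'd \<Rightarrow> int ^ 'd \<Rightarrow> real" where
  "box_time \<Lambda> x u w = Min (path_time x ` saw \<Lambda> u w)"

lemma saw_nonempty:
  assumes "geodesic_set \<Lambda>" "u \<in> \<Lambda>" "w \<in> \<Lambda>"
  shows "saw \<Lambda> u w \<noteq> {}"
proof -
  obtain p where "lattice_path u w p" "set p \<subseteq> \<Lambda>" using assms unfolding geodesic_set_def by blast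
  then show ?thesis using loop_erasure[of u w p \<Lambda> "\<lambda>_. 0"] by auto
qed

lemma box_time_le:
  assumes "finite \<Lambda>" "lattice_path u w p" "set p \<subseteq> \<Lambda>" "\<And>e. e \<in> lattice_edges \<Longrightarrow> 0 \<le> x e"
  shows "box_time \<Lambda> x u w \<le> path_time x p"
proof -
  obtain q where q: "q \<in> saw \<Lambda> u w" "path_time x q \<le> path_time x p"
    using loop_erasure[of u w p \<Lambda> x] assms(2-4) by blast
  have "box_time \<Lambda> x u w \<le> path_time x q"
    unfolding box_time_def using q finite_saw[OF assms(1)] by (intro Min_le) auto
  then show ?thesis using q by simp
qed

lemma box_time_attained:
  assumes "finite \<Lambda>" "saw \<Lambda> u w \<noteq> {}"
  shows "\<exists>p\<in>saw \<Lambda> u w. path_time x p = box_time \<Lambda> x u w"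
proof -
  have "box_time \<Lambda> x u w \<in> path_time x ` saw \<Lambda> u w"
    unfolding box_time_def using assms by (intro Min_in finite_imageI finite_saw) auto
  then show ?thesis by auto
qed

lemma fpp_dist_le:
  assumes "lattice_path u w p" "\<And>e. e \<in> lattice_edges \<Longrightarrow> 0 \<le> x e"
  shows "fpp_dist x u w \<le> path_time x p"
  unfolding fpp_dist_def
proof (rule cINF_lower)
  show "bdd_below (path_time x ` {p. lattice_path u w p})"
    using path_time_nonneg[of u w _ x] assms(2) by (intro bdd_belowI2[where m = 0]) blast
qed (use assms in simp)

text \<open>\<open>P\<close> will be a set of paths with edge sets \<open>E p\<close>. The values \<open>y\<close> are bounded by \<open>Y\<close> because \<open>t\<close> should be
  infinite if all the paths use \<open>e\<close>.\<close>

lemma Min_sum_one_coordinate: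
  fixes x :: "'e \<Rightarrow> real"
  assumes "finite P" "P \<noteq> {}" "\<And>p. p \<in> P \<Longrightarrow> finite (E p)"
  shows "\<exists>t c. \<forall>y\<in>{0..Y}. Min ((\<lambda>p. sum (x(e := y)) (E p)) ` P) = c + min t y \<and>
    (y < t \<longrightarrow> (\<forall>p\<in>P. sum (x(e := y)) (E p) = Min ((\<lambda>p. sum (x(e := y)) (E p)) ` P) \<longrightarrow> e \<in> E p))"
proof -
  define P1 where "P1 = {p\<in>P. e \<in> E p}"
  define P0 where "P0 = {p\<in>P. e \<notin> E p}"
  define s where "s p = sum x (E p - {e})" for p
  have val: "sum (x(e := y)) (E p) = (if p \<in> P1 then s p + y else s p)" if "p \<in> P" for p y
  proof (cases "e \<in> E p")
    case True
    have "sum (x(e := y)) (E p) = y + sum (x(e := y)) (E p - {e})"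
      using True assms(3)[OF that] by (subst sum.remove[of _ e]) auto
    also have "sum (x(e := y)) (E p - {e}) = s p" unfolding s_def by (intro sum.cong) auto
    finally show ?thesis using True that by (simp add: P1_def)
  next
    case False
    then have "E p - {e} = E p" by auto
    moreover have "sum (x(e := y)) (E p) = sum x (E p)" using False by (intro sum.cong) auto
    ultimately show ?thesis using False by (simp add: P1_def s_def)
  qed
  have fin: "finite P0" "finite P1" and un: "P = P0 \<union> P1" and dis: "P0 \<inter> P1 = {}"
    using assms by (auto simp: P0_def P1_def)
  let ?M = "\<lambda>y. Min ((\<lambda>p. sum (x(e := y)) (E p)) ` P)"
  have M0: "?M y = Min (s ` P)" if "P1 = {}" for y
    using val that by (intro arg_cong[where f = Min] image_cong) auto
  have M1: "?M y = Min (s ` P) + y" if "P0 = {}" for y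
  proof -
    have "(\<lambda>p. sum (x(e := y)) (E p)) ` P = (\<lambda>p. s p + y) ` P"
    proof (rule image_cong[OF refl])
      fix p assume "p \<in> P"
      then show "sum (x(e := y)) (E p) = s p + y" using val[of p y] that un by simp
    qed
    then show ?thesis using Min_add_commute[OF assms(1,2), of s y] by simp
  qed
  have M: "?M y = min (Min (s ` P0)) (Min (s ` P1) + y)" if "P0 \<noteq> {}" "P1 \<noteq> {}" for y
  proof -
    have "(\<lambda>p. sum (x(e := y)) (E p)) ` P = s ` P0 \<union> (\<lambda>p. s p + y) ` P1"
      unfolding un image_Un
    proof (intro arg_cong2[where f="(\<union>)"] image_cong refl)
      fix p assume "p \<in> P0"
      then show "sum (x(e := y)) (E p) = s p" using val[of p y] un dis by auto
    next
      fix p assume "p \<in> P1"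
      then show "sum (x(e := y)) (E p) = s p + y" using val[of p y] un by auto
    qed
    then show ?thesis using Min_add_commute[OF fin(2) that(2), of s y] fin that by (simp add: Min_Un)
  qed
  consider "P1 = {}" | "P0 = {}" | "P0 \<noteq> {}" "P1 \<noteq> {}" by blast
  then show ?thesis
  proof cases
    case 1
    show ?thesis using M0[OF 1] by - (rule exI[of _ 0], rule exI[of _ "Min (s ` P)"], auto)
  next
    case 2
    then have "e \<in> E p" if "p \<in> P" for p using that by (auto simp: P0_def)
    then show ?thesis using M1[OF 2] by - (rule exI[of _ "Y + 1"], rule exI[of _ "Min (s ` P)"], auto)
  next
    case 3
    show ?thesis
    \<comment> \<open>The threshold is the extra cost of the best path avoiding \<open>e\<close>,
      compared with the best path through \<open>e\<close> without the time of \<open>e\<close>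
      itself.\<close>
    proof (rule exI[of _ "Min (s ` P0) - Min (s ` P1)"], rule exI[of _ "Min (s ` P1)"], intro ballI conjI impI)
      fix y
      show "?M y = Min (s ` P1) + min (Min (s ` P0) - Min (s ` P1)) y" using M[OF 3] by simp
      fix p assume y: "y < Min (s ` P0) - Min (s ` P1)" and p: "p \<in> P" "sum (x(e := y)) (E p) = ?M y"
      show "e \<in> E p"
      proof (rule ccontr)
        assume "e \<notin> E p"
        then have "p \<in> P0" "p \<notin> P1" using p by (auto simp: P0_def P1_def)
        then have "sum (x(e := y)) (E p) = s p" "Min (s ` P0) \<le> s p" using val[OF p(1), of y] fin by simp_all
        then have "Min (s ` P0) \<le> ?M y" using p(2) by linarith
        then show False using M[OF 3, of y] y by simp
      qed
    qed
  qed
qed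

section \<open>Counting self-avoiding paths\<close>

definition walks_from :: "int ^ 'd \<Rightarrow> nat \<Rightarrow> (int ^ 'd) list set" where
  "walks_from a k = {p. length p = Suc k \<and> hd p = a \<and> successively (\<lambda>a b. {a, b} \<in> lattice_edges) p}"

lemma finite_unit_vectors: "finite {s :: int ^ 'd::finite. l1_norm s = 1}"
proof (rule finite_subset[OF _ finite_box[of 1]])
  show "{s :: int ^ 'd. l1_norm s = 1} \<subseteq> lattice_box 1"
  proof
    fix s :: "int ^ 'd" assume "s \<in> {s. l1_norm s = 1}"
    then have "real_of_int \<bar>s $ i\<bar> \<le> 1" for i using abs_le_l1_norm[of s i] by simp
    then show "s \<in> lattice_box 1" unfolding lattice_box_def using of_int_le_1_iff by blast
  qed
qed

text \<open>The successor makes it positive at once, so that one may divide by it; only an upper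
  bound for the degree is wanted.\<close>

definition lattice_degree :: "'d::finite itself \<Rightarrow> nat" where
  "lattice_degree _ = Suc (card {s :: int ^ 'd. l1_norm s = 1})"

lemma card_walks_from:
  fixes a :: "int ^ 'd::finite"
  shows "finite (walks_from a k) \<and> card (walks_from a k) \<le> lattice_degree TYPE('d) ^ k"
proof (induction k arbitrary: a)
  case 0
  have "walks_from a 0 \<subseteq> {[a]}" by (auto simp: walks_from_def length_Suc_conv)
  then show ?case using finite_subset card_mono[of "{[a]}"] by fastforce
next
  case (Suc k)
  let ?U = "{s :: int ^ 'd. l1_norm s = 1}"
  have sub: "walks_from a (Suc k) \<subseteq> (\<Union>s\<in>?U. (#) a ` walks_from (a + s) k)"
  proof
    fix p assume p: "p \<in> walks_from a (Suc k)"
    then obtain b q where q: "p = a # b # q" by (auto simp: walks_from_def length_Suc_conv)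
    then have "l1_norm (b - a) = 1" "b # q \<in> walks_from b k"
      using p by (auto simp: walks_from_def lattice_edge_iff l1_norm_minus)
    then show "p \<in> (\<Union>s\<in>?U. (#) a ` walks_from (a + s) k)"
      using q by (intro UN_I[of "b - a"]) auto
  qed
  have fin: "finite (\<Union>s\<in>?U. (#) a ` walks_from (a + s) k)"
    using finite_unit_vectors Suc by auto
  have "card (walks_from a (Suc k)) \<le> card (\<Union>s\<in>?U. (#) a ` walks_from (a + s) k)"
    by (rule card_mono[OF fin sub])
  also have "\<dots> \<le> (\<Sum>s\<in>?U. card ((#) a ` walks_from (a + s) k))"
    by (rule card_UN_le[OF finite_unit_vectors])
  also have "\<dots> \<le> (\<Sum>s\<in>?U. lattice_degree TYPE('d) ^ k)"
    using Suc by (intro sum_mono order_trans[OF card_image_le]) auto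
  also have "\<dots> \<le> lattice_degree TYPE('d) ^ Suc k" by (simp add: lattice_degree_def)
  finally show ?case using finite_subset[OF sub fin] by simp
qed

text \<open>The empty list stands for a path that misses the region of interest.\<close>

definition saw_from :: "(int ^ 'd) set \<Rightarrow> (int ^ 'd) set \<Rightarrow> (int ^ 'd) list set" where
  "saw_from \<Lambda> V = {p. distinct p \<and> set p \<subseteq> \<Lambda> \<and> successively (\<lambda>a b. {a, b} \<in> lattice_edges) p \<and> (p = [] \<or> hd p \<in> V)}"

lemma finite_saw_from: "finite \<Lambda> \<Longrightarrow> finite (saw_from \<Lambda> V)"
  unfolding saw_from_def by (rule finite_subset[OF _ finite_subset_distinct[of \<Lambda>]]) auto

text \<open>There are at most \<open>D ^ k\<close> walks of \<open>k\<close> steps from a vertex,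
  and the weight leaves \<open>(1/2) ^ k\<close>. Each starting vertex contributes at most 2, the
  empty list 1. Self-avoidance makes the number of edges equal to the number of steps.\<close>

lemma sum_saw_from_le:
  fixes V \<Lambda> :: "(int ^ 'd::finite) set"
  assumes "finite \<Lambda>" "finite V"
  shows "(\<Sum>p\<in>saw_from \<Lambda> V. (1 / (2 * real (lattice_degree TYPE('d)))) ^ card (path_edges p)) \<le> 2 * card V + 1"
proof -
  define D where "D = real (lattice_degree TYPE('d))"
  have D: "D > 0" by (simp add: D_def lattice_degree_def)
  have sub: "saw_from \<Lambda> V \<subseteq> insert [] (\<Union>a\<in>V. \<Union>k\<le>card \<Lambda>. {p. p \<in> walks_from a k \<and> distinct p})"
  proof
    fix p assume p: "p \<in> saw_from \<Lambda> V"
    show "p \<in> insert [] (\<Union>a\<in>V. \<Union>k\<le>card \<Lambda>. {p. p \<in> walks_from a k \<and> distinct p})"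
    proof (cases p)
      case (Cons a q)
      have "length p \<le> card \<Lambda>"
        using p assms unfolding saw_from_def by (metis (mono_tags, lifting) card_mono distinct_card mem_Collect_eq)
      then have "p \<in> walks_from a (length q)" "length q \<le> card \<Lambda>" "a \<in> V" "distinct p"
        using p Cons by (auto simp: saw_from_def walks_from_def)
      then show ?thesis by blast
    qed simp
  qed
  have fin: "finite {p. p \<in> walks_from a k \<and> distinct p}" for a :: "int ^ 'd" and k
    using card_walks_from[of a k] by simp
  define g where "g p = (1 / (2 * D)) ^ card (path_edges p)" for p :: "(int ^ 'd) list"
  have g0: "g p \<ge> 0" for p using D by (simp add: g_def)
  have half: "(\<Sum>k\<le>m. (1 / 2) ^ k) \<le> (2 :: real)" for m :: nat
    by (subst sum_gp0) auto
  have "sum g (saw_from \<Lambda> V) \<le> sum g (insert [] (\<Union>a\<in>V. \<Union>k\<le>card \<Lambda>. {p. p \<in> walks_from a k \<and> distinct p}))"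
    using sub g0 assms fin by (intro sum_mono2) auto
  also have "\<dots> \<le> g [] + sum g (\<Union>a\<in>V. \<Union>k\<le>card \<Lambda>. {p. p \<in> walks_from a k \<and> distinct p})"
    using assms fin g0 by (subst sum.insert_if) auto
  also have "sum g (\<Union>a\<in>V. \<Union>k\<le>card \<Lambda>. {p. p \<in> walks_from a k \<and> distinct p})
      = (\<Sum>a\<in>V. \<Sum>k\<le>card \<Lambda>. sum g {p. p \<in> walks_from a k \<and> distinct p})"
  proof -
    have "sum g (\<Union>k\<le>card \<Lambda>. {p. p \<in> walks_from a k \<and> distinct p})
        = (\<Sum>k\<le>card \<Lambda>. sum g {p. p \<in> walks_from a k \<and> distinct p})" for a :: "int ^ 'd"
      by (intro sum.UNION_disjoint ballI impI fin) (auto simp: walks_from_def)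
    moreover have "sum g (\<Union>a\<in>V. \<Union>k\<le>card \<Lambda>. {p. p \<in> walks_from a k \<and> distinct p})
        = (\<Sum>a\<in>V. sum g (\<Union>k\<le>card \<Lambda>. {p. p \<in> walks_from a k \<and> distinct p}))"
      using assms fin by (intro sum.UNION_disjoint ballI impI finite_UN_I) (auto simp: walks_from_def)
    ultimately show ?thesis by simp
  qed
  also have "\<dots> \<le> (\<Sum>a\<in>V. \<Sum>k\<le>card \<Lambda>. (1 / 2) ^ k)"
  proof (intro sum_mono)
    fix a :: "int ^ 'd" and k
    have "sum g {p. p \<in> walks_from a k \<and> distinct p} = (\<Sum>p\<in>{p. p \<in> walks_from a k \<and> distinct p}. (1 / (2 * D)) ^ k)"
      unfolding g_def by (intro sum.cong) (auto simp: card_path_edges walks_from_def)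
    also have "\<dots> = real (card {p. p \<in> walks_from a k \<and> distinct p}) * (1 / (2 * D)) ^ k" by simp
    also have "\<dots> \<le> D ^ k * (1 / (2 * D)) ^ k"
    proof (rule mult_right_mono)
      have "card {p. p \<in> walks_from a k \<and> distinct p} \<le> lattice_degree TYPE('d) ^ k"
        using card_walks_from[of a k] card_mono[of "walks_from a k" "{p. p \<in> walks_from a k \<and> distinct p}"] by auto
      then show "real (card {p. p \<in> walks_from a k \<and> distinct p}) \<le> D ^ k"
        unfolding D_def by (metis of_nat_le_iff of_nat_power)
    qed (use D in simp)
    also have "\<dots> = (1 / 2) ^ k" using D by (simp add: power_mult_distrib[symmetric])
    finally show "sum g {p. p \<in> walks_from a k \<and> distinct p} \<le> (1 / 2) ^ k" .
  qed
  also have "\<dots> \<le> (\<Sum>a\<in>V. 2)" using half by (intro sum_mono)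
  finally show ?thesis by (simp add: g_def D_def path_edges_def mult.commute)
qed

text \<open>Between its first and its last visit to \<open>V\<close> a geodesic is at least as fast as any other path
  between the two visited points.\<close>

lemma geodesic_segment:
  assumes "finite \<Lambda>" "p \<in> saw \<Lambda> u w" "path_time x p = box_time \<Lambda> x u w"
    and x: "\<And>e. e \<in> lattice_edges \<Longrightarrow> 0 \<le> x e"
    and Es: "\<And>e. e \<in> Es \<Longrightarrow> e \<subseteq> V"
  shows "\<exists>\<sigma>\<in>saw_from \<Lambda> V. path_edges p \<inter> Es \<subseteq> path_edges \<sigma> \<and> path_edges \<sigma> \<subseteq> path_edges p \<and>
    (path_time x \<sigma> = 0 \<or> (\<exists>a\<in>V \<inter> \<Lambda>. \<exists>b\<in>V \<inter> \<Lambda>. \<forall>r. lattice_path a b r \<longrightarrow> set r \<subseteq> \<Lambda> \<longrightarrow> path_time x \<sigma> \<le> path_time x r))"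
proof -
  \<comment> \<open>The steps of \<open>p\<close> along edges of \<open>Es\<close>. The segment runs
    from the beginning of the first such step to the end of the last one.\<close>
  define J where "J = {i. i < length p - 1 \<and> {p ! i, p ! Suc i} \<in> Es}"
  have finJ: "finite J" by (simp add: J_def)
  show ?thesis
  proof (cases "J = {}")
    case True
    then have "path_edges p \<inter> Es = {}" by (auto simp: J_def path_edges_def)
    then show ?thesis by (intro bexI[of _ "[]"]) (auto simp: saw_from_def path_time_def path_edges_def)
  next
    case False
    define i0 where "i0 = Min J"
    define i1 where "i1 = Max J"
    have "i0 \<in> J" "i1 \<in> J" using Min_in Max_in finJ False by (auto simp: i0_def i1_def)
    have le: "i0 \<le> i1" using finJ False by (simp add: i0_def i1_def)
    have i1: "i1 < length p - 1" using \<open>i1 \<in> J\<close> by (simp add: J_def)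
    define a where "a = p ! i0"
    define b where "b = p ! Suc i1"
    define p1 where "p1 = take i0 p"
    define p2 where "p2 = take (i1 - i0) (drop (Suc i0) p)"
    define p3 where "p3 = drop (Suc (Suc i1)) p"
    have i0l: "i0 < length p" and i1l: "Suc i1 < length p" using le i1 by auto
    have d: "drop (Suc i0) p = p2 @ drop (Suc i1) p"
    proof -
      have "drop (i1 - i0) (drop (Suc i0) p) = drop (Suc i1) p" using le by simp
      then show ?thesis unfolding p2_def by (metis append_take_drop_id)
    qed
    have "drop (Suc i1) p = b # p3" "drop i0 p = a # drop (Suc i0) p"
      using Cons_nth_drop_Suc[OF i0l] Cons_nth_drop_Suc[OF i1l] by (simp_all add: a_def b_def p3_def)
    then have p_eq: "p = p1 @ a # p2 @ b # p3"
      unfolding p1_def using d by (metis append_take_drop_id)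
    have len1: "length p1 = i0" using i0l by (simp add: p1_def)
    have len2: "length p2 = i1 - i0" using i1l le by (simp add: p2_def)
    define \<sigma> where "\<sigma> = a # p2 @ [b]"
    have p: "lattice_path u w p" "distinct p" "set p \<subseteq> \<Lambda>" using assms(2) by (auto simp: saw_def)
    have L1: "lattice_path u a (p1 @ [a])" and L2: "lattice_path a w (a # p2 @ b # p3)"
      using lattice_path_split[of u w p1 a "p2 @ b # p3"] p p_eq by auto
    have L3: "lattice_path a b \<sigma>" and L4: "lattice_path b w (b # p3)"
      using lattice_path_split[of a w "a # p2" b p3] L2 by (auto simp: \<sigma>_def)
    have aV: "a \<in> V \<inter> \<Lambda>"
      using Es[of "{p ! i0, p ! Suc i0}"] \<open>i0 \<in> J\<close> p(3) nth_mem[OF i0l] by (auto simp: J_def a_def)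
    have bV: "b \<in> V \<inter> \<Lambda>"
      using Es[of "{p ! i1, p ! Suc i1}"] \<open>i1 \<in> J\<close> p(3) nth_mem[OF i1l] by (auto simp: J_def b_def)
    have \<sigma>_nth: "\<sigma> ! j = p ! (i0 + j)" if "j < length \<sigma>" for j
      using that len1 unfolding \<sigma>_def by (subst p_eq) (auto simp: nth_append nth_Cons')
    have len\<sigma>: "length \<sigma> = i1 - i0 + 2" by (simp add: \<sigma>_def len2)
    have "path_edges p \<inter> Es \<subseteq> path_edges \<sigma>"
    proof
      fix e assume "e \<in> path_edges p \<inter> Es"
      then obtain i where i: "i \<in> J" "e = {p ! i, p ! Suc i}" by (auto simp: path_edges_def J_def)
      then have "i0 \<le> i" "i \<le> i1" using finJ by (auto simp: i0_def i1_def)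
      then have "e = {\<sigma> ! (i - i0), \<sigma> ! Suc (i - i0)}" "i - i0 < length \<sigma> - 1"
        using i len\<sigma> by (auto simp: \<sigma>_nth)
      then show "e \<in> path_edges \<sigma>" by (auto simp: path_edges_def)
    qed
    moreover have "path_edges \<sigma> \<subseteq> path_edges p"
    proof
      fix e assume "e \<in> path_edges \<sigma>"
      then obtain j where j: "j < length \<sigma> - 1" "e = {\<sigma> ! j, \<sigma> ! Suc j}" by (auto simp: path_edges_def)
      then have "e = {p ! (i0 + j), p ! Suc (i0 + j)}" "i0 + j < length p - 1"
        using len\<sigma> i1 le by (auto simp: \<sigma>_nth)
      then show "e \<in> path_edges p" by (auto simp: path_edges_def)
    qed
    moreover have "\<sigma> \<in> saw_from \<Lambda> V"
      using p L3 aV unfolding saw_from_def lattice_path_def by (auto simp: p_eq \<sigma>_def)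
    moreover have "path_time x \<sigma> \<le> path_time x r" if r: "lattice_path a b r" "set r \<subseteq> \<Lambda>" for r
    proof -
      \<comment> \<open>Splicing \<open>r\<close> into \<open>p\<close> in place of the segment
        gives a competitor of \<open>p\<close>, possibly with loops.\<close>
      let ?r1 = "(p1 @ [a]) @ tl r"
      note j1 = lattice_path_join[OF L1 r(1)]
      note j2 = lattice_path_join[OF j1(1) L4]
      have "set (?r1 @ tl (b # p3)) \<subseteq> \<Lambda>" using j1(3) j2(3) r(2) p(3) unfolding p_eq by auto
      then have "box_time \<Lambda> x u w \<le> path_time x (p1 @ [a]) + path_time x r + path_time x (b # p3)"
        using box_time_le[OF assms(1) j2(1) _ x] j1(2) j2(2) by simp
      moreover have "path_time x p = path_time x (p1 @ [a]) + (path_time x \<sigma> + path_time x (b # p3))"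
        using path_time_append[of x p1 a "p2 @ b # p3"] path_time_append[of x "a # p2" b p3]
        by (simp add: p_eq \<sigma>_def)
      ultimately show ?thesis using assms(3) by simp
    qed
    ultimately show ?thesis using aV bV by blast
  qed
qed

section \<open>First passage percolation with coded passage times\<close>

definition edges_in :: "(int ^ 'd) set \<Rightarrow> (int ^ 'd) set set" where
  "edges_in \<Lambda> = {e \<in> lattice_edges. e \<subseteq> \<Lambda>}"

lemma finite_edges_in: "finite \<Lambda> \<Longrightarrow> finite (edges_in \<Lambda>)"
  unfolding edges_in_def by (rule finite_subset[of _ "Pow \<Lambda>"]) auto

lemma path_edges_in:
  assumes "successively (\<lambda>a b. {a, b} \<in> lattice_edges) p" "set p \<subseteq> \<Lambda>"
  shows "path_edges p \<subseteq> edges_in \<Lambda>"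
proof
  fix e assume "e \<in> path_edges p"
  then obtain i where i: "e = {p ! i, p ! Suc i}" "Suc i < length p"
    by (auto simp: path_edges_def)
  then have "e \<in> lattice_edges" using assms(1) by (auto simp: successively_conv_nth)
  moreover have "p ! i \<in> set p" "p ! Suc i \<in> set p" using i by auto
  ultimately show "e \<in> edges_in \<Lambda>" using assms(2) i by (auto simp: edges_in_def)
qed

text \<open>Cauchy-Schwarz three times, as \<open>8 = 2 ^ 3\<close>. It reduces eighth moments of
  path times to those of single edges.\<close>

lemma sum_power8_le:
  fixes a :: "nat \<Rightarrow> real"
  shows "(\<Sum>i<l. a i) ^ 8 \<le> real l ^ 7 * (\<Sum>i<l. a i ^ 8)"
proof -
  have sq: "(\<Sum>i<l. b i)\<^sup>2 \<le> real l * (\<Sum>i<l. (b i)\<^sup>2)" for b :: "nat \<Rightarrow> real"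
    using Cauchy_Schwarz_ineq_sum[of "\<lambda>_. 1" b "{..<l}"] by simp
  have "((\<Sum>i<l. a i)\<^sup>2)\<^sup>2 \<le> (real l * (\<Sum>i<l. (a i)\<^sup>2))\<^sup>2"
    by (intro power_mono sq) simp
  also have "\<dots> \<le> (real l)\<^sup>2 * (real l * (\<Sum>i<l. ((a i)\<^sup>2)\<^sup>2))"
    unfolding power_mult_distrib by (intro mult_left_mono sq) simp
  finally have "(((\<Sum>i<l. a i)\<^sup>2)\<^sup>2)\<^sup>2 \<le> ((real l)\<^sup>2 * (real l * (\<Sum>i<l. ((a i)\<^sup>2)\<^sup>2)))\<^sup>2"
    by (intro power_mono) (assumption, rule zero_le_power2)
  also have "\<dots> = ((real l)\<^sup>2 * real l)\<^sup>2 * (\<Sum>i<l. ((a i)\<^sup>2)\<^sup>2)\<^sup>2"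
    by (simp add: power_mult_distrib)
  also have "\<dots> \<le> ((real l)\<^sup>2 * real l)\<^sup>2 * (real l * (\<Sum>i<l. (((a i)\<^sup>2)\<^sup>2)\<^sup>2))"
    by (intro mult_left_mono sq) simp
  also have "\<dots> = real l ^ 7 * (\<Sum>i<l. a i ^ 8)"
  proof -
    have "((real l)\<^sup>2 * real l)\<^sup>2 * real l = real l ^ 7" by (simp add: power2_eq_square power_numeral_reduce)
    then show ?thesis by (simp add: mult.assoc[symmetric])
  qed
  finally show ?thesis by simp
qed

text \<open>The function \<open>T\<close> is the quantile function of the law of the passage times; the passage time of an edge
  is \<open>T (k / 2 ^ n)\<close> where \<open>k\<close> is given by its \<open>n\<close> bits.\<close>

locale quantile =
  fixes T :: "real \<Rightarrow> real" and m8 :: real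
  assumes T_mono: "0 \<le> a \<Longrightarrow> a \<le> b \<Longrightarrow> b < 1 \<Longrightarrow> T a \<le> T b"
    and T_nonneg: "0 \<le> a \<Longrightarrow> a < 1 \<Longrightarrow> 0 \<le> T a"
    and T_pos: "0 < a \<Longrightarrow> a < 1 \<Longrightarrow> 0 < T a"
    and T_moment: "(\<Sum>k<2 ^ n. T (real k / 2 ^ n) ^ 8) \<le> m8 * 2 ^ n"
begin

definition q :: "nat \<Rightarrow> nat \<Rightarrow> real" where "q n k = T (real k / 2 ^ n)"

lemma q_mono: "k \<le> l \<Longrightarrow> l < 2 ^ n \<Longrightarrow> q n k \<le> q n l"
  unfolding q_def by (intro T_mono) (auto simp: divide_right_mono)

lemma q_nonneg: "k < 2 ^ n \<Longrightarrow> 0 \<le> q n k"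
  unfolding q_def by (intro T_nonneg) auto

lemma m8_nonneg: "0 \<le> m8"
proof -
  have "0 \<le> T 0 ^ 8" by simp
  also have "\<dots> \<le> m8" using T_moment[of 0] by simp
  finally show ?thesis .
qed

lemma q_moments:
  "(\<Sum>k<2 ^ n. q n k ^ 4) \<le> (1 + m8) * 2 ^ n"
  "(\<Sum>k<2 ^ n. q n k) \<le> (1 + m8) * 2 ^ n"
proof -
  have le: "y \<le> 1 + y ^ 8" "y ^ 4 \<le> 1 + y ^ 8" if "0 \<le> y" for y :: real
  proof -
    show "y \<le> 1 + y ^ 8"
    proof (cases "y \<le> 1")
      case False
      then have "y ^ 1 \<le> y ^ 8" by (intro power_increasing) auto
      then show ?thesis by simp
    qed (use that in \<open>simp add: add_increasing2\<close>)
    show "y ^ 4 \<le> 1 + y ^ 8"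
    proof (cases "y \<le> 1")
      case False
      then have "y ^ 4 \<le> y ^ 8" by (intro power_increasing) auto
      then show ?thesis by simp
    next
      case True
      then have "y ^ 4 \<le> 1" using that by (simp add: power_le_one)
      then show ?thesis using that by (simp add: add_increasing2)
    qed
  qed
  have s: "(\<Sum>k<(2::nat) ^ n. 1 + q n k ^ 8) \<le> (1 + m8) * 2 ^ n"
    using T_moment[of n] by (simp add: sum.distrib q_def algebra_simps)
  have "(\<Sum>k<2 ^ n. q n k ^ 4) \<le> (\<Sum>k<(2::nat) ^ n. 1 + q n k ^ 8)"
    by (intro sum_mono le q_nonneg) simp
  then show "(\<Sum>k<2 ^ n. q n k ^ 4) \<le> (1 + m8) * 2 ^ n" using s by linarith
  have "(\<Sum>k<2 ^ n. q n k) \<le> (\<Sum>k<(2::nat) ^ n. 1 + q n k ^ 8)"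
    by (intro sum_mono le q_nonneg) simp
  then show "(\<Sum>k<2 ^ n. q n k) \<le> (1 + m8) * 2 ^ n" using s by linarith
qed

text \<open>A large \<open>\<kappa>\<close> suppresses all codes except those with passage time near
  0. As \<open>T\<close> is positive on the open unit interval, these have many leading zeros and
  their share of the exponential moment is small. The same \<open>\<kappa>\<close> serves for all
  large \<open>n\<close>.\<close>

lemma exp_moment_small:
  assumes "0 < r"
  shows "\<exists>\<kappa>\<ge>0. \<exists>n0. \<forall>n\<ge>n0. (\<Sum>k<2 ^ n. exp (ln (3 / 2) * (1 + real (lead_zeros n k)) - \<kappa> * q n k)) \<le> r * 2 ^ n"
proof -
  have "(\<lambda>j. (3 / 4 :: real) ^ j) \<longlonglongrightarrow> 0" by (rule LIMSEQ_power_zero) simp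
  then have "\<forall>\<^sub>F j in sequentially. (3 / 4 :: real) ^ j < r / 6"
    using assms by (intro order_tendstoD(2)) auto
  \<comment> \<open>The value \<open>r\<close> is met in two halves:
    \<open>3/2 * (2 * (r/6))\<close> for the small codes and \<open>(r/4) * 2\<close> for all the
    others.\<close>
  then obtain n0 where n0: "(3 / 4 :: real) ^ Suc n0 < r / 6"
    unfolding eventually_sequentially by (meson le_SucI order_refl)
  define t where "t = T (1 / 2 ^ Suc n0)"
  have t: "t > 0" unfolding t_def
  proof (rule T_pos)
    show "(1 :: real) / 2 ^ Suc n0 < 1" using one_less_power[of "2 :: real" "Suc n0"] by simp
  qed simp
  define \<kappa> where "\<kappa> = max 0 (- ln (r / 6) / t)"
  have \<kappa>: "\<kappa> \<ge> 0" "exp (- \<kappa> * t) \<le> r / 6"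
  proof -
    have "- ln (r / 6) / t \<le> \<kappa>" by (simp add: \<kappa>_def)
    then have "- ln (r / 6) \<le> \<kappa> * t" using t by (subst (asm) pos_divide_le_eq) auto
    then have "exp (- \<kappa> * t) \<le> exp (ln (r / 6))" by simp
    then show "exp (- \<kappa> * t) \<le> r / 6" using assms by simp
  qed (simp add: \<kappa>_def)
  have "(\<Sum>k<2 ^ n. exp (ln (3 / 2) * (1 + real (lead_zeros n k)) - \<kappa> * q n k)) \<le> r * 2 ^ n" if n: "Suc n0 \<le> n" for n
  proof -
    define l where "l = n - Suc n0"
    have nl: "n = l + Suc n0" using n by (simp add: l_def)
    have ex: "exp (ln (3 / 2) * (1 + real (lead_zeros n k)) - \<kappa> * q n k) = (3 / 2) * (3 / 2) ^ lead_zeros n k * exp (- \<kappa> * q n k)" for k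
    proof -
      have "exp (ln (3 / 2) * (1 + real (lead_zeros n k))) = (3 / 2 :: real) powr real (Suc (lead_zeros n k))"
        by (simp add: powr_def mult.commute)
      also have "\<dots> = (3 / 2) ^ Suc (lead_zeros n k)" by (subst powr_realpow) auto
      finally show ?thesis by (simp add: exp_diff exp_minus field_simps)
    qed
    have "(\<Sum>k<2 ^ n. exp (ln (3 / 2) * (1 + real (lead_zeros n k)) - \<kappa> * q n k))
        \<le> (\<Sum>k<2 ^ n. (3 / 2) * (if k < 2 ^ l then (3 / 2) ^ lead_zeros n k else 0) + (r / 4) * (3 / 2) ^ lead_zeros n k)"
    proof (rule sum_mono)
      fix k :: nat assume k: "k \<in> {..<2 ^ n}"
      show "exp (ln (3 / 2) * (1 + real (lead_zeros n k)) - \<kappa> * q n k) \<le>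
        (3 / 2) * (if k < 2 ^ l then (3 / 2) ^ lead_zeros n k else 0) + (r / 4) * (3 / 2) ^ lead_zeros n k"
      proof (cases "k < 2 ^ l")
        case True
        have "exp (- \<kappa> * q n k) \<le> 1" using \<kappa> q_nonneg[of k n] k by simp
        then have "(3 / 2) * (3 / 2) ^ lead_zeros n k * exp (- \<kappa> * q n k) \<le> (3 / 2) * (3 / 2) ^ lead_zeros n k * (1 :: real)"
          by (intro mult_left_mono) auto
        moreover have "0 \<le> (r / 4) * (3 / 2) ^ lead_zeros n k" using assms by simp
        ultimately show ?thesis unfolding ex if_P[OF True] by linarith
      next
        case False
        have "1 / 2 ^ Suc n0 = (2 ^ l / 2 ^ n :: real)" by (simp add: nl power_add)
        also have "\<dots> \<le> real k / 2 ^ n"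
        proof (rule divide_right_mono)
          have "real (2 ^ l) \<le> real k" using False by (simp only: of_nat_le_iff not_less)
          then show "2 ^ l \<le> real k" by simp
        qed simp
        finally have "t \<le> q n k" unfolding t_def q_def using k by (intro T_mono) auto
        then have "exp (- \<kappa> * q n k) \<le> exp (- \<kappa> * t)" using \<kappa> by (simp add: mult_left_mono)
        then have "exp (- \<kappa> * q n k) \<le> r / 6" using \<kappa>(2) by linarith
        then have "(3 / 2) * (3 / 2) ^ lead_zeros n k * exp (- \<kappa> * q n k) \<le> (3 / 2) * (3 / 2) ^ lead_zeros n k * (r / 6)"
          by (intro mult_left_mono) auto
        then show ?thesis unfolding ex using False by simp
      qed
    qed
    also have "\<dots> = (3 / 2) * (\<Sum>k<2 ^ n. (if k < 2 ^ l then (3 / 2) ^ lead_zeros n k else 0)) + (r / 4) * (\<Sum>k<2 ^ n. (3 / 2) ^ lead_zeros n k)"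
      by (simp add: sum.distrib sum_distrib_left)
    also have "(\<Sum>k<2 ^ n. (if k < 2 ^ l then (3 / 2) ^ lead_zeros n k else 0)) = (\<Sum>k<2 ^ l. (3 / 2 :: real) ^ lead_zeros n k)"
    proof -
      have "(2::nat) ^ l \<le> 2 ^ n" unfolding nl by (intro power_increasing) auto
      then have "k < 2 ^ n" if "k < 2 ^ l" for k :: nat using that by linarith
      then have "{..<2 ^ n} \<inter> {k::nat. k < 2 ^ l} = {..<2 ^ l}" by auto
      then show ?thesis by (simp add: sum.If_cases)
    qed
    also have "(3 / 2) * (\<Sum>k<2 ^ l. (3 / 2 :: real) ^ lead_zeros n k) + (r / 4) * (\<Sum>k<2 ^ n. (3 / 2) ^ lead_zeros n k)
       \<le> (3 / 2) * ((3 / 2) ^ Suc n0 * (2 * 2 ^ l)) + (r / 4) * (2 * 2 ^ n)"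
      using sum_lead_zeros_power_small[of l "Suc n0"] sum_lead_zeros_power[of n] assms
      unfolding nl by (intro add_mono mult_left_mono) auto
    also have "(3 / 2 :: real) ^ Suc n0 * (2 * 2 ^ l) = 2 * (3 / 4) ^ Suc n0 * 2 ^ n"
    proof -
      have "(3 / 4 :: real) ^ Suc n0 * 2 ^ Suc n0 = (3 / 2) ^ Suc n0"
        unfolding power_mult_distrib[symmetric] by simp
      then show ?thesis unfolding nl power_add by (simp only: mult.assoc mult.commute mult.left_commute)
    qed
    also have "3 / 2 * (2 * (3 / 4) ^ Suc n0 * 2 ^ n) + (r / 4) * (2 * 2 ^ n) \<le> 3 / 2 * (2 * (r / 6) * 2 ^ n) + (r / 4) * (2 * 2 ^ n)"
      using n0 by (intro add_mono mult_left_mono mult_right_mono) auto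
    finally show ?thesis by simp
  qed
  then show ?thesis using \<kappa>(1) by blast
qed

definition wt :: "nat \<Rightarrow> ('e \<times> nat) set \<Rightarrow> 'e \<Rightarrow> real" where
  "wt n A e = q n (edge_code n A e)"

lemma wt_nonneg: "0 \<le> wt n A e"
  unfolding wt_def by (rule q_nonneg[OF edge_code_less])

text \<open>Dyadic form of \<open>1 + log (1 / U)\<close>, the weight with which an edge enters the
  influence bound.\<close>

definition len_wt :: "nat \<Rightarrow> ('e \<times> nat) set \<Rightarrow> 'e \<Rightarrow> real" where
  "len_wt n A e = 1 + real (lead_zeros n (edge_code n A e))"

lemma len_wt_nonneg: "0 \<le> len_wt n A e"
  by (simp add: len_wt_def)

lemma avg_path_time_le:
  assumes "finite F" "path_edges p \<subseteq> F"
  shows "cube_avg (F \<times> {..<n}) (\<lambda>A. path_time (wt n A) p) \<le> (1 + m8) * real (length p - 1)"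
    and "cube_avg (F \<times> {..<n}) (\<lambda>A. path_time (wt n A) p ^ 8) \<le> m8 * real (length p - 1) ^ 8"
proof -
  let ?e = "\<lambda>i. {p ! i, p ! Suc i}"
  have e: "?e i \<in> F" if "i < length p - 1" for i using assms that by (auto simp: path_edges_def)
  have "cube_avg (F \<times> {..<n}) (\<lambda>A. wt n A (?e i)) \<le> 1 + m8" if "i < length p - 1" for i
    unfolding wt_def cube_avg_edge_code[OF assms(1) e[OF that], of n "q n"]
    using q_moments(2)[of n] by (simp add: divide_le_eq)
  then have "(\<Sum>i<length p - 1. cube_avg (F \<times> {..<n}) (\<lambda>A. wt n A (?e i))) \<le> (\<Sum>i<length p - 1. 1 + m8)"
    by (intro sum_mono) auto
  then show "cube_avg (F \<times> {..<n}) (\<lambda>A. path_time (wt n A) p) \<le> (1 + m8) * real (length p - 1)"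
    unfolding path_time_def cube_avg_sum by (simp add: mult.commute)
  have 8: "cube_avg (F \<times> {..<n}) (\<lambda>A. wt n A (?e i) ^ 8) \<le> m8" if "i < length p - 1" for i
    unfolding wt_def cube_avg_edge_code[OF assms(1) e[OF that], of n "\<lambda>k. q n k ^ 8"]
    using T_moment[of n] by (simp add: divide_le_eq q_def)
  have "cube_avg (F \<times> {..<n}) (\<lambda>A. path_time (wt n A) p ^ 8)
     \<le> cube_avg (F \<times> {..<n}) (\<lambda>A. real (length p - 1) ^ 7 * (\<Sum>i<length p - 1. wt n A (?e i) ^ 8))"
    unfolding path_time_def by (intro cube_avg_mono sum_power8_le)
  also have "\<dots> = real (length p - 1) ^ 7 * (\<Sum>i<length p - 1. cube_avg (F \<times> {..<n}) (\<lambda>A. wt n A (?e i) ^ 8))"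
    by (simp add: cube_avg_cmult cube_avg_sum)
  also have "\<dots> \<le> real (length p - 1) ^ 7 * (\<Sum>i<length p - 1. m8)"
    using 8 by (intro mult_left_mono sum_mono) auto
  also have "\<dots> = m8 * (real (length p - 1) ^ 7 * real (length p - 1))" by simp
  also have "real (length p - 1) ^ 7 * real (length p - 1) = real (length p - 1) ^ 8"
    using power_Suc2[of "real (length p - 1)" 7] by simp
  finally show "cube_avg (F \<times> {..<n}) (\<lambda>A. path_time (wt n A) p ^ 8) \<le> m8 * real (length p - 1) ^ 8" .
qed

text \<open>Below the threshold of the one-coordinate description every optimal path uses
  \<open>e\<close>, so any selection \<open>\<gamma>\<close> of optimal paths can serve as the
  geodesic.\<close>

lemma box_time_influence_le:
  assumes F: "finite F" "e \<in> F" and n: "0 < n"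
    and \<Lambda>: "finite \<Lambda>" "saw \<Lambda> u w \<noteq> {}"
    and \<gamma>: "\<And>A. A \<subseteq> F \<times> {..<n} \<Longrightarrow> \<gamma> A \<in> saw \<Lambda> u w"
      "\<And>A. A \<subseteq> F \<times> {..<n} \<Longrightarrow> path_time (wt n A) (\<gamma> A) = box_time \<Lambda> (wt n A) u w"
    and p: "p = 1 \<or> p = 2"
  shows "(\<Sum>i<n. cube_avg (F \<times> {..<n}) (\<lambda>A. \<bar>cube_diff (e, i) (\<lambda>A. box_time \<Lambda> (wt n A) u w) A\<bar> ^ p))
    \<le> (2 * (2 + T (1 / 2))\<^sup>2 + 4 * (m8 + 102)) *
        cube_avg (F \<times> {..<n}) (\<lambda>A. if e \<in> path_edges (\<gamma> A) then len_wt n A e else 0)"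
proof -
  have "(\<Sum>i<n. cube_avg (F \<times> {..<n}) (\<lambda>A. \<bar>cube_diff (e, i) (\<lambda>A. box_time \<Lambda> (wt n A) u w) A\<bar> ^ p))
    \<le> (2 * (1 + (1 + T (1 / 2)))\<^sup>2 + 4 * ((1 + m8) + 101)) *
        cube_avg (F \<times> {..<n}) (\<lambda>A. if e \<in> path_edges (\<gamma> A) then 1 + real (lead_zeros n (edge_code n A e)) else 0)"
  proof (rule edge_influence_le[OF F n _ _ _ _ q_moments(1) p])
    show "0 \<le> 1 + T (1 / 2)" using T_nonneg[of "1/2"] by simp
    \<comment> \<open>Codes with leading digit 0 give passage times at most
      \<open>T (1 / 2)\<close>, a median; adding 1 makes the inequality strict.\<close>
    show "q n k < 1 + T (1 / 2)" if "k < 2 ^ (n - 1)" for k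
    proof -
      have nn: "(2::real) ^ n = 2 * 2 ^ (n - 1)" using n by (cases n) auto
      have "real k < 2 ^ (n - 1)" using that by simp
      then have "real k / 2 ^ n \<le> 1 / 2" using nn by (simp add: field_simps)
      then have "q n k \<le> T (1 / 2)" unfolding q_def by (intro T_mono) auto
      then show ?thesis by simp
    qed
    fix A assume A: "A \<subseteq> (F - {e}) \<times> {..<n}"
    have wt_upd: "wt n (A \<union> {e} \<times> B) = (wt n A)(e := q n (set_encode B))" if "B \<subseteq> {..<n}" for B
    proof
      fix e'
      have "A \<subseteq> (F - {e}) \<times> UNIV" using A by auto
      then show "wt n (A \<union> {e} \<times> B) e' = ((wt n A)(e := q n (set_encode B))) e'"
        using that unfolding wt_def by (cases "e' = e") (simp_all add: edge_code_Un)
    qed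
    have bt: "box_time \<Lambda> x u w = Min ((\<lambda>p. sum x (path_edges p)) ` saw \<Lambda> u w)" for x
      unfolding box_time_def by (intro arg_cong[where f = Min] image_cong) (auto simp: saw_def path_time_sum)
    \<comment> \<open>\<open>q n (2 ^ n - 1)\<close> is the largest passage time that can occur and
      serves as the bound \<open>Y\<close> of the one-coordinate lemma.\<close>
    have mem: "q n (set_encode B) \<in> {0..q n (2 ^ n - 1)}" if "B \<subseteq> {..<n}" for B
      using set_encode_less[OF that] by (auto intro!: q_nonneg q_mono)
    obtain t c where tc: "\<forall>y\<in>{0..q n (2 ^ n - 1)}. box_time \<Lambda> ((wt n A)(e := y)) u w = c + min t y \<and>
      (y < t \<longrightarrow> (\<forall>p\<in>saw \<Lambda> u w. sum ((wt n A)(e := y)) (path_edges p) = box_time \<Lambda> ((wt n A)(e := y)) u w \<longrightarrow> e \<in> path_edges p))"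
      using Min_sum_one_coordinate[OF finite_saw[OF \<Lambda>(1)] \<Lambda>(2), of path_edges "q n (2 ^ n - 1)" "wt n A" e]
        finite_path_edges
      unfolding bt by blast
    show "\<exists>t c. \<forall>B\<subseteq>{..<n}. box_time \<Lambda> (wt n (A \<union> {e} \<times> B)) u w = c + min t (q n (set_encode B)) \<and>
       (q n (set_encode B) < t \<longrightarrow> e \<in> path_edges (\<gamma> (A \<union> {e} \<times> B)))"
    proof (rule exI[of _ t], rule exI[of _ c], intro allI impI)
      fix B assume B: "B \<subseteq> {..<n}"
      let ?A = "A \<union> {e} \<times> B" and ?y = "q n (set_encode B)"
      have sub: "?A \<subseteq> F \<times> {..<n}" using A B F by auto
      have "sum (wt n ?A) (path_edges (\<gamma> ?A)) = box_time \<Lambda> (wt n ?A) u w"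
        using \<gamma>[OF sub] by (simp add: saw_def path_time_sum[symmetric])
      then show "box_time \<Lambda> (wt n ?A) u w = c + min t ?y \<and> (?y < t \<longrightarrow> e \<in> path_edges (\<gamma> ?A))"
        using tc mem[OF B] \<gamma>(1)[OF sub] unfolding wt_upd[OF B] by blast
    qed
  qed (auto intro: q_mono q_nonneg)
  then show ?thesis unfolding len_wt_def by (simp add: add.commute)
qed

text \<open>The greedy bound with \<open>K = 2 * card V + 1\<close> from the path count. The
  exponential moment is that of \<open>ln (3 / 2) * len_wt\<close>, and dividing by
  \<open>ln (3 / 2)\<close> undoes the scaling.\<close>

lemma greedy_saw_le:
  fixes \<Lambda> V :: "(int ^ 'd::finite) set"
  assumes \<kappa>: "(\<Sum>k<2 ^ n. exp (ln (3 / 2) * (1 + real (lead_zeros n k)) - \<kappa> * q n k)) \<le> 1 / (2 * real (lattice_degree TYPE('d))) * 2 ^ n"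
    and "finite \<Lambda>" "finite V" "finite F" "edges_in \<Lambda> \<subseteq> F"
    and \<sigma>: "\<And>A. A \<subseteq> F \<times> {..<n} \<Longrightarrow> \<sigma> A \<in> saw_from \<Lambda> V"
  shows "cube_avg (F \<times> {..<n}) (\<lambda>A. \<Sum>e\<in>path_edges (\<sigma> A). len_wt n A e)
    \<le> (\<kappa> * cube_avg (F \<times> {..<n}) (\<lambda>A. path_time (wt n A) (\<sigma> A)) + ln (2 * card V + 1)) / ln (3 / 2)"
proof -
  have "cube_avg (F \<times> {..<n}) (\<lambda>A. \<Sum>e\<in>path_edges (\<sigma> A). ln (3 / 2) * (1 + real (lead_zeros n (edge_code n A e))))
    \<le> \<kappa> * cube_avg (F \<times> {..<n}) (\<lambda>A. \<Sum>e\<in>path_edges (\<sigma> A). q n (edge_code n A e)) + ln (2 * card V + 1)"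
  proof (rule greedy_path_le[OF assms(4) finite_saw_from[OF assms(2)] _ \<kappa> _ sum_saw_from_le[OF assms(2,3)] \<sigma>])
    fix p assume "p \<in> saw_from \<Lambda> V"
    then show "path_edges p \<subseteq> F" using path_edges_in[of p \<Lambda>] assms(5) by (auto simp: saw_from_def)
  qed auto
  also have "cube_avg (F \<times> {..<n}) (\<lambda>A. \<Sum>e\<in>path_edges (\<sigma> A). ln (3 / 2) * (1 + real (lead_zeros n (edge_code n A e))))
    = ln (3 / 2) * cube_avg (F \<times> {..<n}) (\<lambda>A. \<Sum>e\<in>path_edges (\<sigma> A). len_wt n A e)"
    by (simp add: len_wt_def cube_avg_cmult flip: sum_distrib_left)
  also have "cube_avg (F \<times> {..<n}) (\<lambda>A. \<Sum>e\<in>path_edges (\<sigma> A). q n (edge_code n A e))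
     = cube_avg (F \<times> {..<n}) (\<lambda>A. path_time (wt n A) (\<sigma> A))"
    using \<sigma> by (intro cube_avg_cong) (auto simp: saw_from_def path_time_sum wt_def)
  finally show ?thesis by (simp add: pos_le_divide_eq mult.commute)
qed

end

section \<open>Averaging over translations\<close>

lemma lattice_edges_shift: "(+) z ` e \<in> lattice_edges \<longleftrightarrow> e \<in> lattice_edges"
proof -
  have 1: "(+) z ` e \<in> lattice_edges" if e: "e \<in> lattice_edges" for z :: "int ^ 'd" and e
  proof -
    obtain u w where uw: "e = {u, w}" "l1_norm (u - w) = 1" using e unfolding lattice_edges_def by blast
    then have "(+) z ` e = {z + u, z + w}" "l1_norm ((z + u) - (z + w)) = 1" by auto
    then show ?thesis unfolding lattice_edges_def by blast
  qed
  have "(+) (- z) ` (+) z ` e = e" by (simp add: image_image)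
  then show ?thesis using 1[of e z] 1[of "(+) z ` e" "- z"] by auto
qed

lemma path_edges_map: "path_edges (map ((+) z) p) = (`) ((+) z) ` path_edges p"
  unfolding path_edges_def image_image by (intro image_cong) auto

lemma path_time_map: "path_time x (map ((+) z) p) = path_time (\<lambda>e. x ((+) z ` e)) p"
  unfolding path_time_def by (auto intro!: sum.cong)

lemma lattice_path_shift: "lattice_path (z + u) (z + w) (map ((+) z) p) \<longleftrightarrow> lattice_path u w p"
proof -
  have "{z + a, z + b} \<in> lattice_edges \<longleftrightarrow> {a, b} \<in> lattice_edges" for a b
    by (simp add: lattice_edge_iff)
  then show ?thesis unfolding lattice_path_def
    by (auto simp: hd_map last_map successively_map)
qed

lemma saw_shift: "saw ((+) z ` \<Lambda>) (z + u) (z + w) = map ((+) z) ` saw \<Lambda> u w"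
proof (intro set_eqI iffI)
  fix p assume p: "p \<in> saw ((+) z ` \<Lambda>) (z + u) (z + w)"
  define p' where "p' = map ((+) (- z)) p"
  have eq: "p = map ((+) z) p'" by (simp add: p'_def comp_def)
  have "p' \<in> saw \<Lambda> u w"
  proof -
    have "lattice_path (z + u) (z + w) (map ((+) z) p')" "distinct (map ((+) z) p')" "(+) z ` set p' \<subseteq> (+) z ` \<Lambda>"
      using p by (simp_all add: saw_def flip: eq set_map)
    moreover have "inj ((+) z)" by simp
    ultimately show ?thesis unfolding saw_def lattice_path_shift
      by (simp add: distinct_map inj_image_subset_iff)
  qed
  then show "p \<in> map ((+) z) ` saw \<Lambda> u w" using eq by blast
next
  fix p assume "p \<in> map ((+) z) ` saw \<Lambda> u w"
  then show "p \<in> saw ((+) z ` \<Lambda>) (z + u) (z + w)"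
    unfolding saw_def by (auto simp: lattice_path_shift distinct_map intro!: imageI)
qed

lemma box_time_shift: "box_time ((+) z ` \<Lambda>) x (z + u) (z + w) = box_time \<Lambda> (\<lambda>e. x ((+) z ` e)) u w"
  unfolding box_time_def saw_shift image_image path_time_map ..

lemma edges_in_shift: "edges_in ((+) z ` \<Lambda>) = (`) ((+) z) ` edges_in \<Lambda>"
proof (intro set_eqI iffI)
  fix e assume e: "e \<in> edges_in ((+) z ` \<Lambda>)"
  have eq: "e = (+) z ` (+) (- z) ` e" by (simp add: image_image)
  have "(+) (- z) ` e \<subseteq> \<Lambda>" using e by (auto simp: edges_in_def)
  then have "(+) (- z) ` e \<in> edges_in \<Lambda>" using e lattice_edges_shift[of "- z" e] unfolding edges_in_def by blast
  then show "e \<in> (`) ((+) z) ` edges_in \<Lambda>" using eq by blast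
qed (auto simp: edges_in_def lattice_edges_shift)

text \<open>A nontrivial translation could fix an undirected edge only by exchanging its ends, which
  would force them to coincide. So the translates of \<open>e\<close> are distinct and sums over
  \<open>z\<close> can be reindexed by edges.\<close>

lemma inj_shift_edge: "inj (\<lambda>z. (+) (- z) ` e)" if edge: "e \<in> lattice_edges" for e :: "(int ^ 'd) set"
proof (rule injI)
  fix z z' :: "int ^ 'd" assume eq: "(+) (- z) ` e = (+) (- z') ` e"
  obtain a b where e: "e = {a, b}" "l1_norm (a - b) = 1" using edge unfolding lattice_edges_def by blast
  have "{- z + a, - z + b} = {- z' + a, - z' + b}" using eq e by simp
  then consider "- z + a = - z' + a" | "- z + a = - z' + b" "- z + b = - z' + a"
    by (auto simp: doubleton_eq_iff)
  then show "z = z'"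
  proof cases
    case 2
    have "a $ i = b $ i" for i
    proof -
      have "- z $ i + a $ i = - z' $ i + b $ i" "- z $ i + b $ i = - z' $ i + a $ i"
        using 2 by (metis vector_add_component vector_uminus_component)+
      then show ?thesis by simp
    qed
    then have "a = b" by (simp add: vec_eq_iff)
    then show ?thesis using e by (simp add: l1_norm_def)
  qed simp
qed

text \<open>Translations in two fixed directions, whatever the dimension: \<open>m^2\<close> points
  within distance of order \<open>m\<close>.\<close>

definition square :: "'d \<Rightarrow> 'd \<Rightarrow> nat \<Rightarrow> (int ^ 'd) set" where
  "square i j m = (\<lambda>(a, b). \<chi> l. if l = i then int a else if l = j then int b else 0) ` ({..<m} \<times> {..<m})"

lemma finite_square [simp]: "finite (square i j m)"
  by (simp add: square_def)

lemma card_square: "i \<noteq> j \<Longrightarrow> card (square i j m) = m\<^sup>2"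
proof -
  assume ij: "i \<noteq> j"
  have "inj_on (\<lambda>(a, b). (\<chi> l. if l = i then int a else if l = j then int b else 0) :: int ^ 'a) ({..<m} \<times> {..<m})"
  proof (rule inj_onI, clarify)
    fix a b a' b' :: nat
    assume eq: "(\<chi> l. if l = i then int a else if l = j then int b else 0) = (\<chi> l. if l = i then int a' else if l = j then int b' else 0)"
    from arg_cong[OF eq, of "\<lambda>v. v $ i"] arg_cong[OF eq, of "\<lambda>v. v $ j"] ij
    show "a = a' \<and> b = b'" by simp
  qed
  then show ?thesis unfolding square_def by (subst card_image) (auto simp: power2_eq_square)
qed

lemma l1_norm_two_coordinates:
  fixes v :: "int ^ 'd::finite"
  assumes "\<And>l. l \<noteq> i \<Longrightarrow> l \<noteq> j \<Longrightarrow> v $ l = 0"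
  shows "l1_norm v \<le> real_of_int \<bar>v $ i\<bar> + real_of_int \<bar>v $ j\<bar>"
proof -
  have "l1_norm v \<le> (\<Sum>l\<in>UNIV. (if l = i then real_of_int \<bar>v $ i\<bar> else 0) + (if l = j then real_of_int \<bar>v $ j\<bar> else 0))"
    unfolding l1_norm_def using assms by (intro sum_mono) auto
  then show ?thesis by (simp add: sum.distrib)
qed

lemma square_l1_norm:
  fixes z z' :: "int ^ 'd::finite"
  assumes "z \<in> square i j m" "z' \<in> square i j m"
  shows "l1_norm (z - z') \<le> 2 * real m" "l1_norm z \<le> 2 * real m"
proof -
  have bnd: "0 \<le> y $ l \<and> y $ l \<le> int m \<and> (l \<noteq> i \<longrightarrow> l \<noteq> j \<longrightarrow> y $ l = 0)" if "y \<in> square i j m" for y :: "int ^ 'd" and l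
    using that by (auto simp: square_def)
  have "l1_norm (z - z') \<le> real_of_int \<bar>(z - z') $ i\<bar> + real_of_int \<bar>(z - z') $ j\<bar>"
    using bnd[OF assms(1)] bnd[OF assms(2)] by (intro l1_norm_two_coordinates) auto
  moreover have "\<bar>(z - z') $ l\<bar> \<le> int m" for l
  proof -
    have "0 \<le> z $ l" "z $ l \<le> int m" "0 \<le> z' $ l" "z' $ l \<le> int m"
      using bnd[OF assms(1), of l] bnd[OF assms(2), of l] by blast+
    then show ?thesis by simp
  qed
  then have "real_of_int \<bar>(z - z') $ l\<bar> \<le> real m" for l by (metis of_int_le_iff of_int_of_nat_eq)
  from this[of i] this[of j] show "l1_norm (z - z') \<le> 2 * real m" using calculation by linarith
  have "l1_norm z \<le> real_of_int \<bar>z $ i\<bar> + real_of_int \<bar>z $ j\<bar>"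
    using bnd[OF assms(1)] by (intro l1_norm_two_coordinates) auto
  moreover have "\<bar>z $ l\<bar> \<le> int m" for l using bnd[OF assms(1), of l] by simp
  then have "real_of_int \<bar>z $ l\<bar> \<le> real m" for l by (metis of_int_le_iff of_int_of_nat_eq)
  from this[of i] this[of j] show "l1_norm z \<le> 2 * real m" using calculation by linarith
qed

definition shift_conf :: "int ^ 'd \<Rightarrow> ((int ^ 'd) set \<times> nat) set \<Rightarrow> ((int ^ 'd) set \<times> nat) set" where
  "shift_conf z = (`) (\<lambda>(e, i). ((+) z ` e, i))"

lemma inj_image_shift: "((+) z ` e = (+) z ` e') = (e = (e' :: (int ^ 'd) set))"
  by (intro inj_image_eq_iff) auto

lemma inj_shift_pair: "inj (\<lambda>(e :: (int ^ 'd) set, i :: nat). ((+) z ` e, i))"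
  by (rule injI, clarify) (simp only: prod.inject inj_image_shift)

lemma edge_code_shift: "edge_code n (shift_conf z A) ((+) z ` e) = edge_code n A e"
  unfolding edge_code_def shift_conf_def
  by (intro arg_cong[where f = set_encode]) (force simp: inj_image_shift)

lemma shift_conf_inverse: "shift_conf (- z) (shift_conf z A) = A"
  unfolding shift_conf_def by (simp add: image_image case_prod_unfold)

lemma edge_code_Int: "e \<in> F \<Longrightarrow> edge_code n (A \<inter> F \<times> {..<n}) e = edge_code n A e"
  unfolding edge_code_def by (intro arg_cong[where f = set_encode]) auto

lemma saw_path_edges: "p \<in> saw \<Lambda> u w \<Longrightarrow> path_edges p \<subseteq> edges_in \<Lambda>"
  by (rule path_edges_in) (auto simp: saw_def lattice_path_def)

lemma path_time_cong: "(\<And>e. e \<in> path_edges p \<Longrightarrow> x e = y e) \<Longrightarrow> path_time x p = path_time y p"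
  unfolding path_time_def path_edges_def by (intro sum.cong) auto

lemma box_time_cong:
  assumes "\<And>e. e \<in> edges_in \<Lambda> \<Longrightarrow> x e = y e"
  shows "box_time \<Lambda> x u w = box_time \<Lambda> y u w"
  unfolding box_time_def
  by (intro arg_cong[where f = Min] image_cong refl path_time_cong assms) (use saw_path_edges in blast)

context quantile
begin

text \<open>The choice operator need not commute with translations. For a translated box the
  configuration is therefore moved back, a path is chosen there, and that path is
  translated.\<close>

definition opt_path :: "nat \<Rightarrow> (int ^ 'd) set \<Rightarrow> int ^ 'd \<Rightarrow> int ^ 'd \<Rightarrow> ((int ^ 'd) set \<times> nat) set \<Rightarrow> (int ^ 'd) list" where
  "opt_path n \<Lambda> u w A = (SOME p. p \<in> saw \<Lambda> u w \<and> path_time (wt n A) p = box_time \<Lambda> (wt n A) u w)"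

lemma opt_path:
  assumes "finite \<Lambda>" "saw \<Lambda> u w \<noteq> {}"
  shows "opt_path n \<Lambda> u w A \<in> saw \<Lambda> u w" "path_time (wt n A) (opt_path n \<Lambda> u w A) = box_time \<Lambda> (wt n A) u w"
  using someI_ex[of "\<lambda>p. p \<in> saw \<Lambda> u w \<and> path_time (wt n A) p = box_time \<Lambda> (wt n A) u w"]
    box_time_attained[OF assms, of "wt n A"] unfolding opt_path_def by auto

text \<open>Summing over translates turns the influence of one fixed edge into the length that one geodesic spends
  in a square.\<close>

lemma translated_influence_le:
  fixes v :: "int ^ 'd::finite"
  assumes \<kappa>: "0 \<le> \<kappa>" "(\<Sum>k<2 ^ n. exp (ln (3 / 2) * (1 + real (lead_zeros n k)) - \<kappa> * q n k)) \<le> 1 / (2 * real (lattice_degree TYPE('d))) * 2 ^ n"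
    and v: "(0 :: int ^ 'd) \<in> lattice_box N" "v \<in> lattice_box N" and e: "e \<in> lattice_edges" and s: "0 < s" and m: "1 \<le> m"
    and F: "finite F" "\<And>z. z \<in> square i j m \<Longrightarrow> edges_in ((+) z ` lattice_box N) \<subseteq> F" "e \<in> F"
  defines "\<gamma> \<equiv> \<lambda>z A. map ((+) z) (opt_path n (lattice_box N) 0 v (shift_conf (- z) A \<inter> edges_in (lattice_box N) \<times> {..<n}))"
  shows "(\<Sum>z\<in>square i j m. cube_avg (F \<times> {..<n}) (\<lambda>A. if e \<in> path_edges (\<gamma> z A) then len_wt n A e else 0))
    \<le> (\<kappa> * (s + 4 * real m ^ 4 * (m8 * (3 * real m) ^ 8) / s ^ 7) + ln (4 * real m ^ 2 + 1)) / ln (3 / 2)"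
proof -
  let ?B = "square i j m" and ?\<Lambda> = "lattice_box N :: (int ^ 'd) set"
  define F0 where "F0 = edges_in ?\<Lambda>"
  have finF0: "finite F0" unfolding F0_def by (intro finite_edges_in finite_box)
  have ne: "saw ?\<Lambda> 0 v \<noteq> {}" using v by (intro saw_nonempty geodesic_set_box)
  define \<gamma>0 where "\<gamma>0 = opt_path n ?\<Lambda> 0 v"
  have \<gamma>0: "\<gamma>0 A \<in> saw ?\<Lambda> 0 v" "path_time (wt n A) (\<gamma>0 A) = box_time ?\<Lambda> (wt n A) 0 v" for A
    unfolding \<gamma>0_def by (rule opt_path[OF finite_box ne])+
  define H where "H e' A = (if e' \<in> path_edges (\<gamma>0 A) then len_wt n A e' else 0)" for e' A
  \<comment> \<open>Stationarity: moving the configuration back by \<open>z\<close> turns the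
    translated box into the original one and \<open>e\<close> into \<open>e - z\<close>; the digits
    outside the box are averaged out.\<close>
  have term_eq: "cube_avg (F \<times> {..<n}) (\<lambda>A. if e \<in> path_edges (\<gamma> z A) then len_wt n A e else 0)
     = cube_avg (F0 \<times> {..<n}) (H ((+) (- z) ` e))" if z: "z \<in> ?B" for z
  proof -
    let ?e = "(+) (- z) ` e" and ?S0 = "F0 \<times> {..<n}"
    have e_eq: "e = (+) z ` ?e" by (simp add: image_image)
    have zS0: "shift_conf z ?S0 = edges_in ((+) z ` ?\<Lambda>) \<times> {..<n}"
      unfolding edges_in_shift F0_def shift_conf_def by force
    have cut: "shift_conf (- z) A \<inter> ?S0 = shift_conf (- z) (A \<inter> shift_conf z ?S0)" for A
    proof -
      have "shift_conf (- z) (A \<inter> shift_conf z ?S0) = shift_conf (- z) A \<inter> shift_conf (- z) (shift_conf z ?S0)"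
        unfolding shift_conf_def by (rule image_Int[OF inj_shift_pair])
      then show ?thesis by (simp add: shift_conf_inverse)
    qed
    have "(if e \<in> path_edges (\<gamma> z A) then len_wt n A e else 0) = H ?e (shift_conf (- z) A \<inter> ?S0)" for A
    proof -
      have "e \<in> path_edges (\<gamma> z A) \<longleftrightarrow> ?e \<in> path_edges (\<gamma>0 (shift_conf (- z) A \<inter> ?S0))"
        unfolding \<gamma>_def path_edges_map \<gamma>0_def F0_def
        using e_eq inj_image_shift[of z ?e] by (metis (no_types, lifting) imageE imageI)
      moreover have "len_wt n (shift_conf (- z) A \<inter> ?S0) ?e = len_wt n A e"
        if "?e \<in> path_edges (\<gamma>0 (shift_conf (- z) A \<inter> ?S0))"
      proof -
        have "?e \<in> F0" using that saw_path_edges[OF \<gamma>0(1)] by (auto simp: F0_def)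
        then have "edge_code n (shift_conf (- z) A \<inter> ?S0) ?e = edge_code n A e"
          by (simp only: edge_code_Int edge_code_shift)
        then show ?thesis unfolding len_wt_def by simp
      qed
      ultimately show ?thesis by (simp add: H_def)
    qed
    then have "cube_avg (F \<times> {..<n}) (\<lambda>A. if e \<in> path_edges (\<gamma> z A) then len_wt n A e else 0)
       = cube_avg (F \<times> {..<n}) (\<lambda>A. H ?e (shift_conf (- z) A \<inter> ?S0))" by simp
    also have "\<dots> = cube_avg (shift_conf z ?S0) (\<lambda>A. H ?e (shift_conf (- z) A \<inter> ?S0))"
    proof (rule cube_avg_indep)
      show "shift_conf z ?S0 \<subseteq> F \<times> {..<n}" unfolding zS0 using F(2)[OF z] by auto
      show "H ?e (shift_conf (- z) A \<inter> ?S0) = H ?e (shift_conf (- z) (A \<inter> shift_conf z ?S0) \<inter> ?S0)" for A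
        unfolding cut by (simp add: Int_assoc)
    qed (use F in simp)
    also have "\<dots> = cube_avg ?S0 (\<lambda>A. H ?e (shift_conf (- z) (shift_conf z A) \<inter> ?S0))"
      unfolding shift_conf_def by (rule cube_avg_image[OF inj_on_subset[OF inj_shift_pair subset_UNIV]])
    also have "\<dots> = cube_avg ?S0 (H ?e)"
      unfolding shift_conf_inverse by (intro cube_avg_cong) (simp add: Int_absorb2)
    finally show ?thesis .
  qed
  define Es where "Es = (\<lambda>z. (+) (- z) ` e) ` ?B"
  define V where "V = \<Union>Es"
  obtain a0 b0 where e_ab: "e = {a0, b0}" "l1_norm (a0 - b0) = 1" using e unfolding lattice_edges_def by blast
  \<comment> \<open>The edges \<open>e - z\<close> have their ends in two reflected copies of the
    square, which yields both the cardinality and the diameter of \<open>V\<close>.\<close>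
  have V_eq: "V = (\<lambda>z. a0 - z) ` ?B \<union> (\<lambda>z. b0 - z) ` ?B"
    unfolding V_def Es_def e_ab by auto
  have finV: "finite V" unfolding V_eq by simp
  have cardV: "card V \<le> 2 * m\<^sup>2"
  proof -
    have "card (?B) \<le> m\<^sup>2"
      unfolding square_def by (rule order_trans[OF card_image_le]) (simp_all add: power2_eq_square)
    moreover have "card V \<le> card ((\<lambda>z. a0 - z) ` ?B) + card ((\<lambda>z. b0 - z) ` ?B)"
      unfolding V_eq by (rule card_Un_le)
    moreover have "card ((\<lambda>z. a0 - z) ` ?B) \<le> card ?B" "card ((\<lambda>z. b0 - z) ` ?B) \<le> card ?B"
      by (auto intro: card_image_le)
    ultimately show ?thesis by linarith
  qed
  have diamV: "l1_norm (a - b) \<le> 3 * real m" if ab: "a \<in> V" "b \<in> V" for a b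
  proof -
    obtain a1 z where a: "a = a1 - z" "a1 \<in> {a0, b0}" "z \<in> ?B" using ab(1) unfolding V_eq by blast
    obtain b1 z' where b: "b = b1 - z'" "b1 \<in> {a0, b0}" "z' \<in> ?B" using ab(2) unfolding V_eq by blast
    have "l1_norm (a1 - b1) \<le> 1"
      using a(2) b(2) e_ab(2) l1_norm_minus[of a0 b0] by (auto simp: l1_norm_def)
    moreover have "a - b = (a1 - b1) + (z' - z)" using a b by simp
    ultimately have "l1_norm (a - b) \<le> 1 + 2 * real m"
      using l1_norm_triangle[of "a1 - b1" "z' - z"] square_l1_norm(1)[OF b(3) a(3)] by simp
    then show ?thesis using m by simp
  qed
  define \<pi> where "\<pi> a b = (SOME p. lattice_path a b p \<and> set p \<subseteq> ?\<Lambda> \<and> real (length p - 1) = l1_norm (a - b))" for a b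
  have \<pi>: "lattice_path a b (\<pi> a b)" "set (\<pi> a b) \<subseteq> ?\<Lambda>" "real (length (\<pi> a b) - 1) = l1_norm (a - b)"
    if "a \<in> ?\<Lambda>" "b \<in> ?\<Lambda>" for a b
    using someI_ex[of "\<lambda>p. lattice_path a b p \<and> set p \<subseteq> ?\<Lambda> \<and> real (length p - 1) = l1_norm (a - b)"]
      geodesic_set_box[of N] that unfolding \<pi>_def geodesic_set_def by blast+
  let ?W = "V \<inter> ?\<Lambda>"
  have finW: "finite ?W" using finV by simp
  \<comment> \<open>A bound for the largest of these path times whose mean is easy to estimate: a
    time \<open>t > s\<close> is at most \<open>t^8 / s^7\<close>.\<close>
  define Y where "Y A = s + (\<Sum>(a, b)\<in>?W \<times> ?W. path_time (wt n A) (\<pi> a b) ^ 8) / s ^ 7" for A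
  have "\<exists>\<sigma>\<in>saw_from ?\<Lambda> V. path_edges (\<gamma>0 A) \<inter> Es \<subseteq> path_edges \<sigma> \<and> path_time (wt n A) \<sigma> \<le> Y A" for A
  proof -
    have Es_V: "e' \<subseteq> V" if "e' \<in> Es" for e' using that by (auto simp: V_def)
    obtain \<sigma> where \<sigma>: "\<sigma> \<in> saw_from ?\<Lambda> V" "path_edges (\<gamma>0 A) \<inter> Es \<subseteq> path_edges \<sigma>"
      "path_time (wt n A) \<sigma> = 0 \<or> (\<exists>a\<in>?W. \<exists>b\<in>?W. \<forall>r. lattice_path a b r \<longrightarrow> set r \<subseteq> ?\<Lambda> \<longrightarrow> path_time (wt n A) \<sigma> \<le> path_time (wt n A) r)"
      using geodesic_segment[OF finite_box \<gamma>0(1) \<gamma>0(2) wt_nonneg Es_V] by blast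
    have nn: "0 \<le> (\<Sum>(a, b)\<in>?W \<times> ?W. path_time (wt n A) (\<pi> a b) ^ 8) / s ^ 7"
      using s by (intro divide_nonneg_nonneg sum_nonneg) auto
    have "path_time (wt n A) \<sigma> \<le> Y A"
      using \<sigma>(3)
    proof (elim disjE bexE)
      assume "path_time (wt n A) \<sigma> = 0"
      then show ?thesis unfolding Y_def using s nn by linarith
    next
      fix a b assume ab: "a \<in> ?W" "b \<in> ?W"
        and le: "\<forall>r. lattice_path a b r \<longrightarrow> set r \<subseteq> ?\<Lambda> \<longrightarrow> path_time (wt n A) \<sigma> \<le> path_time (wt n A) r"
      let ?t = "path_time (wt n A) (\<pi> a b)"
      have le': "path_time (wt n A) \<sigma> \<le> ?t" using le \<pi>[of a b] ab by auto
      show ?thesis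
      proof (cases "?t \<le> s")
        case True
        then show ?thesis unfolding Y_def using le' nn by linarith
      next
        case False
        then have "?t * s ^ 7 \<le> ?t * ?t ^ 7" using s by (intro mult_left_mono power_mono) auto
        also have "\<dots> = ?t ^ 8" using power_Suc[of ?t 7] by simp
        also have "\<dots> \<le> (\<Sum>(a, b)\<in>?W \<times> ?W. path_time (wt n A) (\<pi> a b) ^ 8)"
          using member_le_sum[of "(a, b)" "?W \<times> ?W" "\<lambda>(a, b). path_time (wt n A) (\<pi> a b) ^ 8"] ab finW by auto
        finally have "?t \<le> (\<Sum>(a, b)\<in>?W \<times> ?W. path_time (wt n A) (\<pi> a b) ^ 8) / s ^ 7"
          using s by (simp add: pos_le_divide_eq)
        then show ?thesis unfolding Y_def using le' s by linarith
      qed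
    qed
    then show ?thesis using \<sigma> by blast
  qed
  then have "\<exists>\<sigma>. \<forall>A. \<sigma> A \<in> saw_from ?\<Lambda> V \<and> path_edges (\<gamma>0 A) \<inter> Es \<subseteq> path_edges (\<sigma> A) \<and> path_time (wt n A) (\<sigma> A) \<le> Y A"
    by (intro choice allI) blast
  then obtain \<sigma> where \<sigma>: "\<And>A. \<sigma> A \<in> saw_from ?\<Lambda> V" "\<And>A. path_edges (\<gamma>0 A) \<inter> Es \<subseteq> path_edges (\<sigma> A)"
      "\<And>A. path_time (wt n A) (\<sigma> A) \<le> Y A" by blast
  have Y_avg: "cube_avg (F0 \<times> {..<n}) Y \<le> s + 4 * real m ^ 4 * (m8 * (3 * real m) ^ 8) / s ^ 7"
  proof -
    have "cube_avg (F0 \<times> {..<n}) (\<lambda>A. path_time (wt n A) (\<pi> a b) ^ 8) \<le> m8 * (3 * real m) ^ 8" if "a \<in> ?W" "b \<in> ?W" for a b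
    proof -
      have "path_edges (\<pi> a b) \<subseteq> F0" unfolding F0_def using \<pi>[of a b] that
        by (intro path_edges_in) (auto simp: lattice_path_def)
      then have "cube_avg (F0 \<times> {..<n}) (\<lambda>A. path_time (wt n A) (\<pi> a b) ^ 8) \<le> m8 * real (length (\<pi> a b) - 1) ^ 8"
        by (rule avg_path_time_le(2)[OF finF0])
      also have "\<dots> \<le> m8 * (3 * real m) ^ 8"
        using \<pi>(3)[of a b] diamV[of a b] that m8_nonneg by (intro mult_left_mono power_mono) auto
      finally show ?thesis .
    qed
    then have "(\<Sum>(a, b)\<in>?W \<times> ?W. cube_avg (F0 \<times> {..<n}) (\<lambda>A. path_time (wt n A) (\<pi> a b) ^ 8)) \<le> (\<Sum>(a, b)\<in>?W \<times> ?W. m8 * (3 * real m) ^ 8)"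
      by (intro sum_mono) auto
    also have "\<dots> = real (card ?W) ^ 2 * (m8 * (3 * real m) ^ 8)"
      by (simp add: case_prod_unfold card_cartesian_product power2_eq_square)
    also have "\<dots> \<le> (2 * real m ^ 2) ^ 2 * (m8 * (3 * real m) ^ 8)"
    proof (intro mult_right_mono power_mono)
      have "card ?W \<le> card V" using finV by (intro card_mono) auto
      then have "real (card ?W) \<le> real (2 * m\<^sup>2)" using cardV by (simp only: of_nat_le_iff)
      then show "real (card ?W) \<le> 2 * real m ^ 2" by simp
    qed (use m8_nonneg in auto)
    also have "\<dots> = 4 * real m ^ 4 * (m8 * (3 * real m) ^ 8)"
      by (simp add: power_mult_distrib flip: power_mult)
    finally have "(\<Sum>(a, b)\<in>?W \<times> ?W. cube_avg (F0 \<times> {..<n}) (\<lambda>A. path_time (wt n A) (\<pi> a b) ^ 8)) / s ^ 7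
      \<le> 4 * real m ^ 4 * (m8 * (3 * real m) ^ 8) / s ^ 7"
      using s by (intro divide_right_mono) auto
    then show ?thesis
      unfolding Y_def case_prod_unfold cube_avg_add cube_avg_divide cube_avg_sum
      using finF0 by (simp add: cube_avg_const)
  qed
  have "(\<Sum>z\<in>?B. cube_avg (F \<times> {..<n}) (\<lambda>A. if e \<in> path_edges (\<gamma> z A) then len_wt n A e else 0))
    = (\<Sum>z\<in>?B. cube_avg (F0 \<times> {..<n}) (H ((+) (- z) ` e)))"
    by (intro sum.cong refl term_eq)
  also have "\<dots> = (\<Sum>e'\<in>Es. cube_avg (F0 \<times> {..<n}) (H e'))"
    unfolding Es_def by (subst sum.reindex[OF inj_on_subset[OF inj_shift_edge[OF e] subset_UNIV]]) (simp add: comp_def)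
  also have "\<dots> = cube_avg (F0 \<times> {..<n}) (\<lambda>A. \<Sum>e'\<in>Es. H e' A)"
    by (simp add: cube_avg_sum)
  also have "\<dots> \<le> cube_avg (F0 \<times> {..<n}) (\<lambda>A. \<Sum>e'\<in>path_edges (\<sigma> A). len_wt n A e')"
  proof (rule cube_avg_mono)
    fix A
    have "finite Es" unfolding Es_def by simp
    then have "(\<Sum>e'\<in>Es. H e' A) = (\<Sum>e'\<in>path_edges (\<gamma>0 A) \<inter> Es. len_wt n A e')"
      unfolding H_def by (simp add: sum.If_cases Int_commute)
    also have "\<dots> \<le> (\<Sum>e'\<in>path_edges (\<sigma> A). len_wt n A e')"
      using \<sigma>(2) by (intro sum_mono2) (auto simp: len_wt_nonneg)
    finally show "(\<Sum>e'\<in>Es. H e' A) \<le> (\<Sum>e'\<in>path_edges (\<sigma> A). len_wt n A e')" .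
  qed
  also have "\<dots> \<le> (\<kappa> * cube_avg (F0 \<times> {..<n}) (\<lambda>A. path_time (wt n A) (\<sigma> A)) + ln (2 * card V + 1)) / ln (3 / 2)"
    using \<sigma>(1) finF0 by (intro greedy_saw_le[OF \<kappa>(2) finite_box finV]) (auto simp: F0_def)
  also have "\<dots> \<le> (\<kappa> * (s + 4 * real m ^ 4 * (m8 * (3 * real m) ^ 8) / s ^ 7) + ln (4 * real m ^ 2 + 1)) / ln (3 / 2)"
  proof (intro divide_right_mono add_mono mult_left_mono \<kappa>(1))
    show "cube_avg (F0 \<times> {..<n}) (\<lambda>A. path_time (wt n A) (\<sigma> A)) \<le> s + 4 * real m ^ 4 * (m8 * (3 * real m) ^ 8) / s ^ 7"
      using cube_avg_mono[of "F0 \<times> {..<n}", OF \<sigma>(3)] Y_avg by (rule order_trans)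
    have "real (card V) \<le> real (2 * m\<^sup>2)" using cardV by (simp only: of_nat_le_iff)
    then show "ln (real (2 * card V + 1)) \<le> ln (4 * real m ^ 2 + 1)" by (subst ln_le_cancel_iff) auto
  qed simp
  finally show ?thesis .
qed

end

section \<open>The averaged passage time and its variance on the cube\<close>

lemma geodesic_set_shift:
  assumes "geodesic_set \<Lambda>"
  shows "geodesic_set ((+) z ` \<Lambda>)"
  unfolding geodesic_set_def
proof (intro ballI)
  fix u w assume "u \<in> (+) z ` \<Lambda>" "w \<in> (+) z ` \<Lambda>"
  then obtain u' w' where uw: "u = z + u'" "w = z + w'" "u' \<in> \<Lambda>" "w' \<in> \<Lambda>" by auto
  then obtain p where p: "lattice_path u' w' p" "set p \<subseteq> \<Lambda>" "real (length p - 1) = l1_norm (u' - w')"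
    using assms unfolding geodesic_set_def by blast
  have "lattice_path u w (map ((+) z) p)" unfolding uw lattice_path_shift by (rule p)
  moreover have "set (map ((+) z) p) \<subseteq> (+) z ` \<Lambda>" using p(2) by auto
  ultimately show "\<exists>p. lattice_path u w p \<and> set p \<subseteq> (+) z ` \<Lambda> \<and> real (length p - 1) = l1_norm (u - w)"
    using p(3) by (intro exI[of _ "map ((+) z) p"]) (simp add: uw)
qed

lemma cube_diff_sum: "cube_diff j (\<lambda>A. (\<Sum>z\<in>B. f z A) / c) A = (\<Sum>z\<in>B. cube_diff j (f z) A) / c"
  by (simp add: cube_diff_def sum_subtractf diff_divide_distrib)

text \<open>Every translate has its own translated box, so the summands are exact translates of one
  another. For \<open>i \<noteq> j\<close> the divisor \<open>real k ^ 4\<close> is the number of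
  points of a square of side \<open>k^2\<close>.\<close>

definition avg_time :: "nat \<Rightarrow> 'd \<Rightarrow> 'd \<Rightarrow> nat \<Rightarrow> ((int ^ 'd) set \<Rightarrow> real) \<Rightarrow> int ^ 'd \<Rightarrow> real" where
  "avg_time N i j k x v = (\<Sum>z\<in>square i j (k\<^sup>2). box_time ((+) z ` lattice_box (int N)) x z (z + v)) / real k ^ 4"

definition avg_edges :: "nat \<Rightarrow> 'd \<Rightarrow> 'd \<Rightarrow> nat \<Rightarrow> (int ^ 'd::finite) set set" where
  "avg_edges N i j k = (\<Union>z\<in>square i j (k\<^sup>2). edges_in ((+) z ` lattice_box (int N)))"

lemma finite_avg_edges: "finite (avg_edges N i j k)"
  unfolding avg_edges_def by (intro finite_UN_I finite_square finite_edges_in finite_imageI finite_box)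

context quantile
begin

text \<open>\<open>C1\<close> compares influences with the expected weight \<open>infl z e\<close>
  that the geodesic of translate \<open>z\<close> puts on \<open>e\<close>. \<open>C2\<close> bounds
  the total weight of one geodesic by \<open>|v| + 1\<close>, and \<open>C3\<close> bounds by
  \<open>k^3\<close> the weight on one edge summed over the translates. The sum of squared
  influences is at most their maximum times their sum, so the factor \<open>M = k\<close> cancels
  the \<open>1 / k\<close> gained by averaging.\<close>

lemma avg_time_variance_at:
  fixes v :: "int ^ 'd::finite"
  assumes \<kappa>: "0 \<le> \<kappa>" "(\<Sum>k<2 ^ n. exp (ln (3 / 2) * (1 + real (lead_zeros n k)) - \<kappa> * q n k)) \<le> 1 / (2 * real (lattice_degree TYPE('d))) * 2 ^ n"
    and n: "0 < n" and ij: "i \<noteq> j" and k: "2 \<le> k"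
    and v: "v \<in> lattice_box (int N)"
  defines "C1 \<equiv> 2 * (2 + T (1 / 2))\<^sup>2 + 4 * (m8 + 102)"
    and "C2 \<equiv> (\<kappa> * (1 + m8) + ln 3) / ln (3 / 2)"
    and "C3 \<equiv> (\<kappa> * (1 + 4 * 3 ^ 8 * m8) + 9) / ln (3 / 2)"
    and "S \<equiv> avg_edges N i j k \<times> {..<n}"
  shows "ln (real k) * (cube_avg S (\<lambda>A. (avg_time N i j k (wt n A) v)\<^sup>2) - (cube_avg S (\<lambda>A. avg_time N i j k (wt n A) v))\<^sup>2)
    \<le> C1 * C2 * (1 + C1 * C3) * (l1_norm v + 1)"
proof -
  define B where "B = (square i j (k\<^sup>2) :: (int ^ 'd) set)"
  define F where "F = (avg_edges N i j k :: (int ^ 'd) set set)"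
  let ?\<Lambda> = "lattice_box (int N) :: (int ^ 'd) set"
  have S: "S = F \<times> {..<n}" by (simp add: S_def F_def)
  have finF: "finite F" unfolding F_def by (rule finite_avg_edges)
  have finB: "finite B" by (simp add: B_def)
  have cardB: "real (card B) = real k ^ 4"
    unfolding B_def card_square[OF ij] by (simp flip: power_mult)
  have k0: "real k ^ 4 > 0" using k by simp
  have 0: "(0 :: int ^ 'd) \<in> ?\<Lambda>" by (simp add: lattice_box_def)
  have sub: "edges_in ((+) z ` ?\<Lambda>) \<subseteq> F" if "z \<in> B" for z
    using that unfolding F_def avg_edges_def B_def by blast
  define f where "f z A = box_time ((+) z ` ?\<Lambda>) (wt n A) z (z + v)" for z A
  define \<gamma> where "\<gamma> z A = map ((+) z) (opt_path n ?\<Lambda> 0 v (shift_conf (- z) A \<inter> edges_in ?\<Lambda> \<times> {..<n}))" for z A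
  have ne: "saw ?\<Lambda> 0 v \<noteq> {}" using v 0 by (intro saw_nonempty geodesic_set_box)
  have ne': "saw ((+) z ` ?\<Lambda>) z (z + v) \<noteq> {}" for z using ne saw_shift[of z ?\<Lambda> 0 v] by simp
  have \<gamma>_saw: "\<gamma> z A \<in> saw ((+) z ` ?\<Lambda>) z (z + v)" for z A
    unfolding \<gamma>_def using saw_shift[of z ?\<Lambda> 0 v] opt_path(1)[OF finite_box ne] by simp
  have \<gamma>_time: "path_time (wt n A) (\<gamma> z A) = f z A" for z A
  proof -
    let ?A0 = "shift_conf (- z) A \<inter> edges_in ?\<Lambda> \<times> {..<n}"
    have wt0: "wt n ?A0 e = wt n A ((+) z ` e)" if "e \<in> edges_in ?\<Lambda>" for e
    proof -
      have "edge_code n ?A0 e = edge_code n (shift_conf (- z) A) e" by (rule edge_code_Int[OF that])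
      also have "\<dots> = edge_code n (shift_conf (- z) A) ((+) (- z) ` ((+) z ` e))" by (simp add: image_image)
      also have "\<dots> = edge_code n A ((+) z ` e)" by (rule edge_code_shift)
      finally show ?thesis unfolding wt_def by simp
    qed
    have "path_time (wt n A) (\<gamma> z A) = path_time (\<lambda>e. wt n A ((+) z ` e)) (opt_path n ?\<Lambda> 0 v ?A0)"
      unfolding \<gamma>_def path_time_map ..
    also have "\<dots> = path_time (wt n ?A0) (opt_path n ?\<Lambda> 0 v ?A0)"
      using saw_path_edges[OF opt_path(1)[OF finite_box ne, of n ?A0]]
      by (intro path_time_cong wt0[symmetric]) blast
    also have "\<dots> = box_time ?\<Lambda> (wt n ?A0) 0 v" by (rule opt_path(2)[OF finite_box ne])
    also have "\<dots> = box_time ?\<Lambda> (\<lambda>e. wt n A ((+) z ` e)) 0 v" by (rule box_time_cong) (rule wt0)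
    also have "\<dots> = f z A" unfolding f_def using box_time_shift[of z ?\<Lambda> "wt n A" 0 v] by simp
    finally show ?thesis .
  qed
  define infl where "infl z e = cube_avg S (\<lambda>A. if e \<in> path_edges (\<gamma> z A) then len_wt n A e else 0)" for z e
  have infl0: "0 \<le> infl z e" for z e unfolding infl_def by (intro cube_avg_nonneg) (simp add: len_wt_nonneg)
  have C1: "0 \<le> C1" unfolding C1_def using m8_nonneg by simp
  have C2: "0 \<le> C2" unfolding C2_def using m8_nonneg \<kappa>(1) by simp
  have C3: "0 \<le> C3" unfolding C3_def using m8_nonneg \<kappa>(1) by simp
  have L: "0 \<le> l1_norm v + 1" using l1_norm_nonneg[of v] by simp
  have a: "(\<Sum>l<n. cube_avg S (\<lambda>A. \<bar>cube_diff (e, l) (f z) A\<bar> ^ p)) \<le> C1 * infl z e"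
    if "z \<in> B" "e \<in> F" "p = 1 \<or> p = 2" for z e p
    unfolding S C1_def infl_def f_def
    by (rule box_time_influence_le[OF finF that(2) n finite_imageI[OF finite_box] ne' \<gamma>_saw _ that(3)])
      (use \<gamma>_time in \<open>simp add: f_def\<close>)
  have b: "(\<Sum>e\<in>F. infl z e) \<le> C2 * (l1_norm v + 1)" if z: "z \<in> B" for z
  proof -
    have PE: "path_edges (\<gamma> z A) \<subseteq> F" for A using saw_path_edges[OF \<gamma>_saw] sub[OF z] by blast
    have "(\<Sum>e\<in>F. infl z e) = cube_avg S (\<lambda>A. \<Sum>e\<in>path_edges (\<gamma> z A). len_wt n A e)"
      unfolding infl_def cube_avg_sum[symmetric]
      using finF PE by (simp add: sum.If_cases Int_absorb1)
    also have "\<dots> \<le> (\<kappa> * cube_avg S (\<lambda>A. path_time (wt n A) (\<gamma> z A)) + ln (2 * card {z} + 1)) / ln (3 / 2)"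
      unfolding S
    proof (rule greedy_saw_le[OF \<kappa>(2) finite_imageI[OF finite_box] _ finF sub[OF z]])
      fix A show "\<gamma> z A \<in> saw_from ((+) z ` ?\<Lambda>) {z}"
        using \<gamma>_saw[of z A] by (auto simp: saw_from_def saw_def lattice_path_def)
    qed simp
    also have "cube_avg S (\<lambda>A. path_time (wt n A) (\<gamma> z A)) \<le> (1 + m8) * l1_norm v"
    proof -
      have "z \<in> (+) z ` ?\<Lambda>" "z + v \<in> (+) z ` ?\<Lambda>" using 0 v by (auto intro: image_eqI[of _ _ 0])
      then obtain p where p: "lattice_path z (z + v) p" "set p \<subseteq> (+) z ` ?\<Lambda>" "real (length p - 1) = l1_norm (z - (z + v))"
        using geodesic_set_shift[OF geodesic_set_box] unfolding geodesic_set_def by blast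
      have "cube_avg S (\<lambda>A. path_time (wt n A) (\<gamma> z A)) \<le> cube_avg S (\<lambda>A. path_time (wt n A) p)"
        unfolding \<gamma>_time f_def
        by (intro cube_avg_mono box_time_le finite_imageI finite_box p wt_nonneg)
      also have "\<dots> \<le> (1 + m8) * real (length p - 1)"
        unfolding S using path_edges_in[of p "(+) z ` ?\<Lambda>"] p sub[OF z]
        by (intro avg_path_time_le finF) (auto simp: lattice_path_def)
      also have "real (length p - 1) = l1_norm v" unfolding p(3) l1_norm_minus[of z] by simp
      finally show ?thesis .
    qed
    also have "(\<kappa> * ((1 + m8) * l1_norm v) + ln (2 * card {z} + 1)) / ln (3 / 2) \<le> C2 * (l1_norm v + 1)"
    proof -
      have "0 \<le> ln 3 * l1_norm v + \<kappa> * (1 + m8)" using l1_norm_nonneg[of v] m8_nonneg \<kappa>(1) by simp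
      then have "\<kappa> * ((1 + m8) * l1_norm v) + ln 3 \<le> (\<kappa> * (1 + m8) + ln 3) * (l1_norm v + 1)"
        by (simp add: algebra_simps)
      then have "(\<kappa> * ((1 + m8) * l1_norm v) + ln 3) / ln (3 / 2) \<le> (\<kappa> * (1 + m8) + ln 3) * (l1_norm v + 1) / ln (3 / 2)"
        by (rule divide_right_mono) simp
      then show ?thesis unfolding C2_def by simp
    qed
    finally show ?thesis using \<kappa>(1) by (simp add: divide_right_mono mult_left_mono)
  qed
  have c: "(\<Sum>z\<in>B. infl z e) \<le> C3 * real k ^ 3" if e: "e \<in> F" for e
  proof -
    have el: "e \<in> lattice_edges" using e unfolding F_def avg_edges_def edges_in_def by blast
    have k1: "1 \<le> k\<^sup>2" "0 < real k ^ 3" using k by simp_all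
    \<comment> \<open>Cut-off at \<open>s = k^3\<close>: order \<open>k^8\<close> pairs of points,
      eighth moments of order \<open>k^16\<close> and the divisor \<open>s^7 = k^21\<close> give
      \<open>k^3\<close> again, so the two terms balance.\<close>
    have "(\<Sum>z\<in>B. infl z e) \<le> (\<kappa> * (real k ^ 3 + 4 * real (k\<^sup>2) ^ 4 * (m8 * (3 * real (k\<^sup>2)) ^ 8) / (real k ^ 3) ^ 7) + ln (4 * real (k\<^sup>2) ^ 2 + 1)) / ln (3 / 2)"
      unfolding infl_def \<gamma>_def S B_def
      by (rule translated_influence_le[OF \<kappa> 0 v el k1(2,1) finF _ e]) (rule sub, simp add: B_def)
    also have "4 * real (k\<^sup>2) ^ 4 * (m8 * (3 * real (k\<^sup>2)) ^ 8) / (real k ^ 3) ^ 7 = 4 * 3 ^ 8 * m8 * real k ^ 3"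
    proof -
      have "real (k\<^sup>2) ^ 4 * real (k\<^sup>2) ^ 8 = real k ^ 3 * (real k ^ 3) ^ 7"
        by (simp flip: power_mult power_add)
      then show ?thesis using k1(2) by (simp add: power_mult_distrib divide_eq_eq mult_ac)
    qed
    also have "ln (4 * real (k\<^sup>2) ^ 2 + 1) \<le> 9 * real k ^ 3"
    proof -
      have "1 \<le> real k ^ 4" using k by simp
      then have "ln (4 * real (k\<^sup>2) ^ 2 + 1) \<le> ln (5 * real k ^ 4)"
        using k by (subst ln_le_cancel_iff) (auto simp flip: power_mult intro: add_pos_pos)
      also have "\<dots> = ln 5 + 4 * ln (real k)" using k by (simp add: ln_mult ln_realpow)
      also have "\<dots> \<le> 5 + 4 * real k"
        using ln_le_minus_one[of 5] ln_le_minus_one[of "real k"] k by simp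
      also have "\<dots> \<le> 9 * real k ^ 3"
      proof -
        have "real k ^ 1 \<le> real k ^ 3" using k by (intro power_increasing) auto
        moreover have "2 \<le> real k" using k by simp
        ultimately show ?thesis unfolding power_one_right by linarith
      qed
      finally show ?thesis .
    qed
    also have "(\<kappa> * (real k ^ 3 + 4 * 3 ^ 8 * m8 * real k ^ 3) + 9 * real k ^ 3) / ln (3 / 2) = C3 * real k ^ 3"
      unfolding C3_def by (simp add: algebra_simps add_divide_distrib)
    finally show ?thesis by (simp add: divide_right_mono)
  qed
  define g where "g A = avg_time N i j k (wt n A) v" for A
  have g: "g = (\<lambda>A. (\<Sum>z\<in>B. f z A) / real k ^ 4)"
    unfolding avg_time_def f_def B_def g_def by (rule refl)
  have Dg: "cube_diff el g A = (\<Sum>z\<in>B. cube_diff el (f z) A) / real k ^ 4" for el A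
    unfolding g by (rule cube_diff_sum)
  define a1 where "a1 e l = cube_avg S (\<lambda>A. \<bar>cube_diff (e, l) g A\<bar>)" for e l
  have a1_0: "0 \<le> a1 e l" for e l unfolding a1_def by (intro cube_avg_nonneg) simp
  have a1_le: "a1 e l \<le> (\<Sum>z\<in>B. cube_avg S (\<lambda>A. \<bar>cube_diff (e, l) (f z) A\<bar>)) / real k ^ 4" for e l
  proof -
    have "a1 e l \<le> cube_avg S (\<lambda>A. (\<Sum>z\<in>B. \<bar>cube_diff (e, l) (f z) A\<bar>) / real k ^ 4)"
      unfolding a1_def Dg by (intro cube_avg_mono) (simp add: divide_right_mono)
    then show ?thesis by (simp add: cube_avg_divide cube_avg_sum)
  qed
  have a1_sum: "(\<Sum>l<n. a1 e l) \<le> C1 * (\<Sum>z\<in>B. infl z e) / real k ^ 4" if e: "e \<in> F" for e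
  proof -
    have "(\<Sum>l<n. a1 e l) \<le> (\<Sum>l<n. (\<Sum>z\<in>B. cube_avg S (\<lambda>A. \<bar>cube_diff (e, l) (f z) A\<bar>)) / real k ^ 4)"
      by (intro sum_mono a1_le)
    also have "\<dots> = (\<Sum>z\<in>B. \<Sum>l<n. cube_avg S (\<lambda>A. \<bar>cube_diff (e, l) (f z) A\<bar>)) / real k ^ 4"
      by (subst sum.swap) (simp add: sum_divide_distrib)
    also have "\<dots> \<le> (\<Sum>z\<in>B. C1 * infl z e) / real k ^ 4"
      using a[OF _ e, of _ 1] by (intro divide_right_mono sum_mono) auto
    finally show ?thesis by (simp add: sum_distrib_left)
  qed
  have a1_small: "(\<Sum>l<n. a1 e l) \<le> C1 * C3 / real k" if e: "e \<in> F" for e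
  proof -
    have "C1 * (\<Sum>z\<in>B. infl z e) / real k ^ 4 \<le> C1 * (C3 * real k ^ 3) / real k ^ 4"
      using c[OF e] C1 by (intro divide_right_mono mult_left_mono) auto
    also have "\<dots> = C1 * C3 / real k" using k by (simp add: power_numeral_reduce)
    finally show ?thesis using a1_sum[OF e] by simp
  qed
  have avgB: "(\<Sum>e\<in>F. C1 * (\<Sum>z\<in>B. infl z e) / real k ^ 4) \<le> C1 * C2 * (l1_norm v + 1)"
  proof -
    have "(\<Sum>e\<in>F. C1 * (\<Sum>z\<in>B. infl z e) / real k ^ 4) = C1 * (\<Sum>z\<in>B. \<Sum>e\<in>F. infl z e) / real k ^ 4"
      by (subst sum.swap) (simp add: sum_distrib_left sum_divide_distrib)
    also have "\<dots> \<le> C1 * (\<Sum>z\<in>B. C2 * (l1_norm v + 1)) / real k ^ 4"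
      using b C1 by (intro divide_right_mono mult_left_mono sum_mono) auto
    also have "\<dots> = C1 * C2 * (l1_norm v + 1)" using k0 by (simp add: cardB)
    finally show ?thesis .
  qed
  have energy: "(\<Sum>el\<in>S. cube_avg S (\<lambda>A. (cube_diff el g A)\<^sup>2)) \<le> C1 * C2 * (l1_norm v + 1)"
  proof -
    have "(cube_diff el g A)\<^sup>2 \<le> (\<Sum>z\<in>B. (cube_diff el (f z) A)\<^sup>2) / real k ^ 4" for el A
    proof -
      have "(\<Sum>z\<in>B. 1 * cube_diff el (f z) A)\<^sup>2 \<le> (\<Sum>z\<in>B. 1\<^sup>2) * (\<Sum>z\<in>B. (cube_diff el (f z) A)\<^sup>2)"
        by (rule Cauchy_Schwarz_ineq_sum)
      then have "(\<Sum>z\<in>B. cube_diff el (f z) A)\<^sup>2 \<le> real k ^ 4 * (\<Sum>z\<in>B. (cube_diff el (f z) A)\<^sup>2)"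
        by (simp add: cardB)
      then have "(\<Sum>z\<in>B. cube_diff el (f z) A)\<^sup>2 / (real k ^ 4)\<^sup>2 \<le> real k ^ 4 * (\<Sum>z\<in>B. (cube_diff el (f z) A)\<^sup>2) / (real k ^ 4)\<^sup>2"
        by (rule divide_right_mono) simp
      moreover have "c * Y / c\<^sup>2 = Y / c" if "0 < c" for c Y :: real
        using that by (simp add: power2_eq_square)
      ultimately show ?thesis unfolding Dg power_divide using k0 by metis
    qed
    then have "(\<Sum>el\<in>S. cube_avg S (\<lambda>A. (cube_diff el g A)\<^sup>2)) \<le> (\<Sum>el\<in>S. cube_avg S (\<lambda>A. (\<Sum>z\<in>B. (cube_diff el (f z) A)\<^sup>2) / real k ^ 4))"
      by (intro sum_mono cube_avg_mono)
    also have "\<dots> = (\<Sum>e\<in>F. \<Sum>l<n. (\<Sum>z\<in>B. cube_avg S (\<lambda>A. (cube_diff (e, l) (f z) A)\<^sup>2)) / real k ^ 4)"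
      unfolding cube_avg_divide cube_avg_sum S by (simp add: sum.cartesian_product)
    also have "\<dots> = (\<Sum>e\<in>F. (\<Sum>z\<in>B. \<Sum>l<n. cube_avg S (\<lambda>A. (cube_diff (e, l) (f z) A)\<^sup>2)) / real k ^ 4)"
      by (intro sum.cong refl) (subst sum.swap, simp add: sum_divide_distrib)
    also have "\<dots> \<le> (\<Sum>e\<in>F. (\<Sum>z\<in>B. C1 * infl z e) / real k ^ 4)"
      using a[of _ _ 2] by (intro sum_mono divide_right_mono) auto
    also have "\<dots> \<le> C1 * C2 * (l1_norm v + 1)" using avgB by (simp add: sum_distrib_left)
    finally show ?thesis .
  qed
  have influences: "(\<Sum>el\<in>S. (cube_avg S (\<lambda>A. \<bar>cube_diff el g A\<bar>))\<^sup>2) \<le> C1 * C3 / real k * (C1 * C2 * (l1_norm v + 1))"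
  proof -
    have "(\<Sum>el\<in>S. (cube_avg S (\<lambda>A. \<bar>cube_diff el g A\<bar>))\<^sup>2) = (\<Sum>e\<in>F. \<Sum>l<n. (a1 e l)\<^sup>2)"
      unfolding S a1_def by (simp add: sum.cartesian_product)
    also have "\<dots> \<le> (\<Sum>e\<in>F. \<Sum>l<n. (C1 * C3 / real k) * a1 e l)"
    proof (intro sum_mono)
      fix e l assume e: "e \<in> F" and l: "l \<in> {..<n}"
      have "a1 e l \<le> (\<Sum>l<n. a1 e l)" using l by (intro member_le_sum) (auto simp: a1_0)
      then have "a1 e l \<le> C1 * C3 / real k" using a1_small[OF e] by simp
      then show "(a1 e l)\<^sup>2 \<le> (C1 * C3 / real k) * a1 e l"
        unfolding power2_eq_square by (intro mult_right_mono a1_0)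
    qed
    also have "\<dots> = (C1 * C3 / real k) * (\<Sum>e\<in>F. \<Sum>l<n. a1 e l)" by (simp add: sum_distrib_left)
    also have "\<dots> \<le> (C1 * C3 / real k) * (\<Sum>e\<in>F. C1 * (\<Sum>z\<in>B. infl z e) / real k ^ 4)"
      using C1 C3 by (intro mult_left_mono sum_mono a1_sum) auto
    also have "\<dots> \<le> (C1 * C3 / real k) * (C1 * C2 * (l1_norm v + 1))"
      using C1 C3 avgB by (intro mult_left_mono) auto
    finally show ?thesis .
  qed
  have "ln (real k) * (cube_avg S (\<lambda>A. (g A)\<^sup>2) - (cube_avg S g)\<^sup>2) \<le>
     (\<Sum>el\<in>S. cube_avg S (\<lambda>A. (cube_diff el g A)\<^sup>2)) + real k * (\<Sum>el\<in>S. (cube_avg S (\<lambda>A. \<bar>cube_diff el g A\<bar>))\<^sup>2)"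
    using finF k by (intro cube_Falik_Samorodnitsky) (auto simp: S)
  also have "\<dots> \<le> C1 * C2 * (l1_norm v + 1) + real k * (C1 * C3 / real k * (C1 * C2 * (l1_norm v + 1)))"
    using energy influences by (intro add_mono mult_left_mono) auto
  also have "\<dots> = C1 * C2 * (1 + C1 * C3) * (l1_norm v + 1)"
    using k by (simp add: algebra_simps)
  finally show ?thesis unfolding g_def[abs_def] .
qed

text \<open>The constant depends neither on the number of digits nor on the box, the scale or
  \<open>v\<close>; hence both limits can be taken before \<open>k\<close> is chosen in terms of
  \<open>v\<close>.\<close>

lemma avg_time_variance:
  "\<exists>C\<ge>0. \<exists>n0. \<forall>n\<ge>n0. \<forall>i j :: 'd::finite. \<forall>k N. \<forall>v. i \<noteq> j \<longrightarrow> 2 \<le> k \<longrightarrow> v \<in> lattice_box (int N) \<longrightarrow>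
    ln (real k) * (cube_avg (avg_edges N i j k \<times> {..<n}) (\<lambda>A. (avg_time N i j k (wt n A) v)\<^sup>2)
        - (cube_avg (avg_edges N i j k \<times> {..<n}) (\<lambda>A. avg_time N i j k (wt n A) v))\<^sup>2)
    \<le> C * (l1_norm v + 1)"
proof -
  have "0 < 1 / (2 * real (lattice_degree TYPE('d)))" by (simp add: lattice_degree_def)
  from exp_moment_small[OF this] obtain \<kappa> n0 where \<kappa>: "0 \<le> \<kappa>"
    "\<And>n. n0 \<le> n \<Longrightarrow> (\<Sum>k<2 ^ n. exp (ln (3 / 2) * (1 + real (lead_zeros n k)) - \<kappa> * q n k)) \<le> 1 / (2 * real (lattice_degree TYPE('d))) * 2 ^ n"
    by blast
  define C1 where "C1 = 2 * (2 + T (1 / 2))\<^sup>2 + 4 * (m8 + 102)"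
  define C2 where "C2 = (\<kappa> * (1 + m8) + ln 3) / ln (3 / 2)"
  define C3 where "C3 = (\<kappa> * (1 + 4 * 3 ^ 8 * m8) + 9) / ln (3 / 2)"
  have "0 \<le> C1 * C2 * (1 + C1 * C3)" unfolding C1_def C2_def C3_def using m8_nonneg \<kappa>(1)
    by (intro mult_nonneg_nonneg add_nonneg_nonneg divide_nonneg_nonneg) auto
  then show ?thesis
    using avg_time_variance_at[OF \<kappa>(1) \<kappa>(2), folded C1_def C2_def C3_def]
    by (intro exI[of _ "C1 * C2 * (1 + C1 * C3)"] conjI exI[of _ "Suc n0"]) auto
qed

end

section \<open>Nearly gamma laws\<close>

lemma measure_std_normal:
  assumes "A \<in> sets borel"
  shows "measure (density lborel std_normal_density) A = (LBINT u. indicator A u * std_normal_density u)"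
proof -
  have "measure (density lborel std_normal_density) A = (\<integral>u. indicator A u \<partial>density lborel std_normal_density)"
    using assms by simp
  also have "\<dots> = (LBINT u. std_normal_density u *\<^sub>R indicator A u)"
    using assms by (intro integral_density) auto
  finally show ?thesis by (simp add: mult.commute)
qed

lemma std_normal_cdf_eq: "std_normal_cdf x = cdf (density lborel std_normal_density) x"
proof -
  have "measure (density lborel std_normal_density) {..x} = (LBINT u. indicator {..x} u * std_normal_density u)"
    by (rule measure_std_normal) simp
  then show ?thesis by (simp add: std_normal_cdf_def cdf_def set_lebesgue_integral_def)
qed

interpretation gauss: real_distribution "density lborel std_normal_density"
  by (intro real_distribution.intro prob_space_normal_density real_distribution_axioms.intro) auto

lemma std_normal_cdf_surj:
  assumes "0 < p" "p < 1"
  shows "\<exists>z. std_normal_cdf z = p"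
proof -
  have cont: "isCont std_normal_cdf z" for z
  proof -
    have "measure (density lborel std_normal_density) {z} = 0"
      by (simp add: measure_def emeasure_density nn_integral_cmult_indicator)
    then show ?thesis unfolding std_normal_cdf_eq[abs_def] gauss.isCont_cdf[symmetric] .
  qed
  have "\<forall>\<^sub>F z in at_bot. std_normal_cdf z < p" "\<forall>\<^sub>F z in at_top. p < std_normal_cdf z"
    unfolding std_normal_cdf_eq using assms
    by (auto intro: order_tendstoD gauss.cdf_lim_at_bot gauss.cdf_lim_at_top_prob)
  then obtain a b where ab: "std_normal_cdf a < p" "p < std_normal_cdf b"
    unfolding eventually_at_bot_linorder eventually_at_top_linorder by blast
  have "a \<le> b"
  proof (rule ccontr)
    assume "\<not> a \<le> b"
    then have "std_normal_cdf b \<le> std_normal_cdf a"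
      unfolding std_normal_cdf_eq by (intro gauss.cdf_nondecreasing) auto
    then show False using ab by simp
  qed
  then show ?thesis using IVT[of std_normal_cdf a p b] ab cont by auto
qed

text \<open>Ensures that \<open>H\<close> takes values above \<open>std_normal_cdf 0\<close>, the
  range in which the Gaussian tail bound is applied.\<close>

lemma std_normal_cdf_0_less_1: "std_normal_cdf 0 < 1"
proof -
  let ?G = "density lborel std_normal_density"
  have "measure ?G {..0} + measure ?G {0<..1} = measure ?G ({..0} \<union> {0<..1})"
    by (rule gauss.finite_measure_Union[symmetric]) auto
  also have "\<dots> \<le> 1" by (rule gauss.prob_le_1)
  finally have le: "std_normal_cdf 0 + measure ?G {0<..1} \<le> 1" unfolding std_normal_cdf_eq cdf_def .
  have "measure ?G {0<..1} \<noteq> 0"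
  proof
    assume "measure ?G {0<..1} = 0"
    then have "emeasure ?G {0<..1} = 0" by (simp add: gauss.emeasure_eq_measure)
    then have "{0<..1} \<in> null_sets ?G" by (auto simp: null_sets_def)
    then have "AE x in lborel. x \<in> {0<..1::real} \<longrightarrow> std_normal_density x \<le> 0"
      by (subst (asm) null_sets_density_iff) auto
    then have "AE x in lborel. x \<notin> {0<..1::real}"
      by (rule AE_mp) (use normal_density_pos[of 1 0] in \<open>auto intro!: AE_I2 simp: not_le[symmetric]\<close>)
    then have "emeasure lborel {x \<in> space lborel. \<not> (x \<notin> {0<..1::real})} = 0"
      by (subst (asm) AE_iff_measurable[OF _ refl]) auto
    moreover have "{x \<in> space lborel. \<not> (x \<notin> {0<..1::real})} = {0<..1}" by auto
    ultimately show False by (simp only:) simp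
  qed
  then show ?thesis using le measure_nonneg[of ?G "{0<..1}"] by linarith
qed

text \<open>For \<open>s > 0\<close> the cross term in \<open>(z + s)^2\<close> is nonnegative, so
  the density at \<open>z + s\<close> is at most \<open>sqrt (2 * pi)\<close> times the product of
  the densities at \<open>z\<close> and at \<open>s\<close>. Integrate over
  \<open>s\<close>.\<close>

lemma std_normal_mills:
  assumes "0 \<le> z"
  shows "1 - std_normal_cdf z \<le> sqrt (2 * pi) * std_normal_density z"
proof -
  let ?G = "density lborel std_normal_density"
  have "1 - std_normal_cdf z = measure ?G (space ?G - {..z})"
    unfolding std_normal_cdf_eq cdf_def by (subst gauss.prob_compl) auto
  also have "space ?G - {..z} = {z<..}" by auto
  also have "measure ?G {z<..} = (LBINT u. indicator {z<..} u * std_normal_density u)"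
    by (rule measure_std_normal) simp
  also have "\<dots> = (LBINT s. indicator {z<..} (z + 1 * s) * std_normal_density (z + 1 * s))"
    by (subst lborel_integral_real_affine[where c = 1 and t = z]) auto
  also have "\<dots> \<le> (LBINT s. sqrt (2 * pi) * std_normal_density z * std_normal_density s)"
  proof (rule integral_mono')
    fix s :: real
    show "indicator {z<..} (z + 1 * s) * std_normal_density (z + 1 * s) \<le> sqrt (2 * pi) * std_normal_density z * std_normal_density s"
    proof (cases "0 < s")
      case True
      have "std_normal_density (z + s) \<le> sqrt (2 * pi) * std_normal_density z * std_normal_density s"
      proof -
        have "exp (- (z + s)\<^sup>2 / 2) \<le> exp (- z\<^sup>2 / 2) * exp (- s\<^sup>2 / 2)"
          using assms True by (simp add: power2_sum field_simps flip: exp_add)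
        then show ?thesis by (simp add: std_normal_density_def field_simps)
      qed
      then show ?thesis using True by simp
    qed (simp add: std_normal_density_def)
  qed (auto simp: integrable_normal_density)
  also have "\<dots> = sqrt (2 * pi) * std_normal_density z"
    using integral_normal_density[of 1 0] by simp
  finally show ?thesis .
qed

text \<open>Bounds the numerator of \<open>ng_psi\<close> from below by the tail
  \<open>1 - H\<close>, so that an upper bound on \<open>ng_psi\<close> becomes information on the
  tail.\<close>

lemma gauss_profile_ge:
  assumes "std_normal_cdf 0 < p" "p < 1"
  shows "1 - p \<le> sqrt (2 * pi) * gauss_profile p"
proof -
  have "0 \<le> std_normal_cdf 0" unfolding std_normal_cdf_eq by (rule gauss.cdf_nonneg)
  then have p: "0 < p" using assms by simp
  \<comment> \<open>\<open>inv\<close> picks some preimage of \<open>p\<close>; monotonicity and the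
    assumption on \<open>p\<close> force it to be nonnegative.\<close>
  define z where "z = inv std_normal_cdf p"
  have z: "std_normal_cdf z = p"
    unfolding z_def inv_def using std_normal_cdf_surj[OF p assms(2)] by (rule someI_ex)
  have "0 \<le> z"
  proof (rule ccontr)
    assume "\<not> 0 \<le> z"
    then have "std_normal_cdf z \<le> std_normal_cdf 0"
      unfolding std_normal_cdf_eq by (intro gauss.cdf_nondecreasing) auto
    then show False using z assms by simp
  qed
  then show ?thesis using std_normal_mills[of z] z p assms by (simp add: gauss_profile_def z_def)
qed

lemma summable_power_geometric:
  fixes \<rho> :: real
  assumes "0 \<le> \<rho>" "\<rho> < 1"
  shows "summable (\<lambda>j. (real j + 1) ^ m * \<rho> ^ j)"
proof -
  have "(\<lambda>j. ((real j + 2) / (real j + 1)) ^ m * \<rho>) \<longlonglongrightarrow> 1 ^ m * \<rho>"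
    by (intro tendsto_intros) real_asymp
  then have "\<forall>\<^sub>F j in sequentially. ((real j + 2) / (real j + 1)) ^ m * \<rho> < (1 + \<rho>) / 2"
    using assms by (intro order_tendstoD(2)) auto
  then obtain N where N: "\<And>j. N \<le> j \<Longrightarrow> ((real j + 2) / (real j + 1)) ^ m * \<rho> < (1 + \<rho>) / 2"
    unfolding eventually_sequentially by blast
  show ?thesis
  proof (rule summable_ratio_test[where c = "(1 + \<rho>) / 2" and N = N])
    fix j assume "N \<le> j"
    have "(real (Suc j) + 1) ^ m * \<rho> ^ Suc j = (((real j + 2) / (real j + 1)) ^ m * \<rho>) * ((real j + 1) ^ m * \<rho> ^ j)"
      by (simp add: power_divide field_simps)
    also have "\<dots> \<le> (1 + \<rho>) / 2 * ((real j + 1) ^ m * \<rho> ^ j)"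
      using N[OF \<open>N \<le> j\<close>] assms by (intro mult_right_mono) auto
    finally show "norm ((real (Suc j) + 1) ^ m * \<rho> ^ Suc j) \<le> (1 + \<rho>) / 2 * norm ((real j + 1) ^ m * \<rho> ^ j)"
      using assms by simp
  qed (use assms in auto)
qed

section \<open>Distribution and quantile functions of a nearly gamma law\<close>

locale nearly_gamma_law =
  fixes \<nu> :: "real measure"
  assumes nearly_gamma: "nearly_gamma \<nu>"
begin

sublocale prob_space \<nu>
  using nearly_gamma by (simp add: nearly_gamma_def)

lemma density_ex: "\<exists>h. h \<in> borel_measurable (restrict_space lborel {0..}) \<and> (\<forall>t\<ge>0. 0 \<le> h t) \<and>
   \<nu> = density (restrict_space lborel {0..}) (\<lambda>t. ennreal (h t)) \<and>
   is_interval (dens_support h) \<and> (\<exists>A>0. \<forall>y\<in>dens_support h. ng_psi h y \<le> A * sqrt y)"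
  using nearly_gamma unfolding nearly_gamma_def by blast

lemma space_nu: "space \<nu> = {0..}" and sets_nu: "sets \<nu> = sets (restrict_space borel {0..})"
proof -
  obtain h where "\<nu> = density (restrict_space lborel {0..}) (\<lambda>t. ennreal (h t))" using density_ex by blast
  then have "space \<nu> = space (restrict_space lborel {0..} :: real measure)" "sets \<nu> = sets (restrict_space lborel {0..} :: real measure)"
    by (simp_all only: space_density sets_density)
  then show "space \<nu> = {0..}" "sets \<nu> = sets (restrict_space borel {0..})"
    by (simp_all add: space_restrict_space sets_restrict_space)
qed

lemma measurable_nu: "f \<in> borel_measurable borel \<Longrightarrow> f \<in> borel_measurable \<nu>"
  unfolding measurable_cong_sets[OF sets_nu refl] by (rule measurable_restrict_space1)

lemma sets_nuI: "A \<in> sets borel \<Longrightarrow> A \<subseteq> {0..} \<Longrightarrow> A \<in> sets \<nu>"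
  by (auto simp: sets_nu sets_restrict_space_iff Int_absorb1)

definition H :: "real \<Rightarrow> real" where "H y = measure \<nu> {0..y}"

lemma emeasure_nu:
  assumes h: "h \<in> borel_measurable (restrict_space lborel {0..})"
    and nu: "\<nu> = density (restrict_space lborel {0..}) (\<lambda>t. ennreal (h t))"
    and A: "A \<in> sets borel" "A \<subseteq> {0..}"
  shows "emeasure \<nu> A = (\<integral>\<^sup>+t. ennreal (h t) * indicator A t \<partial>lborel)"
proof -
  have "A \<in> sets (restrict_space lborel {0..})"
    using A by (auto simp: sets_restrict_space_iff)
  moreover have "(\<lambda>t. ennreal (h t)) \<in> borel_measurable (restrict_space lborel {0..})"
    using h by (rule measurable_compose) (rule measurable_ennreal)
  ultimately have "emeasure (density (restrict_space lborel {0..}) (\<lambda>t. ennreal (h t))) A = (\<integral>\<^sup>+t. ennreal (h t) * indicator A t \<partial>restrict_space lborel {0..})"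
    by (rule emeasure_density[rotated])
  also have "\<dots> = (\<integral>\<^sup>+t. ennreal (h t) * indicator A t * indicator {0..} t \<partial>lborel)"
    by (rule nn_integral_restrict_space) simp
  also have "\<dots> = (\<integral>\<^sup>+t. ennreal (h t) * indicator A t \<partial>lborel)"
    using A(2) by (intro nn_integral_cong) (auto split: split_indicator)
  finally show ?thesis by (simp only: nu[symmetric])
qed

lemma no_atom: "measure \<nu> {y} = 0"
proof (cases "y \<ge> 0")
  case True
  obtain h where h: "h \<in> borel_measurable (restrict_space lborel {0..})"
    "\<nu> = density (restrict_space lborel {0..}) (\<lambda>t. ennreal (h t))" using density_ex by blast
  have "emeasure \<nu> {y} = (\<integral>\<^sup>+t. ennreal (h t) * indicator {y} t \<partial>lborel)"
    using True by (intro emeasure_nu[OF h]) auto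
  also have "\<dots> = (\<integral>\<^sup>+t. 0 \<partial>(lborel :: real measure))"
  proof (rule nn_integral_cong_AE)
    show "AE t in lborel. ennreal (h t) * indicator {y} t = 0"
      using AE_lborel_singleton[of y] by eventually_elim simp
  qed
  finally show ?thesis by (simp add: measure_def)
next
  case False
  then have "{y} \<notin> sets \<nu>" using sets.sets_into_space[of "{y}" \<nu>] by (auto simp: space_nu)
  then show ?thesis by (simp add: measure_notin_sets)
qed

text \<open>The same law carried to the whole real line, where the theory of distribution functions
  applies; \<open>\<nu>\<close> itself has space \<open>{0..}\<close>.\<close>

definition \<nu>r :: "real measure" where "\<nu>r = distr \<nu> borel (\<lambda>x. x)"

sublocale R: real_distribution \<nu>r
  unfolding \<nu>r_def by (intro real_distribution_distr measurable_nu) simp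

lemma measure_\<nu>r: "A \<in> sets borel \<Longrightarrow> measure \<nu>r A = measure \<nu> (A \<inter> {0..})"
  unfolding \<nu>r_def by (subst measure_distr) (auto simp: space_nu intro!: measurable_nu)

lemma H_cdf: "H = cdf \<nu>r"
proof
  fix y :: real
  have "{..y} \<inter> {0..} = {0..y}" by auto
  then show "H y = cdf \<nu>r y" by (simp add: H_def cdf_def measure_\<nu>r)
qed

lemma H_mono: "x \<le> y \<Longrightarrow> H x \<le> H y"
  unfolding H_cdf by (rule R.cdf_nondecreasing)

lemma H_nonneg: "0 \<le> H y" and H_le_1: "H y \<le> 1"
  by (simp_all add: H_def)

lemma H_cont: "isCont H y"
proof -
  have "measure \<nu>r {y} = 0"
    using no_atom[of y] by (subst measure_\<nu>r) (auto simp: Int_insert_left)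
  then show ?thesis unfolding H_cdf R.isCont_cdf .
qed

lemma H_0: "H 0 = 0"
  using no_atom[of 0] by (simp add: H_def)

lemma H_lim: "(H \<longlongrightarrow> 1) at_top"
  unfolding H_cdf by (rule R.cdf_lim_at_top_prob)

definition T :: "real \<Rightarrow> real" where "T u = Inf {y. 0 \<le> y \<and> u \<le> H y}"

lemma H_exceeds: "u < 1 \<Longrightarrow> \<exists>b\<ge>0. u < H b"
proof -
  assume "u < 1"
  then have "\<forall>\<^sub>F y in at_top. u < H y" using H_lim by (rule order_tendstoD(1)[rotated])
  then obtain N where "\<And>y. N \<le> y \<Longrightarrow> u < H y" unfolding eventually_at_top_linorder by blast
  from this[of "max N 0"] show ?thesis by (intro exI[of _ "max N 0"] conjI) simp_all
qed

text \<open>Continuity of \<open>H\<close> makes the set in the definition of \<open>T\<close>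
  closed, so it contains its infimum. This adjunction between \<open>T\<close> and \<open>H\<close>
  replaces direct work with infima in most of what follows.\<close>

lemma T_le_iff:
  assumes "u < 1" "0 \<le> y"
  shows "T u \<le> y \<longleftrightarrow> u \<le> H y"
proof -
  let ?A = "{y. 0 \<le> y \<and> u \<le> H y}"
  obtain b where "0 \<le> b" "u < H b" using H_exceeds[OF assms(1)] by blast
  then have "b \<in> ?A" by simp
  then have ne: "?A \<noteq> {}" by (rule ex_in_conv[THEN iffD1, OF exI])
  have bdd: "bdd_below ?A" by (rule bdd_belowI[of _ 0]) simp
  have "closed ?A"
  proof -
    have eq: "?A = {0..} \<inter> H -` {u..}" by auto
    have "closed (H -` {u..})"
      using H_cont by (intro closed_vimage continuous_at_imp_continuous_on closed_atLeast ballI)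
    then show ?thesis unfolding eq by (rule closed_Int[OF closed_atLeast])
  qed
  then have "Inf ?A \<in> ?A" by (rule closed_contains_Inf[OF ne bdd])
  then have "u \<le> H (T u)" unfolding T_def mem_Collect_eq by (rule conjunct2)
  show ?thesis
  proof
    assume "T u \<le> y"
    then have "H (T u) \<le> H y" by (rule H_mono)
    then show "u \<le> H y" using \<open>u \<le> H (T u)\<close> by simp
  next
    assume "u \<le> H y"
    then show "T u \<le> y" unfolding T_def using assms(2) by (intro cInf_lower bdd) simp
  qed
qed

lemma T_nonneg: "0 \<le> u \<Longrightarrow> u < 1 \<Longrightarrow> 0 \<le> T u"
proof -
  assume u: "0 \<le> u" "u < 1"
  show ?thesis
  proof (rule ccontr)
    assume "\<not> 0 \<le> T u"
    moreover obtain b where "0 \<le> b" "u < H b" using H_exceeds[OF u(2)] by blast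
    then have "0 \<le> T u" unfolding T_def by (intro cInf_greatest) (auto intro: less_imp_le)
    ultimately show False by simp
  qed
qed

lemma T_pos: "0 < u \<Longrightarrow> u < 1 \<Longrightarrow> 0 < T u"
  using T_le_iff[of u 0] H_0 by simp

lemma T_mono: "0 \<le> a \<Longrightarrow> a \<le> b \<Longrightarrow> b < 1 \<Longrightarrow> T a \<le> T b"
proof -
  assume ab: "0 \<le> a" "a \<le> b" "b < 1"
  have "b \<le> H (T b)" using T_le_iff[of b "T b"] T_nonneg[of b] ab by simp
  then show ?thesis using T_le_iff[of a "T b"] T_nonneg[of b] ab by simp
qed

text \<open>To the left of \<open>T u\<close> the function \<open>H\<close> stays at most
  \<open>u\<close>, and without atoms it cannot jump above \<open>u\<close> at
  \<open>T u\<close>.\<close>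

lemma H_T: "0 \<le> u \<Longrightarrow> u < 1 \<Longrightarrow> H (T u) = u"
proof -
  assume u: "0 \<le> u" "u < 1"
  have ge: "u \<le> H (T u)" using T_le_iff[of u "T u"] T_nonneg[OF u] u by simp
  show ?thesis
  proof (cases "T u = 0")
    case True
    then show ?thesis using ge H_0 u by simp
  next
    case False
    then have pos: "0 < T u" using T_nonneg[OF u] by simp
    have "(H \<longlongrightarrow> H (T u)) (at_left (T u))"
      using H_cont[of "T u"] by (auto simp: continuous_at intro: tendsto_mono[OF at_le])
    moreover have "\<forall>\<^sub>F y in at_left (T u). H y \<le> u"
      using eventually_at_left_real[OF pos]
    proof eventually_elim
      case (elim y)
      then show ?case using T_le_iff[of u y] u by auto
    qed
    ultimately have "H (T u) \<le> u" by (intro tendsto_upperbound) auto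
    then show ?thesis using ge by simp
  qed
qed

section \<open>Binary digits of a passage time\<close>

lemma H_measurable: "H \<in> borel_measurable borel"
  using H_mono by (intro borel_measurable_mono) (auto simp: mono_def)

lemma sets_H_less [measurable]: "{x \<in> space \<nu>. H x < u} \<in> sets \<nu>"
proof -
  have "H \<in> borel_measurable \<nu>" by (intro measurable_nu H_measurable)
  then show ?thesis by measurable
qed

text \<open>The probability integral transform: \<open>{H < u}\<close> is the interval
  \<open>{0..<T u}\<close>. The case \<open>u = 1\<close>, where \<open>T\<close> may be an infimum
  over the empty set, follows by approximation from below.\<close>

lemma measure_H_less:
  assumes "0 \<le> u" "u \<le> 1"
  shows "measure \<nu> {x \<in> space \<nu>. H x < u} = u"
proof -
  have less: "measure \<nu> {x \<in> space \<nu>. H x < u} = u" if u: "0 \<le> u" "u < 1" for u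
  proof -
    have "{x \<in> space \<nu>. H x < u} = {0..<T u}"
      using T_le_iff[OF u(2)] by (auto simp: space_nu not_le[symmetric])
    moreover have "measure \<nu> {0..T u} = measure \<nu> {0..<T u} + measure \<nu> {T u}"
    proof -
      have "{0..T u} = {0..<T u} \<union> {T u}" using T_nonneg[OF u] by auto
      then show ?thesis using T_nonneg[OF u]
        by (simp only:) (rule finite_measure_Union, auto intro!: sets_nuI)
    qed
    ultimately show ?thesis using H_T[OF u] no_atom[of "T u"] by (simp add: H_def)
  qed
  show ?thesis
  proof (cases "u < 1")
    case False
    then have u: "u = 1" using assms by simp
    have "w \<le> measure \<nu> {x \<in> space \<nu>. H x < 1}" if "0 < w" "w < 1" for w
    proof -
      have "w = measure \<nu> {x \<in> space \<nu>. H x < w}" using less[of w] that by simp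
      also have "\<dots> \<le> measure \<nu> {x \<in> space \<nu>. H x < 1}"
        using that by (intro finite_measure_mono) auto
      finally show ?thesis .
    qed
    then have "1 \<le> measure \<nu> {x \<in> space \<nu>. H x < 1}" by (intro dense_le_bounded[of 0 1]) auto
    then show ?thesis using u prob_le_1[of "{x \<in> space \<nu>. H x < 1}"] by simp
  qed (use less assms in auto)
qed

lemma AE_H_less_1: "AE x in \<nu>. H x < 1"
  using prob_eq_1[of "{x \<in> space \<nu>. H x < 1}"] measure_H_less[of 1] by simp

lemma AE_H_neq: "AE x in \<nu>. H x \<noteq> c"
proof (cases "0 \<le> c \<and> c < 1")
  case True
  have "measure \<nu> {x \<in> space \<nu>. H x = c} \<le> 0"
  proof (rule field_le_epsilon)
    fix e :: real assume e: "0 < e"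
    define u where "u = min (c + e) 1"
    have u: "c < u" "u \<le> c + e" "u \<le> 1" "0 \<le> u" using True e by (auto simp: u_def)
    have "measure \<nu> {x \<in> space \<nu>. H x = c} \<le> measure \<nu> ({x \<in> space \<nu>. H x < u} - {x \<in> space \<nu>. H x < c})"
      using u by (intro finite_measure_mono) auto
    also have "\<dots> = u - c"
      using u True by (subst finite_measure_Diff) (auto simp: measure_H_less)
    finally show "measure \<nu> {x \<in> space \<nu>. H x = c} \<le> 0 + e" using u by simp
  qed
  moreover have "H \<in> borel_measurable \<nu>" by (intro measurable_nu H_measurable)
  then have m: "{x \<in> space \<nu>. H x = c} \<in> sets \<nu>" by measurable
  ultimately have "measure \<nu> {x \<in> space \<nu>. H x = c} = 0"
    using measure_nonneg[of \<nu> "{x \<in> space \<nu>. H x = c}"] by linarith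
  then have "emeasure \<nu> {x \<in> space \<nu>. H x = c} = 0" by (simp add: emeasure_eq_measure)
  then show ?thesis using m by (intro AE_I[of _ _ "{x \<in> space \<nu>. H x = c}"]) auto
next
  case False
  show ?thesis using AE_H_less_1
  proof eventually_elim
    case (elim x)
    then show ?case using False H_nonneg[of x] by auto
  qed
qed

text \<open>The first \<open>n\<close> binary digits of \<open>H x\<close>, read as a number. On the
  null set where \<open>H x = 1\<close> the floor would be \<open>2 ^ n\<close>; the value 0 there
  keeps every code below \<open>2 ^ n\<close>.\<close>

definition code :: "nat \<Rightarrow> real \<Rightarrow> nat" where "code n x = (if H x < 1 then nat \<lfloor>2 ^ n * H x\<rfloor> else 0)"

lemma code_eq_iff:
  assumes "H x < 1"
  shows "code n x = k \<longleftrightarrow> real k / 2 ^ n \<le> H x \<and> H x < (real k + 1) / 2 ^ n"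
proof -
  have "code n x = k \<longleftrightarrow> \<lfloor>2 ^ n * H x\<rfloor> = int k"
    unfolding code_def using H_nonneg[of x] assms by (auto simp: nat_eq_iff)
  also have "\<dots> \<longleftrightarrow> real k \<le> 2 ^ n * H x \<and> 2 ^ n * H x < real k + 1"
    by (simp add: floor_eq_iff)
  finally show ?thesis by (simp add: field_simps)
qed

lemma code_less: "code n x < 2 ^ n"
proof (cases "H x < 1")
  case True
  have "real (code n x) / 2 ^ n \<le> H x" using code_eq_iff[OF True, of n] by blast
  then have "real (code n x) / 2 ^ n < 1" using True by (rule le_less_trans)
  then show ?thesis by simp
qed (simp add: code_def)

lemma code_measurable [measurable]: "code n \<in> measurable \<nu> (count_space UNIV)"
proof -
  have "code n \<in> measurable borel (count_space UNIV)" unfolding code_def[abs_def] using H_measurable by measurable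
  then show ?thesis unfolding measurable_cong_sets[OF sets_nu refl] by (rule measurable_restrict_space1)
qed

lemma measure_code:
  assumes "k < 2 ^ n"
  shows "measure \<nu> {x \<in> space \<nu>. code n x = k} = 1 / 2 ^ n"
proof -
  let ?a = "real k / 2 ^ n" and ?b = "(real k + 1) / 2 ^ n"
  have "real k + 1 \<le> real (2 ^ n)" using assms by (simp only: of_nat_Suc[symmetric] of_nat_le_iff Suc_le_eq add.commute)
  then have ab: "0 \<le> ?a" "?a \<le> ?b" "?b \<le> 1" by (auto simp: divide_right_mono)
  have "measure \<nu> {x \<in> space \<nu>. code n x = k} = measure \<nu> ({x \<in> space \<nu>. H x < ?b} - {x \<in> space \<nu>. H x < ?a})"
  proof (rule finite_measure_eq_AE)
    show "AE x in \<nu>. x \<in> {x \<in> space \<nu>. code n x = k} \<longleftrightarrow> x \<in> {x \<in> space \<nu>. H x < ?b} - {x \<in> space \<nu>. H x < ?a}"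
      using AE_H_less_1 by eventually_elim (auto simp: code_eq_iff)
  qed auto
  also have "\<dots> = measure \<nu> {x \<in> space \<nu>. H x < ?b} - measure \<nu> {x \<in> space \<nu>. H x < ?a}"
    using ab by (intro finite_measure_Diff) auto
  also have "\<dots> = ?b - ?a"
    by (simp only: measure_H_less[OF order_trans[OF ab(1,2)] ab(3)] measure_H_less[OF ab(1) order_trans[OF ab(2,3)]])
  also have "\<dots> = 1 / 2 ^ n" by (simp add: diff_divide_distrib[symmetric])
  finally show ?thesis .
qed

definition approx :: "nat \<Rightarrow> real \<Rightarrow> real" where "approx n x = T (real (code n x) / 2 ^ n)"

text \<open>Cutting off digits rounds \<open>H x\<close> down. The resulting bound by
  \<open>x\<close> yields both domination and moments uniform in \<open>n\<close>.\<close>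

lemma approx_le:
  assumes "H x < 1" "0 \<le> x"
  shows "0 \<le> approx n x" "approx n x \<le> x"
proof -
  have 1: "real (code n x) / 2 ^ n \<le> H x" using code_eq_iff[OF assms(1), of n] by blast
  then have 2: "real (code n x) / 2 ^ n < 1" using assms(1) by (rule le_less_trans)
  show "0 \<le> approx n x" unfolding approx_def by (rule T_nonneg[OF _ 2]) simp
  show "approx n x \<le> x" unfolding approx_def using T_le_iff[OF 2 assms(2)] 1 by simp
qed

text \<open>On a flat piece of \<open>H\<close> the quantile function returns the left end, which is
  what \<open>incr\<close> excludes.\<close>

lemma approx_tendsto:
  assumes "H x < 1" "0 \<le> x" and incr: "\<And>y. y < x \<Longrightarrow> 0 \<le> y \<Longrightarrow> H y < H x"
  shows "(\<lambda>n. approx n x) \<longlonglongrightarrow> x"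
proof (rule order_tendstoI)
  fix a assume "x < a"
  then show "\<forall>\<^sub>F n in sequentially. approx n x < a"
    using approx_le(2)[OF assms(1,2)] by (intro always_eventually allI) (auto intro: le_less_trans)
next
  fix a assume a: "a < x"
  show "\<forall>\<^sub>F n in sequentially. a < approx n x"
  proof (cases "0 \<le> a")
    case True
    have "0 < H x - H a" using incr[OF a True] by simp
    moreover have "(\<lambda>n. (1 / 2 :: real) ^ n) \<longlonglongrightarrow> 0" by (rule LIMSEQ_power_zero) simp
    ultimately have "\<forall>\<^sub>F n in sequentially. (1 / 2 :: real) ^ n < H x - H a" by (intro order_tendstoD(2)) auto
    then show ?thesis
    proof eventually_elim
      case (elim n)
      have c: "real (code n x) / 2 ^ n \<le> H x" "H x < (real (code n x) + 1) / 2 ^ n"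
        using code_eq_iff[OF assms(1), of n] by blast+
      then have "H x < real (code n x) / 2 ^ n + (1 / 2) ^ n" by (simp add: add_divide_distrib power_one_over)
      then have "H a < real (code n x) / 2 ^ n" using elim by simp
      then show "a < approx n x" unfolding approx_def
        using T_le_iff[OF le_less_trans[OF c(1) assms(1)] True] by linarith
    qed
  next
    case False
    then show ?thesis using approx_le(1)[OF assms(1,2)]
      by (intro always_eventually allI) (auto intro: less_le_trans simp: not_le)
  qed
qed

text \<open>If \<open>H y = H x\<close> with \<open>y < x\<close>, then \<open>H\<close> also has
  this value at a rational point in between. The countably many values of \<open>H\<close> at
  rationals are avoided almost surely.\<close>

lemma AE_approx_tendsto: "AE x in \<nu>. H x < 1 \<and> (\<lambda>n. approx n x) \<longlonglongrightarrow> x"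
proof -
  have "AE x in \<nu>. \<forall>r\<in>\<rat>. H x \<noteq> H r"
    using AE_H_neq by (subst AE_ball_countable) (auto simp: countable_rat)
  with AE_H_less_1 show ?thesis using AE_space
  proof eventually_elim
    case (elim x)
    have "H y < H x" if yx: "y < x" for y
    proof -
      obtain r where "y < of_rat r" "of_rat r < x" using of_rat_dense[OF yx] by blast
      then have "H y \<le> H (of_rat r)" "H (of_rat r) \<le> H x" by (auto intro: H_mono)
      moreover have "H x \<noteq> H (of_rat r)" using elim by auto
      ultimately show ?thesis by simp
    qed
    then show ?case using elim by (intro conjI approx_tendsto) (auto simp: space_nu)
  qed
qed

end

section \<open>Tail and eighth moment\<close>

context nearly_gamma_law
begin

text \<open>The bound on \<open>ng_psi\<close> says that the hazard rate \<open>h / (1 - H)\<close>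
  is at least of order \<open>1 / sqrt y\<close>, which integrates to a tail
  \<open>exp (- c * sqrt y)\<close>. Comparing increments of \<open>H\<close> between consecutive
  squares avoids differentiating a logarithm.\<close>

lemma tail_decay: "\<exists>C \<rho>. 0 \<le> \<rho> \<and> \<rho> < 1 \<and> 0 \<le> C \<and> (\<forall>j::nat. 1 - H ((real j)\<^sup>2) \<le> C * \<rho> ^ j)"
proof -
  obtain h A where h: "h \<in> borel_measurable (restrict_space lborel {0..})"
    and h0: "\<And>t. 0 \<le> t \<Longrightarrow> 0 \<le> h t"
    and nu: "\<nu> = density (restrict_space lborel {0..}) (\<lambda>t. ennreal (h t))"
    and int: "is_interval (dens_support h)" and A: "0 < A"
    and psi: "\<And>y. y \<in> dens_support h \<Longrightarrow> ng_psi h y \<le> A * sqrt y"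
    using density_ex by blast
  define K where "K = sqrt (2 * pi) * A"
  have K: "0 < K" using A by (simp add: K_def)
  have cdf_eq: "dens_cdf h y = H y" if y: "0 \<le> y" for y
  proof -
    have m0: "(\<lambda>u. indicator {0..} u *\<^sub>R h u) \<in> borel_measurable lborel"
      using h by (subst (asm) borel_measurable_restrict_space_iff) auto
    then have "(\<lambda>u. indicator {0..y} u *\<^sub>R (indicator {0..} u *\<^sub>R h u)) \<in> borel_measurable lborel"
      by (intro borel_measurable_scaleR[OF _ m0] borel_measurable_indicator) simp
    moreover have "(\<lambda>u. indicator {0..y} u *\<^sub>R (indicator {0..} u *\<^sub>R h u)) = (\<lambda>u. indicator {0..y} u *\<^sub>R h u)"
      by (auto split: split_indicator)
    ultimately have m: "(\<lambda>u. indicator {0..y} u *\<^sub>R h u) \<in> borel_measurable lborel" by simp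
    have "dens_cdf h y = enn2real (\<integral>\<^sup>+u. ennreal (indicator {0..y} u *\<^sub>R h u) \<partial>lborel)"
      unfolding dens_cdf_def set_lebesgue_integral_def
      by (rule integral_eq_nn_integral[OF m]) (auto split: split_indicator intro!: AE_I2 h0)
    also have "(\<integral>\<^sup>+u. ennreal (indicator {0..y} u *\<^sub>R h u) \<partial>lborel) = (\<integral>\<^sup>+u. ennreal (h u) * indicator {0..y} u \<partial>lborel)"
      by (intro nn_integral_cong) (auto split: split_indicator)
    also have "\<dots> = emeasure \<nu> {0..y}" by (rule emeasure_nu[OF h nu, symmetric]) auto
    finally show ?thesis by (simp add: H_def measure_def)
  qed
  have compl: "measure \<nu> {y<..} = 1 - H y" if y: "0 \<le> y" for y
  proof -
    have "measure \<nu> (space \<nu> - {0..y}) = 1 - measure \<nu> {0..y}" by (rule prob_compl) (auto intro: sets_nuI)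
    moreover have "space \<nu> - {0..y} = {y<..}" using y by (auto simp: space_nu)
    ultimately show ?thesis by (simp add: H_def)
  qed
  have hz: "emeasure \<nu> B = 0" if B: "B \<in> sets borel" "B \<subseteq> {0..}" "\<And>t. t \<in> B \<Longrightarrow> \<not> 0 < h t" for B
  proof -
    have "emeasure \<nu> B = (\<integral>\<^sup>+t. ennreal (h t) * indicator B t \<partial>lborel)"
      by (rule emeasure_nu[OF h nu B(1,2)])
    also have "\<dots> = (\<integral>\<^sup>+t. 0 \<partial>(lborel :: real measure))"
      using B(3) by (intro nn_integral_cong) (auto split: split_indicator simp: ennreal_neg not_less)
    finally show ?thesis by simp
  qed
  \<comment> \<open>There is mass on both sides of \<open>y\<close>, so \<open>y\<close> lies in the
    interval where \<open>h\<close> is positive and the bound on \<open>ng_psi\<close> is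
    available.\<close>
  have hazard: "0 < h y \<and> 1 - H y \<le> K * sqrt y * h y" if y: "0 \<le> y" "std_normal_cdf 0 < H y" "H y < 1" for y
  proof -
    have Hy: "0 < H y"
    proof -
      have "0 \<le> std_normal_cdf 0" unfolding std_normal_cdf_eq by (rule gauss.cdf_nonneg)
      then show ?thesis using y by simp
    qed
    have "\<exists>a\<in>{0..y}. 0 < h a"
    proof (rule ccontr)
      assume "\<not> ?thesis"
      then have "emeasure \<nu> {0..y} = 0" by (intro hz) auto
      then show False using Hy by (simp add: H_def measure_def)
    qed
    then obtain a where a: "0 \<le> a" "a \<le> y" "0 < h a" by auto
    have "\<exists>b\<in>{y<..}. 0 < h b"
    proof (rule ccontr)
      assume "\<not> ?thesis"
      then have "emeasure \<nu> {y<..} = 0" using y by (intro hz) auto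
      then show False using y compl[OF y(1)] by (simp add: measure_def)
    qed
    then obtain b where b: "y < b" "0 < h b" by auto
    have "a \<in> dens_support h" "b \<in> dens_support h" using a b y by (auto simp: dens_support_def)
    then have ys: "y \<in> dens_support h"
      using int a(2) b(1) mem_is_interval_1_I[of "dens_support h" a b y] by auto
    then have hy: "0 < h y" by (simp add: dens_support_def)
    have "gauss_profile (H y) \<le> A * sqrt y * h y"
      using psi[OF ys] hy y by (simp add: ng_psi_def cdf_eq pos_divide_le_eq)
    then have "sqrt (2 * pi) * gauss_profile (H y) \<le> sqrt (2 * pi) * (A * sqrt y * h y)"
      by (intro mult_left_mono) auto
    with gauss_profile_ge[OF y(2,3)] have "1 - H y \<le> sqrt (2 * pi) * (A * sqrt y * h y)"
      by (rule order_trans)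
    then show ?thesis using hy unfolding K_def by (simp only: mult.assoc simp_thms)
  qed
  have incr: "(b - a) * ((1 - H b) / (K * sqrt b)) \<le> H b - H a" if ab: "0 \<le> a" "a < b" "std_normal_cdf 0 < H a" for a b
  proof (cases "H b < 1")
    case False
    then have "H b = 1" using H_le_1[of b] by simp
    then show ?thesis using H_le_1[of a] by simp
  next
    case True
    define \<delta> where "\<delta> = (1 - H b) / (K * sqrt b)"
    have \<delta>: "0 \<le> \<delta>" using True K ab by (simp add: \<delta>_def)
    have "ennreal (\<delta> * (b - a)) = (\<integral>\<^sup>+t. ennreal \<delta> * indicator {a<..b} t \<partial>lborel)"
      using ab \<delta> by (simp add: nn_integral_cmult_indicator ennreal_mult')
    also have "\<dots> \<le> (\<integral>\<^sup>+t. ennreal (h t) * indicator {a<..b} t \<partial>lborel)"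
    proof (intro nn_integral_mono)
      fix t
      show "ennreal \<delta> * indicator {a<..b} t \<le> ennreal (h t) * indicator {a<..b} t"
      proof (cases "t \<in> {a<..b}")
        case t: True
        then have Ht: "H a \<le> H t" "H t \<le> H b" by (auto intro: H_mono)
        then have hz: "0 < h t" "1 - H t \<le> K * sqrt t * h t" using hazard[of t] t ab True by auto
        have "1 - H b \<le> K * sqrt t * h t" using hz Ht by simp
        also have "\<dots> \<le> K * sqrt b * h t" using t hz K by (intro mult_right_mono mult_left_mono) auto
        finally have "\<delta> \<le> h t" unfolding \<delta>_def using K ab by (simp add: pos_divide_le_eq mult_ac)
        then show ?thesis using t by (simp add: ennreal_leI)
      qed simp
    qed
    also have "\<dots> = emeasure \<nu> {a<..b}"
      using ab by (intro emeasure_nu[OF h nu, symmetric]) auto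
    also have "\<dots> = ennreal (H b - H a)"
    proof -
      have "{0..b} = {0..a} \<union> {a<..b}" using ab by auto
      then have "measure \<nu> {0..b} = measure \<nu> {0..a} + measure \<nu> {a<..b}"
        using ab by (simp only:) (rule finite_measure_Union, auto intro!: sets_nuI)
      then show ?thesis by (simp add: H_def emeasure_eq_measure)
    qed
    finally have "\<delta> * (b - a) \<le> H b - H a"
      using H_mono[of a b] ab by (simp add: ennreal_le_iff)
    then show ?thesis by (simp add: \<delta>_def mult.commute)
  qed
  obtain y0 where y0: "0 \<le> y0" "std_normal_cdf 0 < H y0" using H_exceeds[OF std_normal_cdf_0_less_1] by blast
  obtain j0 :: nat where "sqrt y0 < real j0" using reals_Archimedean2 by blast
  then have j0: "y0 \<le> (real j0)\<^sup>2" using y0 by (simp add: sqrt_le_D)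
  \<comment> \<open>With \<open>a = j^2\<close> and \<open>b = (j + 1)^2\<close> one has
    \<open>(b - a) / sqrt b = (2 * j + 1) / (j + 1) >= 1\<close>, hence
    \<open>(1 - H b) * (1 + 1 / K) <= 1 - H a\<close>.\<close>
  define \<rho> where "\<rho> = 1 / (1 + 1 / K)"
  have \<rho>: "0 < \<rho>" "\<rho> < 1" using K by (auto simp: \<rho>_def divide_less_eq add_pos_pos)
  have step: "1 - H ((real (Suc j))\<^sup>2) \<le> \<rho> * (1 - H ((real j)\<^sup>2))" if j: "j0 \<le> j" for j
  proof -
    let ?a = "(real j)\<^sup>2" and ?b = "(real (Suc j))\<^sup>2"
    have "(real j0)\<^sup>2 \<le> ?a" using j by (intro power_mono) auto
    then have "H y0 \<le> H ?a" using j0 by (intro H_mono) linarith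
    then have Ha: "std_normal_cdf 0 < H ?a" using y0 by simp
    have lt: "?a < ?b" by (intro power_strict_mono) auto
    have "(1 - H ?b) / K \<le> (?b - ?a) * ((1 - H ?b) / (K * sqrt ?b))"
    proof -
      have s: "sqrt ?b = real j + 1" by simp
      have d: "?b - ?a = 2 * real j + 1" by (simp add: power2_eq_square algebra_simps)
      have "1 \<le> (?b - ?a) / sqrt ?b" unfolding s d by (simp add: field_simps)
      then have "(1 - H ?b) / K * 1 \<le> (1 - H ?b) / K * ((?b - ?a) / sqrt ?b)"
        using K H_le_1[of ?b] by (intro mult_left_mono) auto
      then show ?thesis by (simp add: mult_ac)
    qed
    also have "\<dots> \<le> H ?b - H ?a" by (rule incr[OF _ lt Ha]) simp
    finally have "(1 - H ?b) / K \<le> H ?b - H ?a" .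
    moreover have "(1 - H ?b) * (1 + 1 / K) = (1 - H ?b) + (1 - H ?b) / K"
      by (simp only: distrib_left mult_1_right times_divide_eq_right)
    ultimately have "(1 - H ?b) * (1 + 1 / K) \<le> 1 - H ?a" by linarith
    then show ?thesis using K unfolding \<rho>_def
      by (simp add: pos_le_divide_eq add_pos_pos)
  qed
  have tail: "1 - H ((real (j0 + i))\<^sup>2) \<le> \<rho> ^ i" for i
  proof (induction i)
    case 0
    then show ?case using H_nonneg by simp
  next
    case (Suc i)
    have "1 - H ((real (Suc (j0 + i)))\<^sup>2) \<le> \<rho> * (1 - H ((real (j0 + i))\<^sup>2))" by (rule step) simp
    also have "\<dots> \<le> \<rho> * \<rho> ^ i" using Suc \<rho> by (intro mult_left_mono) auto
    finally show ?case by simp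
  qed
  \<comment> \<open>The factor \<open>(1 / \<rho>) ^ j0\<close> makes the bound trivial for the
    indices below \<open>j0\<close>.\<close>
  have "1 - H ((real j)\<^sup>2) \<le> (1 / \<rho>) ^ j0 * \<rho> ^ j" for j
  proof (cases "j0 \<le> j")
    case True
    then obtain i where i: "j = j0 + i" using le_Suc_ex by blast
    have "(1 / \<rho>) ^ j0 * \<rho> ^ j = \<rho> ^ i" using \<rho> by (simp add: i power_add power_divide)
    then show ?thesis using tail[of i] i by simp
  next
    case False
    have "\<rho> ^ j0 \<le> \<rho> ^ j" using False \<rho> by (intro power_decreasing) auto
    then have "1 \<le> (1 / \<rho>) ^ j0 * \<rho> ^ j" using \<rho> by (simp add: power_divide pos_le_divide_eq)
    then show ?thesis using H_nonneg[of "(real j)\<^sup>2"] by simp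
  qed
  then show ?thesis using \<rho> by (intro exI[of _ "(1 / \<rho>) ^ j0"] exI[of _ \<rho>]) auto
qed

lemma integrable_power8: "integrable \<nu> (\<lambda>x. x ^ 8)"
proof -
  obtain C \<rho> where C: "0 \<le> \<rho>" "\<rho> < 1" "0 \<le> C" "\<And>j::nat. 1 - H ((real j)\<^sup>2) \<le> C * \<rho> ^ j"
    using tail_decay by blast
  \<comment> \<open>If \<open>j < sqrt x <= j + 1\<close>, then \<open>x\<close> lies in
    \<open>E j\<close> and \<open>x^8 <= (j + 1)^16\<close>, while the measure of \<open>E j\<close>
    decays geometrically.\<close>
  define E where "E j = {x \<in> space \<nu>. (real j)\<^sup>2 < x}" for j :: nat
  have E_eq: "E j = space \<nu> - {0..(real j)\<^sup>2}" for j
    unfolding E_def space_nu by auto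
  have E: "E j \<in> sets \<nu>" for j
    unfolding E_eq by (intro sets.compl_sets sets_nuI) auto
  have mE: "measure \<nu> (E j) \<le> C * \<rho> ^ j" for j
  proof -
    have "measure \<nu> (E j) = 1 - H ((real j)\<^sup>2)"
      unfolding H_def E_eq by (intro prob_compl sets_nuI) auto
    then show ?thesis using C(4)[of j] by simp
  qed
  have le: "ennreal (x ^ 8) \<le> (\<Sum>j. ennreal ((real j + 1) ^ 16) * indicator (E j) x)" if x: "x \<in> space \<nu>" for x
  proof (cases "x = 0")
    case False
    then have x0: "0 < x" using x by (simp add: space_nu)
    define j where "j = nat (\<lceil>sqrt x\<rceil> - 1)"
    have "0 < sqrt x" using x0 by simp
    then have j: "real j < sqrt x" "sqrt x \<le> real j + 1" unfolding j_def by linarith+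
    have "(real j)\<^sup>2 < (sqrt x)\<^sup>2" using j by (intro power_strict_mono) auto
    then have xE: "x \<in> E j" using x x0 by (simp add: E_def)
    have "x ^ 8 = sqrt x ^ 16"
      using x0 power_mult[of "sqrt x" 2 8] by simp
    also have "\<dots> \<le> (real j + 1) ^ 16" using j x0 by (intro power_mono) auto
    finally have "ennreal (x ^ 8) \<le> ennreal ((real j + 1) ^ 16) * indicator (E j) x"
      using xE by (simp add: ennreal_leI)
    also have "\<dots> \<le> (\<Sum>j. ennreal ((real j + 1) ^ 16) * indicator (E j) x)"
      using sum_le_suminf[of "\<lambda>j. ennreal ((real j + 1) ^ 16) * indicator (E j) x" "{j}"]
      by (simp only: summableI finite.intros sum.insert sum.empty empty_iff not_False_eq_True add_0_right zero_le simp_thms)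
    finally show ?thesis .
  qed simp
  have "(\<integral>\<^sup>+x. ennreal (x ^ 8) \<partial>\<nu>) \<le> (\<integral>\<^sup>+x. (\<Sum>j. ennreal ((real j + 1) ^ 16) * indicator (E j) x) \<partial>\<nu>)"
    by (intro nn_integral_mono le)
  also have "\<dots> = (\<Sum>j. ennreal ((real j + 1) ^ 16) * emeasure \<nu> (E j))"
    using E by (subst nn_integral_suminf) (auto simp: nn_integral_cmult_indicator)
  also have "\<dots> \<le> (\<Sum>j. ennreal (C * ((real j + 1) ^ 16 * \<rho> ^ j)))"
  proof (rule suminf_le)
    fix j
    have "ennreal ((real j + 1) ^ 16) * emeasure \<nu> (E j) = ennreal ((real j + 1) ^ 16 * measure \<nu> (E j))"
      by (simp add: emeasure_eq_measure ennreal_mult)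
    also have "\<dots> \<le> ennreal ((real j + 1) ^ 16 * (C * \<rho> ^ j))"
      using mE by (intro ennreal_leI mult_left_mono) auto
    finally show "ennreal ((real j + 1) ^ 16) * emeasure \<nu> (E j) \<le> ennreal (C * ((real j + 1) ^ 16 * \<rho> ^ j))"
      by (simp add: mult_ac)
  qed auto
  also have "\<dots> < \<infinity>"
  proof -
    have "summable (\<lambda>j. C * ((real j + 1) ^ 16 * \<rho> ^ j))"
      by (intro summable_mult summable_power_geometric C)
    then have "(\<Sum>j. ennreal (C * ((real j + 1) ^ 16 * \<rho> ^ j))) \<noteq> \<top>"
      using C by (intro ennreal_suminf_neq_top) auto
    then show ?thesis by (simp add: less_top)
  qed
  finally have "(\<integral>\<^sup>+x. ennreal (x ^ 8) \<partial>\<nu>) < \<infinity>" .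
  then show ?thesis by (intro integrableI_nonneg measurable_nu) auto
qed

end

section \<open>Passage to the limit\<close>

lemma (in prob_space) finite_uniform_expectation:
  fixes g :: "'k \<Rightarrow> real"
  assumes I: "finite I" "\<And>x. x \<in> space M \<Longrightarrow> K x \<in> I"
    and K: "\<And>k. k \<in> I \<Longrightarrow> {x \<in> space M. K x = k} \<in> sets M"
    and c: "\<And>k. k \<in> I \<Longrightarrow> measure M {x \<in> space M. K x = k} = c"
  shows "(\<lambda>x. g (K x)) \<in> borel_measurable M" "expectation (\<lambda>x. g (K x)) = c * sum g I"
proof -
  have eq: "g (K x) = (\<Sum>k\<in>I. g k * indicator {x \<in> space M. K x = k} x)" if "x \<in> space M" for x
  proof -
    have "(\<Sum>k\<in>I. g k * indicator {x \<in> space M. K x = k} x) = (\<Sum>k\<in>I. if k = K x then g k else 0)"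
      using that by (intro sum.cong) (auto split: split_indicator)
    also have "\<dots> = g (K x)" using I that by (simp add: sum.delta)
    finally show ?thesis ..
  qed
  have "(\<lambda>x. \<Sum>k\<in>I. g k * indicator {x \<in> space M. K x = k} x) \<in> borel_measurable M"
    using K by (intro borel_measurable_sum borel_measurable_times borel_measurable_indicator) auto
  then show "(\<lambda>x. g (K x)) \<in> borel_measurable M"
    by (subst measurable_cong[OF eq])
  have "expectation (\<lambda>x. g (K x)) = expectation (\<lambda>x. \<Sum>k\<in>I. g k * indicator {x \<in> space M. K x = k} x)"
    by (intro Bochner_Integration.integral_cong refl eq)
  also have "\<dots> = (\<Sum>k\<in>I. expectation (\<lambda>x. g k * indicator {x \<in> space M. K x = k} x))"
    using K by (intro Bochner_Integration.integral_sum integrable_mult_right integrable_real_indicator) (auto simp: emeasure_eq_measure)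
  also have "\<dots> = (\<Sum>k\<in>I. g k * c)"
    using K c by (intro sum.cong) (auto simp: Int_absorb2 sets.sets_into_space)
  finally show "expectation (\<lambda>x. g (K x)) = c * sum g I" by (simp add: sum_distrib_left mult.commute)
qed

text \<open>Dominated convergence for \<open>F n\<close> and for its square, with the common
  majorant \<open>1 + w^2\<close>. It serves both limits, in the number of digits and in the size of
  the box.\<close>

lemma (in prob_space) second_moment_limit:
  fixes f :: "'a \<Rightarrow> real"
  assumes f: "f \<in> borel_measurable M" "\<And>n. F n \<in> borel_measurable M"
    and w: "integrable M (\<lambda>x. (w x)\<^sup>2)"
    and lim: "AE x in M. (\<lambda>n. F n x) \<longlonglongrightarrow> f x"
    and bound: "\<And>n. AE x in M. \<bar>F n x\<bar> \<le> w x"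
    and B: "\<And>n. expectation (\<lambda>x. (F n x)\<^sup>2) - (expectation (F n))\<^sup>2 \<le> B"
  shows "integrable M (\<lambda>x. (f x)\<^sup>2)" "expectation (\<lambda>x. (f x)\<^sup>2) - (expectation f)\<^sup>2 \<le> B"
proof -
  have w1: "integrable M (\<lambda>x. 1 + (w x)\<^sup>2)" using w by simp
  have sq: "(\<lambda>x. (f x)\<^sup>2) \<in> borel_measurable M" "\<And>n. (\<lambda>x. (F n x)\<^sup>2) \<in> borel_measurable M"
    using f by (auto intro: borel_measurable_power)
  have lim2: "AE x in M. (\<lambda>n. (F n x)\<^sup>2) \<longlonglongrightarrow> (f x)\<^sup>2"
    using lim by eventually_elim (intro tendsto_intros)
  have b1: "AE x in M. norm (F n x) \<le> 1 + (w x)\<^sup>2" for n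
    using bound[of n]
  proof eventually_elim
    case (elim x)
    have "0 \<le> (w x - 1)\<^sup>2" by simp
    then have "2 * w x \<le> 1 + (w x)\<^sup>2" by (simp add: power2_diff)
    then show ?case using elim by simp
  qed
  have b2: "AE x in M. norm ((F n x)\<^sup>2) \<le> 1 + (w x)\<^sup>2" for n
    using bound[of n]
  proof eventually_elim
    case (elim x)
    then have "\<bar>F n x\<bar>\<^sup>2 \<le> (w x)\<^sup>2" by (intro power_mono) auto
    then show ?case by simp
  qed
  note d1 = integral_dominated_convergence[OF f w1 lim b1]
  note d2 = integral_dominated_convergence[OF sq w1 lim2 b2]
  show "integrable M (\<lambda>x. (f x)\<^sup>2)" by (rule integrable_dominated_convergence[OF sq w1 lim2 b2])
  have "(\<lambda>n. expectation (\<lambda>x. (F n x)\<^sup>2) - (expectation (F n))\<^sup>2) \<longlonglongrightarrow> expectation (\<lambda>x. (f x)\<^sup>2) - (expectation f)\<^sup>2"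
    by (intro tendsto_intros d1 d2)
  then show "expectation (\<lambda>x. (f x)\<^sup>2) - (expectation f)\<^sup>2 \<le> B"
    by (rule LIMSEQ_le_const2) (use B in blast)
qed

text \<open>The variance of \<open>X\<close> is at most its mean square distance from the constant
  \<open>E Y\<close>; then use \<open>(a + b)^2 <= 2 * a^2 + 2 * b^2\<close>.\<close>

lemma (in prob_space) variance_le_perturbation:
  fixes X Y :: "'a \<Rightarrow> real"
  assumes m: "X \<in> borel_measurable M" "Y \<in> borel_measurable M"
    and Y: "integrable M (\<lambda>x. (Y x)\<^sup>2)"
    and D: "integrable M (\<lambda>x. (X x - Y x)\<^sup>2)"
  shows "variance X \<le> 2 * (expectation (\<lambda>x. (Y x)\<^sup>2) - (expectation Y)\<^sup>2) + 2 * expectation (\<lambda>x. (X x - Y x)\<^sup>2)"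
proof -
  have Y1: "integrable M Y" using square_integrable_imp_integrable[OF m(2) Y] .
  have "integrable M (\<lambda>x. 2 * (X x - Y x)\<^sup>2 + 2 * (Y x)\<^sup>2)" using Y D by simp
  then have X2: "integrable M (\<lambda>x. (X x)\<^sup>2)"
  proof (rule Bochner_Integration.integrable_bound)
    show "AE x in M. norm ((X x)\<^sup>2) \<le> norm (2 * (X x - Y x)\<^sup>2 + 2 * (Y x)\<^sup>2)"
    proof (rule AE_I2)
      fix x
      have "0 \<le> ((X x - Y x) - Y x)\<^sup>2" by simp
      then have "(X x)\<^sup>2 \<le> 2 * (X x - Y x)\<^sup>2 + 2 * (Y x)\<^sup>2" by (simp add: power2_eq_square algebra_simps)
      then show "norm ((X x)\<^sup>2) \<le> norm (2 * (X x - Y x)\<^sup>2 + 2 * (Y x)\<^sup>2)" by simp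
    qed
  qed (use m in simp)
  have X1: "integrable M X" using square_integrable_imp_integrable[OF m(1) X2] .
  define c where "c = expectation Y"
  have "0 \<le> (expectation X - c)\<^sup>2" by simp
  then have "variance X \<le> expectation (\<lambda>x. (X x)\<^sup>2) - 2 * c * expectation X + c\<^sup>2"
    unfolding variance_eq[OF X1 X2] by (simp add: power2_diff algebra_simps)
  also have "\<dots> = expectation (\<lambda>x. (X x)\<^sup>2 - 2 * c * X x + c\<^sup>2)"
    using X1 X2 by (simp add: prob_space)
  also have "\<dots> \<le> expectation (\<lambda>x. 2 * (X x - Y x)\<^sup>2 + 2 * ((Y x)\<^sup>2 - 2 * c * Y x + c\<^sup>2))"
  proof (rule integral_mono)
    fix x
    have "0 \<le> ((X x - Y x) - (Y x - c))\<^sup>2" by simp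
    then show "(X x)\<^sup>2 - 2 * c * X x + c\<^sup>2 \<le> 2 * (X x - Y x)\<^sup>2 + 2 * ((Y x)\<^sup>2 - 2 * c * Y x + c\<^sup>2)"
      by (simp add: power2_eq_square algebra_simps)
  qed (use X1 X2 Y1 Y D in auto)
  also have "\<dots> = 2 * expectation (\<lambda>x. (X x - Y x)\<^sup>2) + 2 * (expectation (\<lambda>x. (Y x)\<^sup>2) - 2 * c * expectation Y + c\<^sup>2)"
    using Y1 Y D by (simp add: prob_space)
  also have "\<dots> = 2 * expectation (\<lambda>x. (X x - Y x)\<^sup>2) + 2 * (expectation (\<lambda>x. (Y x)\<^sup>2) - c\<^sup>2)"
    by (simp add: c_def power2_eq_square)
  finally show ?thesis by (simp add: c_def)
qed

lemma tendsto_Min_image: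
  fixes f :: "nat \<Rightarrow> 'p \<Rightarrow> real"
  assumes "finite P" "P \<noteq> {}" "\<And>p. p \<in> P \<Longrightarrow> (\<lambda>n. f n p) \<longlonglongrightarrow> g p"
  shows "(\<lambda>n. Min (f n ` P)) \<longlonglongrightarrow> Min (g ` P)"
  using assms
proof (induction P rule: finite_ne_induct)
  case (insert p P)
  then show ?case by (simp add: tendsto_min)
qed simp

lemma borel_measurable_Min_image:
  fixes f :: "'a \<Rightarrow> 'p \<Rightarrow> real"
  assumes "finite P" "P \<noteq> {}" "\<And>p. p \<in> P \<Longrightarrow> (\<lambda>x. f x p) \<in> borel_measurable M"
  shows "(\<lambda>x. Min (f x ` P)) \<in> borel_measurable M"
  using assms
proof (induction P rule: finite_ne_induct)
  case (insert p P)
  then show ?case by (simp add: borel_measurable_min)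
qed simp

lemma set_decode_subset: "k < 2 ^ n \<Longrightarrow> set_decode k \<subseteq> {..<n}"
proof -
  assume "k < 2 ^ n"
  then obtain B where B: "B \<subseteq> {..<n}" "k = set_encode B"
    using set_encode_bij[of n] by (auto simp: bij_betw_def image_iff set_eq_iff)
  then show ?thesis by (simp add: finite_subset)
qed

section \<open>Uniform configurations from the passage times\<close>

context nearly_gamma_law
begin

lemma expectation_code:
  fixes g :: "nat \<Rightarrow> real"
  shows "expectation (\<lambda>x. g (code n x)) = (\<Sum>k<2 ^ n. g k) / 2 ^ n"
proof -
  have "expectation (\<lambda>x. g (code n x)) = 1 / 2 ^ n * sum g {..<2 ^ n}"
    by (rule finite_uniform_expectation(2)) (auto simp: code_less measure_code)
  then show ?thesis by simp
qed

text \<open>The sum is \<open>2 ^ n\<close> times the eighth moment of \<open>approx n\<close>,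
  which never exceeds the passage time.\<close>

lemma approx_moment: "(\<Sum>k<2 ^ n. T (real k / 2 ^ n) ^ 8) \<le> expectation (\<lambda>x. x ^ 8) * 2 ^ n"
proof -
  have "(\<Sum>k<2 ^ n. T (real k / 2 ^ n) ^ 8) / 2 ^ n = expectation (\<lambda>x. approx n x ^ 8)"
    unfolding approx_def by (rule expectation_code[symmetric])
  also have "\<dots> \<le> expectation (\<lambda>x. x ^ 8)"
  proof (rule integral_mono_AE')
    show "AE x in \<nu>. approx n x ^ 8 \<le> x ^ 8"
      using AE_H_less_1 AE_space by eventually_elim (auto simp: space_nu intro!: power_mono approx_le)
  qed (auto intro!: integrable_power8)
  finally show ?thesis by (simp add: divide_le_eq)
qed

sublocale Q: quantile T "expectation (\<lambda>x. x ^ 8)"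
  by unfold_locales (auto intro: T_mono T_nonneg T_pos approx_moment)

definition conf :: "nat \<Rightarrow> 'e set \<Rightarrow> ('e \<Rightarrow> real) \<Rightarrow> ('e \<times> nat) set" where
  "conf n F x = {(e, i). e \<in> F \<and> i \<in> set_decode (code n (x e))}"

lemma conf_subset: "conf n F x \<subseteq> F \<times> {..<n}"
  using set_decode_subset[OF code_less] unfolding conf_def by blast

lemma edge_code_conf:
  assumes "e \<in> F"
  shows "edge_code n (conf n F x) e = code n (x e)"
proof -
  have "{i. i < n \<and> (e, i) \<in> conf n F x} = set_decode (code n (x e))"
    using assms set_decode_subset[OF code_less, of n "x e"] by (auto simp: conf_def)
  then show ?thesis by (simp add: edge_code_def)
qed

lemma conf_eq_iff:
  assumes "A \<subseteq> F \<times> {..<n}"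
  shows "conf n F x = A \<longleftrightarrow> (\<forall>e\<in>F. code n (x e) = edge_code n A e)"
proof
  assume "conf n F x = A"
  then show "\<forall>e\<in>F. code n (x e) = edge_code n A e" using edge_code_conf by metis
next
  assume *: "\<forall>e\<in>F. code n (x e) = edge_code n A e"
  have "set_decode (code n (x e)) = {i. i < n \<and> (e, i) \<in> A}" if "e \<in> F" for e
    using * that by (simp add: edge_code_def)
  then show "conf n F x = A" using assms unfolding conf_def by auto
qed

lemma wt_conf: "e \<in> F \<Longrightarrow> Q.wt n (conf n F x) e = approx n (x e)"
  by (simp add: Q.wt_def Q.q_def approx_def edge_code_conf)

lemma prob_space_fpp: "prob_space (fpp_measure \<nu>)"
  unfolding fpp_measure_def by (intro prob_space_PiM prob_space_axioms)

text \<open>Prescribing the digits on \<open>F\<close> is a cylinder event with probability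
  \<open>1 / 2 ^ n\<close> per edge, so the configuration is uniform on the cube and expectations
  are cube averages.\<close>

lemma expectation_conf:
  fixes F :: "(int ^ 'd) set set" and g :: "((int ^ 'd) set \<times> nat) set \<Rightarrow> real"
  assumes F: "finite F" "F \<subseteq> lattice_edges"
  shows "(\<lambda>x. g (conf n F x)) \<in> borel_measurable (fpp_measure \<nu>)"
    and "integral\<^sup>L (fpp_measure \<nu>) (\<lambda>x. g (conf n F x)) = cube_avg (F \<times> {..<n}) g"
proof -
  interpret PP: product_prob_space "\<lambda>_. \<nu>" "lattice_edges :: (int ^ 'd) set set"
    by unfold_locales
  let ?S = "F \<times> {..<n}" and ?M = "fpp_measure \<nu> :: ((int ^ 'd) set \<Rightarrow> real) measure"
  have M: "?M = PiM lattice_edges (\<lambda>_. \<nu>)" by (simp add: fpp_measure_def)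
  have ev: "{x \<in> space ?M. conf n F x = A} = PP.emb lattice_edges F (PiE F (\<lambda>e. {y \<in> space \<nu>. code n y = edge_code n A e}))"
    if "A \<subseteq> ?S" for A
  proof -
    let ?X = "\<lambda>e. {y \<in> space \<nu>. code n y = edge_code n A e}"
    have "{x \<in> space ?M. conf n F x = A} = {x \<in> space ?M. \<forall>e\<in>F. x e \<in> ?X e}"
      unfolding conf_eq_iff[OF that] M using F(2) by (auto simp: space_PiM PiE_iff)
    also have "\<dots> = PP.emb lattice_edges F (PiE F ?X)"
      unfolding prod_emb_def M using F by (auto simp: space_PiM Pi_iff)
    finally show ?thesis .
  qed
  have sets: "{y \<in> space \<nu>. code n y = k} \<in> sets \<nu>" for k by simp
  have meas: "{x \<in> space ?M. conf n F x = A} \<in> sets ?M" if "A \<in> Pow ?S" for A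
    using that F sets unfolding M by (subst ev[unfolded M]) (auto intro!: sets_PiM_I)
  have prob: "measure ?M {x \<in> space ?M. conf n F x = A} = 1 / 2 ^ card ?S" if "A \<in> Pow ?S" for A
  proof -
    have "measure ?M {x \<in> space ?M. conf n F x = A} = (\<Prod>e\<in>F. measure \<nu> {y \<in> space \<nu>. code n y = edge_code n A e})"
      using that F sets unfolding M by (subst ev[unfolded M]) (auto intro!: PP.measure_PiM_emb)
    also have "\<dots> = (\<Prod>e\<in>F. 1 / 2 ^ n)" by (simp add: measure_code edge_code_less)
    also have "\<dots> = 1 / 2 ^ card ?S" using F
      by (simp add: card_cartesian_product power_one_over mult.commute flip: power_mult)
    finally show ?thesis .
  qed
  have I: "finite (Pow ?S)" "\<And>x. x \<in> space ?M \<Longrightarrow> conf n F x \<in> Pow ?S"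
    using F(1) by (simp_all only: Pow_iff conf_subset finite_Pow_iff finite_SigmaI finite_lessThan)
  note e = prob_space.finite_uniform_expectation[OF prob_space_fpp I meas prob, of g]
  show "(\<lambda>x. g (conf n F x)) \<in> borel_measurable ?M" by (rule e(1))
  show "integral\<^sup>L ?M (\<lambda>x. g (conf n F x)) = cube_avg ?S g" using e(2) by (simp add: cube_avg_def)
qed

end

section \<open>Passage times on the whole lattice\<close>

lemma sum_square_integrable:
  fixes f :: "'z \<Rightarrow> 'a \<Rightarrow> real"
  assumes B: "finite B" and m: "\<And>z. z \<in> B \<Longrightarrow> f z \<in> borel_measurable M"
    and i: "\<And>z. z \<in> B \<Longrightarrow> integrable M (\<lambda>x. (f z x)\<^sup>2)"
  shows "integrable M (\<lambda>x. (\<Sum>z\<in>B. f z x)\<^sup>2)"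
    "integral\<^sup>L M (\<lambda>x. (\<Sum>z\<in>B. f z x)\<^sup>2) \<le> real (card B) * (\<Sum>z\<in>B. integral\<^sup>L M (\<lambda>x. (f z x)\<^sup>2))"
proof -
  have le: "(\<Sum>z\<in>B. f z x)\<^sup>2 \<le> real (card B) * (\<Sum>z\<in>B. (f z x)\<^sup>2)" for x
    using Cauchy_Schwarz_ineq_sum[of "\<lambda>_. 1" "\<lambda>z. f z x" B] by simp
  have int: "integrable M (\<lambda>x. real (card B) * (\<Sum>z\<in>B. (f z x)\<^sup>2))" using i by simp
  have sm: "(\<lambda>x. \<Sum>z\<in>B. f z x) \<in> borel_measurable M" by (intro borel_measurable_sum m)
  show I: "integrable M (\<lambda>x. (\<Sum>z\<in>B. f z x)\<^sup>2)"
  proof (rule Bochner_Integration.integrable_bound[OF int])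
    show "AE x in M. norm ((\<Sum>z\<in>B. f z x)\<^sup>2) \<le> norm (real (card B) * (\<Sum>z\<in>B. (f z x)\<^sup>2))"
    proof (rule AE_I2)
      fix x
      show "norm ((\<Sum>z\<in>B. f z x)\<^sup>2) \<le> norm (real (card B) * (\<Sum>z\<in>B. (f z x)\<^sup>2))"
        using le[of x] by (simp add: abs_of_nonneg sum_nonneg)
    qed
  qed (use sm in \<open>rule borel_measurable_power\<close>)
  have "integral\<^sup>L M (\<lambda>x. (\<Sum>z\<in>B. f z x)\<^sup>2) \<le> integral\<^sup>L M (\<lambda>x. real (card B) * (\<Sum>z\<in>B. (f z x)\<^sup>2))"
    by (intro integral_mono I int le)
  also have "\<dots> = real (card B) * (\<Sum>z\<in>B. integral\<^sup>L M (\<lambda>x. (f z x)\<^sup>2))"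
    using i by simp
  finally show "integral\<^sup>L M (\<lambda>x. (\<Sum>z\<in>B. f z x)\<^sup>2) \<le> real (card B) * (\<Sum>z\<in>B. integral\<^sup>L M (\<lambda>x. (f z x)\<^sup>2))" .
qed

lemma box_time_ge_fpp_dist:
  assumes "finite \<Lambda>" "saw \<Lambda> u w \<noteq> {}" "\<And>e. e \<in> lattice_edges \<Longrightarrow> 0 \<le> x e"
  shows "fpp_dist x u w \<le> box_time \<Lambda> x u w"
proof -
  obtain p where p: "p \<in> saw \<Lambda> u w" "path_time x p = box_time \<Lambda> x u w"
    using box_time_attained[OF assms(1,2)] by blast
  have "lattice_path u w p" using p(1) by (simp add: saw_def)
  then have "fpp_dist x u w \<le> path_time x p" using assms(3) by (rule fpp_dist_le)
  then show ?thesis using p(2) by simp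
qed

lemma fpp_dist_nonneg:
  fixes u w :: "int ^ 'd::finite"
  assumes "\<And>e. e \<in> lattice_edges \<Longrightarrow> 0 \<le> x e"
  shows "0 \<le> fpp_dist x u w"
proof -
  obtain p where "lattice_path u w p" using geodesic_set_UNIV unfolding geodesic_set_def by blast
  then show ?thesis unfolding fpp_dist_def
    by (intro cINF_greatest) (auto intro: path_time_nonneg assms)
qed

lemma fpp_dist_triangle:
  fixes u w u' w' :: "int ^ 'd::finite"
  assumes p: "lattice_path u u' p" and p': "lattice_path w' w p'"
    and x: "\<And>e. e \<in> lattice_edges \<Longrightarrow> 0 \<le> x e"
  shows "fpp_dist x u w \<le> path_time x p + fpp_dist x u' w' + path_time x p'"
proof -
  have "fpp_dist x u w - path_time x p - path_time x p' \<le> fpp_dist x u' w'"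
    unfolding fpp_dist_def[of x u' w']
  proof (rule cINF_greatest)
    obtain r where "lattice_path u' w' r" using geodesic_set_UNIV unfolding geodesic_set_def by blast
    then show "{r. lattice_path u' w' r} \<noteq> {}" by blast
    fix r assume "r \<in> {r. lattice_path u' w' r}"
    then have r: "lattice_path u' w' r" by simp
    note j1 = lattice_path_join[OF p r]
    note j2 = lattice_path_join[OF j1(1) p']
    have "fpp_dist x u w \<le> path_time x ((p @ tl r) @ tl p')" using j2(1) x by (rule fpp_dist_le)
    then show "fpp_dist x u w - path_time x p - path_time x p' \<le> path_time x r"
      unfolding j2(2) j1(2) by simp
  qed
  then show ?thesis by simp
qed

lemma box_mono: "M \<le> N \<Longrightarrow> lattice_box M \<subseteq> lattice_box N"
  by (auto simp: lattice_box_def intro: order_trans)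

lemma finite_subset_box:
  fixes A :: "(int ^ 'd::finite) set"
  assumes "finite A"
  shows "\<exists>N::nat. A \<subseteq> lattice_box (int N)"
proof -
  define N where "N = (\<Sum>v\<in>A. \<Sum>i\<in>UNIV. nat \<bar>v $ i\<bar>)"
  have "\<bar>v $ i\<bar> \<le> int N" if "v \<in> A" for v i
  proof -
    have "nat \<bar>v $ i\<bar> \<le> (\<Sum>i\<in>UNIV. nat \<bar>v $ i\<bar>)" by (rule member_le_sum) auto
    also have "\<dots> \<le> N" unfolding N_def using that assms by (intro member_le_sum) auto
    finally show ?thesis by linarith
  qed
  then show ?thesis by (intro exI[of _ N]) (auto simp: lattice_box_def)
qed

text \<open>A path whose time is within \<open>e\<close> of the infimum is finite, hence contained
  in all large boxes.\<close>

lemma box_time_tendsto: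
  fixes u w z :: "int ^ 'd::finite"
  assumes x: "\<And>e. e \<in> lattice_edges \<Longrightarrow> 0 \<le> x e"
    and uw: "u \<in> (+) z ` lattice_box (int N0)" "w \<in> (+) z ` lattice_box (int N0)"
  shows "(\<lambda>N. box_time ((+) z ` lattice_box (int (N0 + N))) x u w) \<longlonglongrightarrow> fpp_dist x u w"
proof (rule LIMSEQ_I)
  fix e :: real assume e: "0 < e"
  have ge: "fpp_dist x u w \<le> box_time ((+) z ` lattice_box (int (N0 + N))) x u w" for N
  proof (rule box_time_ge_fpp_dist[OF finite_imageI[OF finite_box] _ x])
    have "(+) z ` lattice_box (int N0) \<subseteq> (+) z ` lattice_box (int (N0 + N))" by (intro image_mono box_mono) simp
    then show "saw ((+) z ` lattice_box (int (N0 + N))) u w \<noteq> {}"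
      using uw by (intro saw_nonempty geodesic_set_shift geodesic_set_box) auto
  qed
  have "\<exists>p\<in>{p. lattice_path u w p}. path_time x p < fpp_dist x u w + e"
  proof (rule ccontr)
    assume "\<not> ?thesis"
    moreover obtain p where "lattice_path u w p" using geodesic_set_UNIV unfolding geodesic_set_def by blast
    ultimately have "fpp_dist x u w + e \<le> fpp_dist x u w"
      by (subst (2) fpp_dist_def) (intro cINF_greatest, auto simp: not_less)
    then show False using e by simp
  qed
  then obtain p where p: "lattice_path u w p" "path_time x p < fpp_dist x u w + e" by blast
  obtain N1 where N1: "(+) (- z) ` set p \<subseteq> lattice_box (int N1)" using finite_subset_box[of "(+) (- z) ` set p"] by auto
  have "norm (box_time ((+) z ` lattice_box (int (N0 + N))) x u w - fpp_dist x u w) < e" if "N1 \<le> N" for N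
  proof -
    have "(+) (- z) ` set p \<subseteq> lattice_box (int (N0 + N))"
      using N1 box_mono[of "int N1" "int (N0 + N)"] that by force
    then have "(+) z ` (+) (- z) ` set p \<subseteq> (+) z ` lattice_box (int (N0 + N))" by (rule image_mono)
    then have "set p \<subseteq> (+) z ` lattice_box (int (N0 + N))" by (simp add: image_image)
    then have "box_time ((+) z ` lattice_box (int (N0 + N))) x u w \<le> path_time x p"
      by (intro box_time_le finite_imageI finite_box p x)
    then show ?thesis using ge[of N] p(2) by simp
  qed
  then show "\<exists>no. \<forall>N\<ge>no. norm (box_time ((+) z ` lattice_box (int (N0 + N))) x u w - fpp_dist x u w) < e" by blast
qed

definition avg_fpp :: "'d \<Rightarrow> 'd \<Rightarrow> nat \<Rightarrow> ((int ^ 'd) set \<Rightarrow> real) \<Rightarrow> int ^ 'd \<Rightarrow> real" where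
  "avg_fpp i j k x v = (\<Sum>z\<in>square i j (k\<^sup>2). fpp_dist x z (z + v)) / real k ^ 4"

context nearly_gamma_law
begin

abbreviation "\<mu> \<equiv> fpp_measure \<nu>"

lemma edge_measurable:
  assumes "e \<in> lattice_edges"
  shows "(\<lambda>x. x e) \<in> borel_measurable \<mu>"
proof -
  have "(\<lambda>x. x e) \<in> measurable \<mu> \<nu>"
    unfolding fpp_measure_def by (rule measurable_component_singleton[OF assms])
  then show ?thesis by (rule measurable_compose) (rule measurable_nu, simp)
qed

lemma edge_nonneg: "x \<in> space \<mu> \<Longrightarrow> e \<in> lattice_edges \<Longrightarrow> 0 \<le> x e"
  by (auto simp: fpp_measure_def space_PiM PiE_iff space_nu)

lemma edge_second_moment:
  assumes e: "e \<in> lattice_edges"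
  shows "integrable \<mu> (\<lambda>x. (x e)\<^sup>2)" "integral\<^sup>L \<mu> (\<lambda>x. (x e)\<^sup>2) = expectation (\<lambda>y. y\<^sup>2)"
proof -
  have m: "(\<lambda>x. x e) \<in> measurable \<mu> \<nu>"
    unfolding fpp_measure_def by (rule measurable_component_singleton[OF e])
  have d: "distr \<mu> \<nu> (\<lambda>x. x e) = \<nu>"
    unfolding fpp_measure_def using e prob_space_axioms by (intro distr_PiM_component)
  have sq: "(\<lambda>y. y\<^sup>2) \<in> borel_measurable \<nu>" by (rule measurable_nu) simp
  have "integrable \<nu> (\<lambda>y. 1 + y ^ 8)" using integrable_power8 by simp
  then have "integrable \<nu> (\<lambda>y. y\<^sup>2)"
  proof (rule Bochner_Integration.integrable_bound)
    show "AE y in \<nu>. norm (y\<^sup>2) \<le> norm (1 + y ^ 8)"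
    proof (rule AE_I2)
      fix y :: real
      show "norm (y\<^sup>2) \<le> norm (1 + y ^ 8)"
      proof (cases "\<bar>y\<bar> \<le> 1")
        case True
        then have "\<bar>y\<bar>\<^sup>2 \<le> 1\<^sup>2" by (intro power_mono) auto
        then show ?thesis by (simp add: add_increasing2)
      next
        case False
        then have "\<bar>y\<bar>\<^sup>2 \<le> \<bar>y\<bar> ^ 8" by (intro power_increasing) auto
        then show ?thesis by simp
      qed
    qed
  qed (rule sq)
  then have "integrable (distr \<mu> \<nu> (\<lambda>x. x e)) (\<lambda>y. y\<^sup>2)" by (simp only: d)
  then show "integrable \<mu> (\<lambda>x. (x e)\<^sup>2)" by (simp only: integrable_distr_eq[OF m sq])
  show "integral\<^sup>L \<mu> (\<lambda>x. (x e)\<^sup>2) = expectation (\<lambda>y. y\<^sup>2)"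
    using integral_distr[OF m sq] by (simp only: d)
qed

lemma path_edge: "lattice_path u w p \<Longrightarrow> i < length p - 1 \<Longrightarrow> {p ! i, p ! Suc i} \<in> lattice_edges"
  using path_edges_lattice[of u w p] by (auto simp: path_edges_def)

lemma path_time_measurable: "lattice_path u w p \<Longrightarrow> (\<lambda>x. path_time x p) \<in> borel_measurable \<mu>"
  unfolding path_time_def by (intro borel_measurable_sum edge_measurable path_edge) auto

lemma path_time_second_moment:
  assumes p: "lattice_path u w p"
  shows "integrable \<mu> (\<lambda>x. (path_time x p)\<^sup>2)"
    "integral\<^sup>L \<mu> (\<lambda>x. (path_time x p)\<^sup>2) \<le> (real (length p - 1))\<^sup>2 * expectation (\<lambda>y. y\<^sup>2)"
proof -
  let ?f = "\<lambda>i x. x {p ! i, p ! Suc i}"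
  have i: "i \<in> {..<length p - 1} \<Longrightarrow> ?f i \<in> borel_measurable \<mu>"
    "i \<in> {..<length p - 1} \<Longrightarrow> integrable \<mu> (\<lambda>x. (?f i x)\<^sup>2)" for i
    using path_edge[OF p] by (auto intro: edge_measurable edge_second_moment(1))
  show "integrable \<mu> (\<lambda>x. (path_time x p)\<^sup>2)"
    unfolding path_time_def by (rule sum_square_integrable(1)[OF _ i]) auto
  have "integral\<^sup>L \<mu> (\<lambda>x. (path_time x p)\<^sup>2) \<le> real (card {..<length p - 1}) * (\<Sum>i<length p - 1. integral\<^sup>L \<mu> (\<lambda>x. (?f i x)\<^sup>2))"
    unfolding path_time_def by (rule sum_square_integrable(2)[OF _ i]) auto
  also have "(\<Sum>i<length p - 1. integral\<^sup>L \<mu> (\<lambda>x. (?f i x)\<^sup>2)) = (\<Sum>i<length p - 1. expectation (\<lambda>y. y\<^sup>2))"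
    using path_edge[OF p] by (intro sum.cong refl edge_second_moment(2)) auto
  finally show "integral\<^sup>L \<mu> (\<lambda>x. (path_time x p)\<^sup>2) \<le> (real (length p - 1))\<^sup>2 * expectation (\<lambda>y. y\<^sup>2)"
    by (simp add: power2_eq_square mult.assoc)
qed

lemma box_time_measurable:
  assumes "finite \<Lambda>" "saw \<Lambda> u w \<noteq> {}"
  shows "(\<lambda>x. box_time \<Lambda> x u w) \<in> borel_measurable \<mu>"
  unfolding box_time_def
  by (rule borel_measurable_Min_image[OF finite_saw[OF assms(1)] assms(2)])
    (auto simp: saw_def intro: path_time_measurable)

lemma AE_edges:
  assumes "finite F" "F \<subseteq> lattice_edges"
  shows "AE x in \<mu>. \<forall>e\<in>F. H (x e) < 1 \<and> (\<lambda>n. approx n (x e)) \<longlonglongrightarrow> x e"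
  using assms(1)
proof (rule AE_finite_allI)
  fix e assume "e \<in> F"
  then have "e \<in> lattice_edges" using assms(2) by blast
  then show "AE x in \<mu>. H (x e) < 1 \<and> (\<lambda>n. approx n (x e)) \<longlonglongrightarrow> x e"
    unfolding fpp_measure_def using AE_approx_tendsto prob_space_axioms
    by (intro AE_PiM_component[where P = "\<lambda>y. H y < 1 \<and> (\<lambda>n. approx n y) \<longlonglongrightarrow> y"])
qed

lemma avg_edges_subset: "avg_edges N i j k \<subseteq> lattice_edges"
  by (auto simp: avg_edges_def edges_in_def)

lemma path_edges_shift_subset:
  assumes "p \<in> saw ((+) z ` lattice_box (int N)) u w" "z \<in> square i j (k\<^sup>2)"
  shows "path_edges p \<subseteq> avg_edges N i j k"
  using saw_path_edges[OF assms(1)] assms(2) unfolding avg_edges_def by blast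

text \<open>The mean time along the translates of one fixed path. It is square integrable and does
  not involve the digits or the box, so it can dominate in both limits.\<close>

definition dominator :: "'d::finite \<Rightarrow> 'd \<Rightarrow> nat \<Rightarrow> (int ^ 'd) list \<Rightarrow> ((int ^ 'd) set \<Rightarrow> real) \<Rightarrow> real" where
  "dominator i j k p x = (\<Sum>z\<in>square i j (k\<^sup>2). path_time x (map ((+) z) p)) / real k ^ 4"

lemma dominator_integrable:
  assumes p: "lattice_path 0 v p"
  shows "integrable \<mu> (\<lambda>x. (dominator i j k p x)\<^sup>2)"
proof -
  have lp: "lattice_path z (z + v) (map ((+) z) p)" for z
    using lattice_path_shift[of z 0 v p] p by simp
  have "integrable \<mu> (\<lambda>x. (\<Sum>z\<in>square i j (k\<^sup>2). path_time x (map ((+) z) p))\<^sup>2)"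
    by (rule sum_square_integrable(1)) (auto intro: path_time_measurable[OF lp] path_time_second_moment(1)[OF lp])
  then show ?thesis unfolding dominator_def power_divide by simp
qed

lemma avg_time_bounds:
  fixes v :: "int ^ 'd::finite"
  assumes p: "lattice_path 0 v p" "set p \<subseteq> lattice_box (int N)"
    and x: "\<And>e. e \<in> lattice_edges \<Longrightarrow> 0 \<le> x e"
  shows "0 \<le> avg_time N i j k x v" "avg_time N i j k x v \<le> dominator i j k p x"
proof -
  have lp: "lattice_path z (z + v) (map ((+) z) p)" and sp: "set (map ((+) z) p) \<subseteq> (+) z ` lattice_box (int N)" for z
    using lattice_path_shift[of z 0 v p] p by auto
  have ne: "saw ((+) z ` lattice_box (int N)) z (z + v) \<noteq> {}" for z
    using loop_erasure[OF lp sp, of "\<lambda>_. 0"] by auto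
  have "0 \<le> box_time ((+) z ` lattice_box (int N)) x z (z + v)" for z
    using box_time_ge_fpp_dist[OF finite_imageI[OF finite_box] ne x] fpp_dist_nonneg[of x z "z + v"] x
    by (meson order_trans)
  then show "0 \<le> avg_time N i j k x v"
    unfolding avg_time_def by (intro divide_nonneg_nonneg sum_nonneg) auto
  show "avg_time N i j k x v \<le> dominator i j k p x"
    unfolding avg_time_def dominator_def
    by (intro divide_right_mono sum_mono box_time_le finite_imageI finite_box lp sp x) auto
qed

lemma avg_time_measurable:
  assumes v: "v \<in> lattice_box (int N)"
  shows "(\<lambda>x. avg_time N i j k x v) \<in> borel_measurable \<mu>"
proof -
  have 0: "0 \<in> lattice_box (int N)" by (simp add: lattice_box_def)
  have "saw ((+) z ` lattice_box (int N)) z (z + v) \<noteq> {}" for z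
    using saw_shift[of z "lattice_box (int N)" 0 v] saw_nonempty[OF geodesic_set_box 0 v] by simp
  then show ?thesis unfolding avg_time_def
    by (intro borel_measurable_divide borel_measurable_sum box_time_measurable finite_imageI finite_box) auto
qed

text \<open>The limit in the number of digits, with the box fixed: the averaged box time is
  continuous in finitely many passage times, and these are approximated almost surely.\<close>

lemma avg_time_limit:
  fixes v :: "int ^ 'd::finite"
  assumes p: "lattice_path 0 v p" "set p \<subseteq> lattice_box (int N)"
    and bound: "\<And>n. n0 \<le> n \<Longrightarrow> cube_avg (avg_edges N i j k \<times> {..<n}) (\<lambda>A. (avg_time N i j k (Q.wt n A) v)\<^sup>2)
        - (cube_avg (avg_edges N i j k \<times> {..<n}) (\<lambda>A. avg_time N i j k (Q.wt n A) v))\<^sup>2 \<le> B"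
  shows "integral\<^sup>L \<mu> (\<lambda>x. (avg_time N i j k x v)\<^sup>2) - (integral\<^sup>L \<mu> (\<lambda>x. avg_time N i j k x v))\<^sup>2 \<le> B"
proof -
  interpret M: prob_space \<mu> by (rule prob_space_fpp)
  let ?F = "avg_edges N i j k :: (int ^ 'd) set set"
  have v: "v \<in> lattice_box (int N)" using p unfolding lattice_path_def by (metis last_in_set subsetD)
  have 0: "(0 :: int ^ 'd) \<in> lattice_box (int N)" by (simp add: lattice_box_def)
  have ne: "saw ((+) z ` lattice_box (int N)) z (z + v) \<noteq> {}" for z
    using saw_shift[of z "lattice_box (int N)" 0 v] saw_nonempty[OF geodesic_set_box 0 v] by simp
  define g where "g n A = avg_time N i j k (Q.wt n A) v" for n A
  \<comment> \<open>The sequence starts at \<open>n0\<close>, from where on the bound holds.\<close>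
  define G where "G n x = g (n0 + n) (conf (n0 + n) ?F x)" for n x
  have lp: "lattice_path z (z + v) (map ((+) z) p)" and sp: "set (map ((+) z) p) \<subseteq> (+) z ` lattice_box (int N)" for z
    using lattice_path_shift[of z 0 v p] p by auto
  have wt: "Q.wt n (conf n ?F x) e = approx n (x e)" if "e \<in> ?F" for n x e
    using that by (rule wt_conf)
  note fin = finite_avg_edges[of N i j k] 
  note AE = AE_edges[OF fin avg_edges_subset]
  have G_meas: "G n \<in> borel_measurable \<mu>" for n
    unfolding G_def by (rule expectation_conf(1)[OF fin avg_edges_subset])
  have lim: "AE x in \<mu>. (\<lambda>n. G n x) \<longlonglongrightarrow> avg_time N i j k x v"
    using AE
  proof eventually_elim
    case (elim x)
    have "(\<lambda>n. path_time (Q.wt n (conf n ?F x)) r) \<longlonglongrightarrow> path_time x r"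
      if r: "r \<in> saw ((+) z ` lattice_box (int N)) z (z + v)" and z: "z \<in> square i j (k\<^sup>2)" for r z
      unfolding path_time_def
    proof (rule tendsto_sum)
      fix l assume "l \<in> {..<length r - 1}"
      then have "{r ! l, r ! Suc l} \<in> ?F" using path_edges_shift_subset[OF r z] by (auto simp: path_edges_def)
      then show "(\<lambda>n. Q.wt n (conf n ?F x) {r ! l, r ! Suc l}) \<longlonglongrightarrow> x {r ! l, r ! Suc l}"
        using elim by (simp add: wt)
    qed
    then have "(\<lambda>n. box_time ((+) z ` lattice_box (int N)) (Q.wt n (conf n ?F x)) z (z + v)) \<longlonglongrightarrow> box_time ((+) z ` lattice_box (int N)) x z (z + v)"
      if "z \<in> square i j (k\<^sup>2)" for z
      unfolding box_time_def using that
      by (intro tendsto_Min_image finite_saw finite_imageI finite_box ne) auto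
    then have "(\<lambda>n. g n (conf n ?F x)) \<longlonglongrightarrow> avg_time N i j k x v"
      unfolding g_def avg_time_def divide_inverse by (intro tendsto_mult_right tendsto_sum) auto
    then show ?case unfolding G_def by (rule LIMSEQ_ignore_initial_segment[where k = n0, unfolded add.commute[of _ n0]])
  qed
  have dom: "AE x in \<mu>. \<bar>G n x\<bar> \<le> dominator i j k p x" for n
    using AE AE_space
  proof eventually_elim
    case (elim x)
    let ?y = "Q.wt (n0 + n) (conf (n0 + n) ?F x)"
    note b = avg_time_bounds[OF p, where x = ?y and i = i and j = j and k = k, OF Q.wt_nonneg]
    \<comment> \<open>The coded passage times are at most the true ones, so a single dominator works
      for all \<open>n\<close>.\<close>
    have "dominator i j k p ?y \<le> dominator i j k p x"
      unfolding dominator_def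
    proof (intro divide_right_mono sum_mono)
      fix z assume z: "z \<in> square i j (k\<^sup>2)"
      show "path_time ?y (map ((+) z) p) \<le> path_time x (map ((+) z) p)"
        unfolding path_time_def
      proof (rule sum_mono)
        fix l assume l: "l \<in> {..<length (map ((+) z) p) - 1}"
        let ?e = "{map ((+) z) p ! l, map ((+) z) p ! Suc l}"
        have "?e \<in> path_edges (map ((+) z) p)" using l by (auto simp: path_edges_def)
        then have "?e \<in> edges_in ((+) z ` lattice_box (int N))"
          using path_edges_in[of "map ((+) z) p"] lp[of z] sp[of z] by (auto simp: lattice_path_def)
        then have e: "?e \<in> ?F" "?e \<in> lattice_edges" using z by (auto simp: avg_edges_def edges_in_def)
        then show "?y ?e \<le> x ?e" using elim edge_nonneg[of x ?e] by (auto simp: wt intro!: approx_le)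
      qed
    qed simp
    then show ?case using b by (simp add: G_def g_def)
  qed
  have "M.expectation (\<lambda>x. (G n x)\<^sup>2) - (M.expectation (G n))\<^sup>2 \<le> B" for n
    unfolding G_def
    using expectation_conf(2)[OF fin avg_edges_subset, where g = "\<lambda>A. (g (n0 + n) A)\<^sup>2" and n = "n0 + n"]
      expectation_conf(2)[OF fin avg_edges_subset, where g = "g (n0 + n)" and n = "n0 + n"] bound[of "n0 + n"]
    by (simp add: g_def[abs_def])
  then show ?thesis
    by (rule M.second_moment_limit(2)[OF avg_time_measurable[OF v] G_meas dominator_integrable[OF p(1)] lim dom])
qed

lemma fpp_dist_measurable:
  fixes u w :: "int ^ 'd::finite"
  shows "(\<lambda>x. fpp_dist x u w) \<in> borel_measurable \<mu>"
proof -
  obtain N0 where N0: "{u, w} \<subseteq> lattice_box (int N0)" using finite_subset_box[of "{u, w}"] by auto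
  show ?thesis
  proof (rule borel_measurable_LIMSEQ_metric)
    fix N
    have "lattice_box (int N0) \<subseteq> lattice_box (int (N0 + N))" by (intro box_mono) simp
    then have "saw (lattice_box (int (N0 + N))) u w \<noteq> {}"
      using N0 by (intro saw_nonempty geodesic_set_box) auto
    \<comment> \<open>The translation by 0 brings the box into the form used in
      \<open>box_time_tendsto\<close>.\<close>
    then show "(\<lambda>x. box_time ((+) (0 :: int ^ 'd) ` lattice_box (int (N0 + N))) x u w) \<in> borel_measurable \<mu>"
      by (intro box_time_measurable finite_imageI finite_box) simp
  next
    fix x :: "(int ^ 'd) set \<Rightarrow> real" assume "x \<in> space \<mu>"
    then show "(\<lambda>N. box_time ((+) (0 :: int ^ 'd) ` lattice_box (int (N0 + N))) x u w) \<longlonglongrightarrow> fpp_dist x u w"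
      using N0 by (intro box_time_tendsto edge_nonneg) auto
  qed
qed

text \<open>The limit in the size of the box; the bound survives because \<open>B\<close> is the
  same for every box containing \<open>v\<close>.\<close>

lemma avg_fpp_variance:
  fixes v :: "int ^ 'd::finite"
  assumes p: "lattice_path 0 v p"
    and bound: "\<And>N. v \<in> lattice_box (int N) \<Longrightarrow> integral\<^sup>L \<mu> (\<lambda>x. (avg_time N i j k x v)\<^sup>2) - (integral\<^sup>L \<mu> (\<lambda>x. avg_time N i j k x v))\<^sup>2 \<le> B"
  shows "(\<lambda>x. avg_fpp i j k x v) \<in> borel_measurable \<mu>"
    "integrable \<mu> (\<lambda>x. (avg_fpp i j k x v)\<^sup>2)"
    "integral\<^sup>L \<mu> (\<lambda>x. (avg_fpp i j k x v)\<^sup>2) - (integral\<^sup>L \<mu> (\<lambda>x. avg_fpp i j k x v))\<^sup>2 \<le> B"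
proof -
  interpret M: prob_space \<mu> by (rule prob_space_fpp)
  obtain N0 where N0: "set p \<subseteq> lattice_box (int N0)" using finite_subset_box[of "set p"] by auto
  have in_box: "(0 :: int ^ 'd) \<in> set p" "v \<in> set p" using p unfolding lattice_path_def by (metis hd_in_set, metis last_in_set)
  have N: "set p \<subseteq> lattice_box (int (N0 + N))" for N using N0 box_mono[of "int N0" "int (N0 + N)"] by auto
  have lim: "(\<lambda>N. avg_time (N0 + N) i j k x v) \<longlonglongrightarrow> avg_fpp i j k x v" if x: "x \<in> space \<mu>" for x
    unfolding avg_time_def avg_fpp_def divide_inverse
  proof (intro tendsto_mult_right tendsto_sum box_time_tendsto edge_nonneg x)
    fix z :: "int ^ 'd"
    show "z \<in> (+) z ` lattice_box (int N0)" using N0 in_box by (intro image_eqI[of _ _ 0]) auto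
    show "z + v \<in> (+) z ` lattice_box (int N0)" using N0 in_box by auto
  qed
  have m: "(\<lambda>x. avg_time (N0 + N) i j k x v) \<in> borel_measurable \<mu>" for N
    using N in_box by (intro avg_time_measurable) auto
  show m': "(\<lambda>x. avg_fpp i j k x v) \<in> borel_measurable \<mu>"
    by (rule borel_measurable_LIMSEQ_metric[OF m lim])
  have dom: "AE x in \<mu>. \<bar>avg_time (N0 + N) i j k x v\<bar> \<le> dominator i j k p x" for N
  proof (rule AE_I2)
    fix x :: "(int ^ 'd) set \<Rightarrow> real" assume x: "x \<in> space \<mu>"
    show "\<bar>avg_time (N0 + N) i j k x v\<bar> \<le> dominator i j k p x"
      using avg_time_bounds[OF p N, where x = x, OF edge_nonneg[OF x], where i = i and j = j and k = k] by simp
  qed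
  have b: "M.expectation (\<lambda>x. (avg_time (N0 + N) i j k x v)\<^sup>2) - (M.expectation (\<lambda>x. avg_time (N0 + N) i j k x v))\<^sup>2 \<le> B" for N
    using N in_box by (intro bound) auto
  note res = M.second_moment_limit[OF m' m dominator_integrable[OF p] AE_I2[OF lim] dom b]
  show "integrable \<mu> (\<lambda>x. (avg_fpp i j k x v)\<^sup>2)" by (rule res(1))
  show "integral\<^sup>L \<mu> (\<lambda>x. (avg_fpp i j k x v)\<^sup>2) - (integral\<^sup>L \<mu> (\<lambda>x. avg_fpp i j k x v))\<^sup>2 \<le> B" by (rule res(2))
qed

end

section \<open>Choice of the scale and conclusion\<close>

lemma growth_estimate:
  assumes L: "65536 \<le> L" and C: "0 \<le> C" "0 \<le> m"
  defines "k \<equiv> nat \<lfloor>L powr (1 / 8)\<rfloor>"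
  shows "2 \<le> k" "2 * (C * (L + 1) / ln (real k)) + 128 * m * real k ^ 4 \<le> (64 * C + 256 * m) * (L / ln L)"
proof -
  define a where "a = L powr (1 / 8)"
  have L0: "0 < L" using L by simp
  \<comment> \<open>Here \<open>65536 = 4 ^ 8\<close>. From \<open>a >= 4\<close> one gets
    \<open>sqrt a <= a / 2 <= k\<close>, whence \<open>ln k >= ln L / 16\<close> despite the
    rounding.\<close>
  have a4: "4 \<le> a"
  proof -
    have "(4::real) = (4 powr 8) powr (1 / 8)" unfolding powr_powr by simp
    also have "4 powr 8 = (65536 :: real)" by simp
    also have "65536 powr (1 / 8) \<le> L powr (1 / 8)" using L by (intro powr_mono2) auto
    finally show ?thesis by (simp add: a_def)
  qed
  have k: "real k \<le> a" "a - 1 < real k" using a4 unfolding k_def a_def[symmetric] by linarith+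
  show k2: "2 \<le> k" using k a4 by linarith
  have lnL: "0 < ln L" using L by simp
  have lnk: "ln L / 16 \<le> ln (real k)"
  proof -
    have s: "2 \<le> sqrt a" using a4 real_le_rsqrt[of 2 a] by simp
    have "sqrt a * 2 \<le> sqrt a * sqrt a" using s a4 by (intro mult_left_mono) auto
    moreover have "sqrt a * sqrt a = a" using a4 by simp
    ultimately have "sqrt a \<le> a / 2" by linarith
    also have "\<dots> \<le> real k" using k a4 by linarith
    finally have "ln (sqrt a) \<le> ln (real k)" using a4 k2 by (subst ln_le_cancel_iff) auto
    moreover have "ln (sqrt a) = ln L / 16" using L0 a4 by (simp add: ln_sqrt a_def ln_powr)
    ultimately show ?thesis by simp
  qed
  have k4: "real k ^ 4 \<le> sqrt L"
  proof -
    have "real k ^ 4 \<le> a ^ 4" using k by (intro power_mono) auto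
    also have "\<dots> = a powr 4" using a4 by simp
    also have "\<dots> = L powr (1 / 2)" unfolding a_def powr_powr by simp
    also have "\<dots> = sqrt L" using L0 by (simp add: powr_half_sqrt)
    finally show ?thesis .
  qed
  \<comment> \<open>The translation cost \<open>k^4 <= sqrt L\<close> is thereby absorbed into
    \<open>L / ln L\<close>.\<close>
  have sqrt_le: "sqrt L \<le> 2 * (L / ln L)"
  proof -
    have "ln (sqrt L) \<le> sqrt L - 1" using L0 by (intro ln_le_minus_one) simp
    then have "ln L \<le> 2 * sqrt L" using L0 by (simp add: ln_sqrt)
    then have "sqrt L * ln L \<le> sqrt L * (2 * sqrt L)" using L0 by (intro mult_left_mono) auto
    also have "\<dots> = 2 * L" using L0 by simp
    finally have "sqrt L \<le> 2 * L / ln L" unfolding pos_le_divide_eq[OF lnL] .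
    then show ?thesis by simp
  qed
  have "C * (L + 1) / ln (real k) \<le> C * (2 * L) / (ln L / 16)"
    using lnk lnL C L by (intro frac_le mult_left_mono) auto
  also have "\<dots> = 32 * C * (L / ln L)" by simp
  finally have 1: "C * (L + 1) / ln (real k) \<le> 32 * C * (L / ln L)" .
  have 2: "m * real k ^ 4 \<le> m * (2 * (L / ln L))"
    using k4 sqrt_le C by (intro mult_left_mono) auto
  have eq: "(64 * C + 256 * m) * Y = 2 * (32 * C * Y) + 128 * (m * (2 * Y))" for Y
    by (simp add: algebra_simps)
  show "2 * (C * (L + 1) / ln (real k)) + 128 * m * real k ^ 4 \<le> (64 * C + 256 * m) * (L / ln L)"
    unfolding eq mult.assoc[of 128 m]
    by (rule add_mono) (rule mult_left_mono[OF 1], simp, rule mult_left_mono[OF 2], simp)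
qed

context nearly_gamma_law
begin

text \<open>A detour from \<open>0\<close> over \<open>z\<close> and \<open>z + v\<close> to
  \<open>v\<close>, and the reverse comparison, bound the difference of the two passage times by
  four paths of length at most \<open>2 * k^2\<close>. Cauchy-Schwarz over the four paths gives the
  constant \<open>4 * 4 * 2^2 = 64\<close>.\<close>

lemma fpp_avg_distance:
  fixes v :: "int ^ 'd::finite"
  assumes ij: "i \<noteq> j" and k: "0 < k"
  shows "integrable \<mu> (\<lambda>x. (fpp_dist x 0 v - avg_fpp i j k x v)\<^sup>2)"
    "integral\<^sup>L \<mu> (\<lambda>x. (fpp_dist x 0 v - avg_fpp i j k x v)\<^sup>2) \<le> 64 * expectation (\<lambda>y. y\<^sup>2) * real k ^ 4"
proof -
  let ?B = "square i j (k\<^sup>2) :: (int ^ 'd) set"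
  define m2 where "m2 = expectation (\<lambda>y. y\<^sup>2)"
  have cardB: "real (card ?B) = real k ^ 4" unfolding card_square[OF ij] by (simp flip: power_mult)
  have k0: "0 < real k ^ 4" using k by simp
  define \<pi> where "\<pi> u w = (SOME p. lattice_path u w p \<and> real (length p - 1) = l1_norm (u - w))" for u w :: "int ^ 'd"
  have \<pi>: "lattice_path u w (\<pi> u w)" "real (length (\<pi> u w) - 1) = l1_norm (u - w)" for u w
  proof -
    have "\<exists>p. lattice_path u w p \<and> real (length p - 1) = l1_norm (u - w)"
      using geodesic_set_UNIV unfolding geodesic_set_def by blast
    from someI_ex[OF this] show "lattice_path u w (\<pi> u w)" "real (length (\<pi> u w) - 1) = l1_norm (u - w)"
      unfolding \<pi>_def by blast+
  qed
  \<comment> \<open>Paths have a direction, so each connection is listed both ways; indexing by a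
    list makes \<open>R\<close> a sum to which \<open>sum_square_integrable\<close> applies.\<close>
  define J where "J z = [(0, z), (z + v, v), (z, 0), (v, z + v)]" for z :: "int ^ 'd"
  define R where "R z x = (\<Sum>l<4. path_time x (\<pi> (fst (J z ! l)) (snd (J z ! l))))" for z x
  have R_eq: "R z x = path_time x (\<pi> 0 z) + path_time x (\<pi> (z + v) v) + path_time x (\<pi> z 0) + path_time x (\<pi> v (z + v))" for z x
    by (simp add: R_def J_def eval_nat_numeral)
  have norm_le: "l1_norm (fst (J z ! l) - snd (J z ! l)) \<le> 2 * real (k\<^sup>2)" if z: "z \<in> ?B" and l: "l < 4" for z l
  proof -
    have "l1_norm z \<le> 2 * real (k\<^sup>2)" by (rule square_l1_norm(2)[OF z z])
    moreover have "l1_norm (0 - z) = l1_norm z" using l1_norm_minus[of 0 z] by simp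
    moreover have "l = 0 \<or> l = 1 \<or> l = 2 \<or> l = 3" using l by linarith
    ultimately show ?thesis unfolding J_def using l1_norm_minus[of v "z + v"] by auto
  qed
  have R_mom: "integral\<^sup>L \<mu> (\<lambda>x. (path_time x (\<pi> (fst (J z ! l)) (snd (J z ! l))))\<^sup>2) \<le> 4 * real k ^ 4 * m2"
    if z: "z \<in> ?B" and l: "l < 4" for z l
  proof -
    let ?u = "fst (J z ! l)" and ?w = "snd (J z ! l)"
    have "integral\<^sup>L \<mu> (\<lambda>x. (path_time x (\<pi> ?u ?w))\<^sup>2) \<le> (l1_norm (?u - ?w))\<^sup>2 * m2"
      using path_time_second_moment(2)[OF \<pi>(1)[of ?u ?w]] \<pi>(2)[of ?u ?w] by (simp add: m2_def)
    also have "\<dots> \<le> (2 * real (k\<^sup>2))\<^sup>2 * m2"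
      using norm_le[OF z l] l1_norm_nonneg by (intro mult_right_mono power_mono) (auto simp: m2_def)
    also have "\<dots> = 4 * real k ^ 4 * m2" by (simp add: power_mult_distrib flip: power_mult)
    finally show ?thesis .
  qed
  have R_meas: "R z \<in> borel_measurable \<mu>" for z
    unfolding R_def by (intro borel_measurable_sum path_time_measurable[OF \<pi>(1)])
  have R_int: "integrable \<mu> (\<lambda>x. (R z x)\<^sup>2)" for z
    unfolding R_def by (rule sum_square_integrable(1)) (auto intro: path_time_measurable[OF \<pi>(1)] path_time_second_moment(1)[OF \<pi>(1)])
  have R_le: "integral\<^sup>L \<mu> (\<lambda>x. (R z x)\<^sup>2) \<le> 64 * m2 * real k ^ 4" if z: "z \<in> ?B" for z
  proof -
    have "integral\<^sup>L \<mu> (\<lambda>x. (R z x)\<^sup>2) \<le> real (card {..<4::nat}) * (\<Sum>l<4. integral\<^sup>L \<mu> (\<lambda>x. (path_time x (\<pi> (fst (J z ! l)) (snd (J z ! l))))\<^sup>2))"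
      unfolding R_def by (rule sum_square_integrable(2)) (auto intro: path_time_measurable[OF \<pi>(1)] path_time_second_moment(1)[OF \<pi>(1)])
    also have "\<dots> \<le> real (card {..<4::nat}) * (\<Sum>l<4::nat. 4 * real k ^ 4 * m2)"
      using R_mom[OF z] by (intro mult_left_mono sum_mono) auto
    also have "\<dots> = 64 * m2 * real k ^ 4" by simp
    finally show ?thesis .
  qed
  have diff: "\<bar>fpp_dist x 0 v - fpp_dist x z (z + v)\<bar> \<le> R z x" if x: "x \<in> space \<mu>" for x z
  proof -
    have pos: "0 \<le> path_time x (\<pi> u w)" for u w
      using \<pi>(1) edge_nonneg[OF x] by (rule path_time_nonneg)
    have "fpp_dist x 0 v \<le> path_time x (\<pi> 0 z) + fpp_dist x z (z + v) + path_time x (\<pi> (z + v) v)"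
      by (intro fpp_dist_triangle \<pi> edge_nonneg x)
    moreover have "fpp_dist x z (z + v) \<le> path_time x (\<pi> z 0) + fpp_dist x 0 v + path_time x (\<pi> v (z + v))"
      by (intro fpp_dist_triangle \<pi> edge_nonneg x)
    ultimately show ?thesis
      unfolding R_eq using pos[of 0 z] pos[of "z + v" v] pos[of z 0] pos[of v "z + v"] by linarith
  qed
  define U where "U x = (\<Sum>z\<in>?B. R z x) / real k ^ 4" for x
  have le: "\<bar>fpp_dist x 0 v - avg_fpp i j k x v\<bar> \<le> U x" if x: "x \<in> space \<mu>" for x
  proof -
    have "fpp_dist x 0 v - avg_fpp i j k x v = (\<Sum>z\<in>?B. fpp_dist x 0 v - fpp_dist x z (z + v)) / real k ^ 4"
      unfolding avg_fpp_def sum_subtractf using k0 by (simp add: cardB diff_divide_distrib)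
    also have "\<bar>\<dots>\<bar> \<le> (\<Sum>z\<in>?B. \<bar>fpp_dist x 0 v - fpp_dist x z (z + v)\<bar>) / real k ^ 4"
      by (simp add: divide_right_mono)
    also have "\<dots> \<le> U x" unfolding U_def using diff[OF x] by (intro divide_right_mono sum_mono) auto
    finally show ?thesis .
  qed
  have U_int: "integrable \<mu> (\<lambda>x. (U x)\<^sup>2)"
    unfolding U_def power_divide
    using sum_square_integrable(1)[of ?B R \<mu>] R_meas R_int by simp
  have meas: "(\<lambda>x. fpp_dist x 0 v - avg_fpp i j k x v) \<in> borel_measurable \<mu>"
    unfolding avg_fpp_def
    by (intro borel_measurable_diff borel_measurable_divide borel_measurable_sum fpp_dist_measurable) auto
  have sq: "(fpp_dist x 0 v - avg_fpp i j k x v)\<^sup>2 \<le> (U x)\<^sup>2" if "x \<in> space \<mu>" for x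
    using power_mono[OF le[OF that] abs_ge_zero, of 2] by simp
  show int: "integrable \<mu> (\<lambda>x. (fpp_dist x 0 v - avg_fpp i j k x v)\<^sup>2)"
  proof (rule Bochner_Integration.integrable_bound[OF U_int])
    show "AE x in \<mu>. norm ((fpp_dist x 0 v - avg_fpp i j k x v)\<^sup>2) \<le> norm ((U x)\<^sup>2)"
      using sq by (intro AE_I2) simp
  qed (use meas in \<open>rule borel_measurable_power\<close>)
  have "integral\<^sup>L \<mu> (\<lambda>x. (fpp_dist x 0 v - avg_fpp i j k x v)\<^sup>2) \<le> integral\<^sup>L \<mu> (\<lambda>x. (U x)\<^sup>2)"
    by (rule integral_mono[OF int U_int sq])
  also have "\<dots> = integral\<^sup>L \<mu> (\<lambda>x. (\<Sum>z\<in>?B. R z x)\<^sup>2) / (real k ^ 4)\<^sup>2"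
    unfolding U_def power_divide by (rule integral_divide_zero)
  also have "\<dots> \<le> (real (card ?B) * (\<Sum>z\<in>?B. integral\<^sup>L \<mu> (\<lambda>x. (R z x)\<^sup>2))) / (real k ^ 4)\<^sup>2"
    by (intro divide_right_mono sum_square_integrable(2) R_meas R_int) auto
  also have "\<dots> \<le> (real (card ?B) * (\<Sum>z\<in>?B. 64 * m2 * real k ^ 4)) / (real k ^ 4)\<^sup>2"
    using R_le by (intro divide_right_mono mult_left_mono sum_mono) auto
  also have "\<dots> = 64 * m2 * real k ^ 4"
    using k0 by (simp only: sum_constant cardB) (simp add: power2_eq_square)
  finally show "integral\<^sup>L \<mu> (\<lambda>x. (fpp_dist x 0 v - avg_fpp i j k x v)\<^sup>2) \<le> 64 * expectation (\<lambda>y. y\<^sup>2) * real k ^ 4"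
    by (simp only: m2_def)
qed

text \<open>The passage time is compared with its average over translates. The variance of the
  average is of order \<open>|v| / ln k\<close>, the mean square error of order \<open>k^4\<close>,
  and \<open>growth_estimate\<close> balances the two. The dimension provides the two directions of
  the square.\<close>

lemma fpp_variance_bound:
  assumes "CARD('d::finite) \<ge> 2"
  shows "\<exists>C\<ge>0. \<forall>v :: int ^ 'd. 65536 \<le> l1_norm v \<longrightarrow>
    prob_space.variance \<mu> (\<lambda>x. fpp_dist x 0 v) \<le> C * (l1_norm v / ln (l1_norm v))"
proof -
  interpret M: prob_space "\<mu> :: ((int ^ 'd) set \<Rightarrow> real) measure" by (rule prob_space_fpp)
  have "\<not> (\<forall>i\<in>UNIV :: 'd set. \<forall>j\<in>UNIV. i = j)"
    using assms card_le_Suc0_iff_eq[of "UNIV :: 'd set"] by simp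
  then obtain i j :: 'd where ij: "i \<noteq> j" by blast
  obtain C n0 where C: "0 \<le> C" and
    disc: "\<And>n k N v. n0 \<le> n \<Longrightarrow> 2 \<le> k \<Longrightarrow> v \<in> lattice_box (int N) \<Longrightarrow>
      ln (real k) * (cube_avg (avg_edges N i j k \<times> {..<n}) (\<lambda>A. (avg_time N i j k (Q.wt n A) v)\<^sup>2)
        - (cube_avg (avg_edges N i j k \<times> {..<n}) (\<lambda>A. avg_time N i j k (Q.wt n A) v))\<^sup>2)
      \<le> C * (l1_norm v + 1)"
    using Q.avg_time_variance[where 'd = 'd] ij by blast
  define m2 where "m2 = expectation (\<lambda>y. y\<^sup>2)"
  have m2: "0 \<le> m2" by (simp add: m2_def)
  have bound: "M.variance (\<lambda>x. fpp_dist x 0 v) \<le> (64 * C + 256 * m2) * (l1_norm v / ln (l1_norm v))"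
    if v: "65536 \<le> l1_norm v" for v :: "int ^ 'd"
  proof -
    define k where "k = nat \<lfloor>l1_norm v powr (1 / 8)\<rfloor>"
    note growth = growth_estimate[OF v C m2, folded k_def]
    have lnk: "0 < ln (real k)" using growth(1) by simp
    obtain p where p: "lattice_path 0 v p" using geodesic_set_UNIV unfolding geodesic_set_def by blast
    have avgN: "integral\<^sup>L \<mu> (\<lambda>x. (avg_time N i j k x v)\<^sup>2) - (integral\<^sup>L \<mu> (\<lambda>x. avg_time N i j k x v))\<^sup>2 \<le> C * (l1_norm v + 1) / ln (real k)"
      if N: "v \<in> lattice_box (int N)" for N
    proof -
      have "(0 :: int ^ 'd) \<in> lattice_box (int N)" by (simp add: lattice_box_def)
      then obtain r where r: "lattice_path 0 v r" "set r \<subseteq> lattice_box (int N)"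
        using geodesic_set_box N unfolding geodesic_set_def by blast
      show ?thesis
      proof (rule avg_time_limit[OF r])
        fix n assume "n0 \<le> n"
        from disc[OF this growth(1) N] show "cube_avg (avg_edges N i j k \<times> {..<n}) (\<lambda>A. (avg_time N i j k (Q.wt n A) v)\<^sup>2)
            - (cube_avg (avg_edges N i j k \<times> {..<n}) (\<lambda>A. avg_time N i j k (Q.wt n A) v))\<^sup>2 \<le> C * (l1_norm v + 1) / ln (real k)"
          unfolding pos_le_divide_eq[OF lnk] mult.commute[of _ "ln (real k)"] .
      qed
    qed
    have avg: "(\<lambda>x. avg_fpp i j k x v) \<in> borel_measurable \<mu>" "integrable \<mu> (\<lambda>x. (avg_fpp i j k x v)\<^sup>2)"
      "integral\<^sup>L \<mu> (\<lambda>x. (avg_fpp i j k x v)\<^sup>2) - (integral\<^sup>L \<mu> (\<lambda>x. avg_fpp i j k x v))\<^sup>2 \<le> C * (l1_norm v + 1) / ln (real k)"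
      by (rule avg_fpp_variance[OF p], erule avgN)+
    have "0 < k" using growth(1) by simp
    note dist = fpp_avg_distance[OF ij this, of v]
    have "M.variance (\<lambda>x. fpp_dist x 0 v) \<le>
      2 * (M.expectation (\<lambda>x. (avg_fpp i j k x v)\<^sup>2) - (M.expectation (\<lambda>x. avg_fpp i j k x v))\<^sup>2)
      + 2 * M.expectation (\<lambda>x. (fpp_dist x 0 v - avg_fpp i j k x v)\<^sup>2)" (is "_ \<le> 2 * ?a + 2 * ?b")
      by (rule M.variance_le_perturbation[OF fpp_dist_measurable avg(1,2) dist(1)])
    also have "2 * ?a + 2 * ?b \<le> 2 * (C * (l1_norm v + 1) / ln (real k)) + 2 * (64 * m2 * real k ^ 4)"
      using avg(3) dist(2)[folded m2_def] by (intro add_mono mult_left_mono zero_le_numeral)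
    also have "\<dots> \<le> (64 * C + 256 * m2) * (l1_norm v / ln (l1_norm v))" using growth(2) by simp
    finally show ?thesis .
  qed
  show ?thesis
    by (rule exI[of _ "64 * C + 256 * m2"], intro conjI allI impI bound) (use C m2 in auto)
qed

end

theorem theorem4p4:
  fixes \<nu> :: "real measure"
  assumes "CARD('d::finite) \<ge> 2"
    and "nearly_gamma \<nu>"
    and "integrable \<nu> (\<lambda>y. y ^ 2)"
  shows "(\<lambda>v :: int ^ 'd. prob_space.variance (fpp_measure \<nu>) (\<lambda>x. fpp_dist x 0 v))
           \<in> O[filtercomap l1_norm at_top](\<lambda>v. l1_norm v / ln (l1_norm v))"
proof -
  interpret nearly_gamma_law \<nu> by unfold_locales (rule assms(2))
  from fpp_variance_bound[OF assms(1)] obtain C where C: "0 \<le> C \<and> (\<forall>v :: int ^ 'd. 65536 \<le> l1_norm v \<longrightarrow>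
      prob_space.variance (fpp_measure \<nu>) (\<lambda>x. fpp_dist x 0 v) \<le> C * (l1_norm v / ln (l1_norm v)))"
    by (rule exE)
  have "\<forall>\<^sub>F v :: int ^ 'd in filtercomap l1_norm at_top. 65536 \<le> l1_norm v"
    using eventually_ge_at_top[of "65536 :: real"] by (rule eventually_filtercomapI)
  then have "\<forall>\<^sub>F v :: int ^ 'd in filtercomap l1_norm at_top.
      norm (prob_space.variance (fpp_measure \<nu>) (\<lambda>x. fpp_dist x 0 v)) \<le> C * norm (l1_norm v / ln (l1_norm v))"
  proof eventually_elim
    case (elim v)
    have "0 \<le> prob_space.variance (fpp_measure \<nu>) (\<lambda>x. fpp_dist x 0 v)"
      by (intro Bochner_Integration.integral_nonneg) simp
    moreover have "prob_space.variance (fpp_measure \<nu>) (\<lambda>x. fpp_dist x 0 v) \<le> C * (l1_norm v / ln (l1_norm v))"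
      using C elim by (elim conjE allE impE)
    moreover have "0 \<le> l1_norm v / ln (l1_norm v)" using elim by simp
    ultimately show ?case by (simp only: real_norm_def abs_of_nonneg)
  qed
  then show ?thesis by (rule bigoI)
qed

end
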